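(* Let $M$ be a closed oriented Riemannian three-manifold with a finite triangulation $K$, and let $C^1(K)=V_{\mathrm p}\oplus V_{\mathrm g}$ be the orthogonal splitting with $V_{\mathrm p}=\mathcal H^1_K\oplus\operatorname{im}\delta_1^\ast$ and $V_{\mathrm g}=\operatorname{im}\delta_0$. Let $\bar\mu,\bar\nu$ be nondegenerate Gaussian probability measures on $V_{\mathrm p}$, and let $\operatorname{Ext}_{\mathrm G}(\bar\mu)$ be the set of nondegenerate Gaussian measures $\mu$ on $V_{\mathrm p}\oplus V_{\mathrm g}$ with $(P_{\mathrm p})_\#\mu=\bar\mu$; define $\operatorname{Ext}_{\mathrm G}(\bar\nu)$ analogously. Then $$D(\bar\mu\|\bar\nu)=\min_{\substack{\mu\in\operatorname{Ext}_{\mathrm G}(\bar\mu)\\ \nu\in\operatorname{Ext}_{\mathrm G}(\bar\nu)}}D(\mu\|\nu)$$ (in particular the minimum is attained). A pair $(\mu,\nu)\in\operatorname{Ext}_{\mathrm G}(\bar\mu)\times\operatorname{Ext}_{\mathrm G}(\bar\nu)$ attains the minimum if and only if the conditional gauge distributions satisfy $\mu_{\mathrm g|x}=\nu_{\mathrm g|x}$ for $\bar\mu$-almost every $x\in V_{\mathrm p}$.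
   Context: $C^k(K)=C^k(K;\mathbb R)$ is the space of real simplicial $k$-cochains of $K$, $\delta_k:C^k(K)\to C^{k+1}(K)$ is the coboundary, and $W_k:C^k(K)\to\Omega^k_{\mathrm{pw}}(M)$ are the Whitney maps into piecewise smooth forms (the linear maps sending the cochain dual to an oriented simplex $[v_0,\dots,v_k]$ to $k!\sum_{i}(-1)^i\lambda_i\,d\lambda_0\wedge\cdots\wedge\widehat{d\lambda_i}\wedge\cdots\wedge d\lambda_k$, with $\lambda_i$ the barycentric coordinate function of $v_i$). Each $C^k(K)$ carries the Whitney inner product $\langle u,v\rangle_k=\int_M W_k(u)\wedge\star W_k(v)$, and $\delta_k^\ast$ denotes the adjoint of $\delta_k$ for these inner products. The harmonic space is $\mathcal H^1_K=\ker\delta_1\cap\ker\delta_0^\ast$, and one has the orthogonal discrete Hodge decomposition $C^1(K)=\operatorname{im}\delta_0\oplus\mathcal H^1_K\oplus\operatorname{im}\delta_1^\ast$. $P_{\mathrm p}:C^1(K)\to V_{\mathrm p}$ is the orthogonal projection onto $V_{\mathrm p}$ (with kernel $V_{\mathrm g}$), and $(P_{\mathrm p})_\#$ denotes pushforward of measures. Elements of $C^1(K)$ are written in Whitney-orthonormal coordinates as $a=(x,y)$ with $x\in V_{\mathrm p}$, $y\in V_{\mathrm g}$. Nondegenerate Gaussian means with positive definite covariance matrix. If $\mu$ has (Lebesgue) density $f(x,y)=f_{\mathrm p}(x)f_{\mathrm g|x}(y)$, where $f_{\mathrm p}$ is the density of $(P_{\mathrm p})_\#\mu$, then $\mu_{\mathrm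 g|x}$ is the probability measure on $V_{\mathrm g}$ with density $f_{\mathrm g|x}=f(x,\cdot)/f_{\mathrm p}(x)$; similarly for $\nu$. For probability measures with densities $f,g$ the relative entropy is $D(f\|g)=\int f\log(f/g)$. *)

theory Defs
  imports "HOL-Probability.Probability" "HOL-Combinatorics.Permutations"
begin

primrec k_smooth_on :: "nat \<Rightarrow> 'a::real_normed_vector set \<Rightarrow> ('a \<Rightarrow> 'b::real_normed_vector) \<Rightarrow> bool" where
  "k_smooth_on 0 S f \<longleftrightarrow> continuous_on S f"
| "k_smooth_on (Suc k) S f \<longleftrightarrow>
     (\<forall>x\<in>S. f differentiable at x) \<and> (\<forall>w. k_smooth_on k S (\<lambda>x. frechet_derivative f (at x) w))"

definition smooth_on :: "'a::real_normed_vector set \<Rightarrow> ('a \<Rightarrow> 'b::real_normed_vector) \<Rightarrow> bool" where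
  "smooth_on S f \<longleftrightarrow> open S \<and> (\<forall>k. k_smooth_on k S f)"

type_synonym 'm chart = "'m set \<times> ('m \<Rightarrow> real^3)"

definition transition :: "'m chart \<Rightarrow> 'm chart \<Rightarrow> real^3 \<Rightarrow> real^3" where
  "transition c d = snd d \<circ> inv_into (fst c) (snd c)"

definition jacobian :: "(real^3 \<Rightarrow> real^3) \<Rightarrow> real^3 \<Rightarrow> real^3^3" where
  "jacobian f x = matrix (frechet_derivative f (at x))"

text \<open>The manifold is a subset of a Hausdorff space, with the subspace topology.
  Second countability is automatic for a compact space covered by charts.\<close>

definition closed_oriented_3manifold :: "'m::t2_space set \<Rightarrow> 'm chart set \<Rightarrow> bool" where
  "closed_oriented_3manifold M A \<longleftrightarrow>
     compact M \<and> (\<Union>c\<in>A. fst c) = M \<and>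
     (\<forall>c\<in>A. openin (top_of_set M) (fst c) \<and> open (snd c ` fst c) \<and>
        (\<exists>\<psi>. homeomorphism (fst c) (snd c ` fst c) (snd c) \<psi>)) \<and>
     (\<forall>c\<in>A. \<forall>d\<in>A. smooth_on (snd c ` (fst c \<inter> fst d)) (transition c d) \<and>
        (\<forall>x \<in> snd c ` (fst c \<inter> fst d). det (jacobian (transition c d) x) > 0))"

text \<open>A metric is given by its Gram matrix \<^term>\<open>g c p\<close> at each point \<open>p\<close> of each chart \<open>c\<close>.\<close>

definition riemannian_metric ::
    "'m chart set \<Rightarrow> ('m chart \<Rightarrow> 'm \<Rightarrow> real^3^3) \<Rightarrow> bool" where
  "riemannian_metric A g \<longleftrightarrow>
     (\<forall>c\<in>A. smooth_on (snd c ` fst c) (\<lambda>x. g c (inv_into (fst c) (snd c) x)) \<and>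
        (\<forall>p\<in>fst c. transpose (g c p) = g c p \<and> (\<forall>w. w \<noteq> 0 \<longrightarrow> w \<bullet> (g c p *v w) > 0))) \<and>
     (\<forall>c\<in>A. \<forall>d\<in>A. \<forall>p \<in> fst c \<inter> fst d.
        g c p = transpose (jacobian (transition c d) (snd c p)) ** g d p
                  ** jacobian (transition c d) (snd c p))"

text \<open>An abstract simplicial complex on a finite vertex type is realized in \<open>real^'v\<close>,
  where the \<open>v\<close>-th coordinate of a point is its barycentric coordinate at the vertex \<open>v\<close>.\<close>

definition simplicial_cplx :: "'v::finite set set \<Rightarrow> bool" where
  "simplicial_cplx K \<longleftrightarrow> {} \<notin> K \<and> (\<forall>s\<in>K. \<forall>t. t \<subseteq> s \<and> t \<noteq> {} \<longrightarrow> t \<in> K)"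

definition closed_simplex :: "'v::finite set \<Rightarrow> (real^'v) set" where
  "closed_simplex s = {x. (\<forall>v. 0 \<le> x $ v) \<and> (\<Sum>v\<in>UNIV. x $ v) = 1 \<and> (\<forall>v. v \<notin> s \<longrightarrow> x $ v = 0)}"

definition realization :: "'v::finite set set \<Rightarrow> (real^'v) set" where
  "realization K = (\<Union>s\<in>K. closed_simplex s)"

text \<open>The homeomorphism is a smooth immersion on each closed simplex: in charts it extends
  locally to a smooth map whose differential is injective on the directions of the simplex.\<close>

definition smooth_triangulation ::
    "'m::t2_space set \<Rightarrow> 'm chart set \<Rightarrow> 'v::finite set set \<Rightarrow> ((real, 'v) vec \<Rightarrow> 'm) \<Rightarrow> bool" where
  "smooth_triangulation M A K h \<longleftrightarrow>
     simplicial_cplx K \<and> (\<exists>h'. homeomorphism (realization K) M h h') \<and>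
     (\<forall>s\<in>K. \<forall>x\<in>closed_simplex s. \<forall>c\<in>A. h x \<in> fst c \<longrightarrow>
        (\<exists>N F. x \<in> N \<and> smooth_on N F \<and>
           (\<forall>y \<in> N \<inter> closed_simplex s. h y \<in> fst c \<and> F y = snd c (h y)) \<and>
           (\<forall>w. (\<forall>v. v \<notin> s \<longrightarrow> w $ v = 0) \<and> (\<Sum>v\<in>UNIV. w $ v) = 0 \<and> w \<noteq> 0 \<longrightarrow>
              frechet_derivative F (at x) w \<noteq> 0)))"

text \<open>A linear order on the vertices orients every simplex. A \<open>k\<close>-cochain is given by its
  values on the simplices so oriented, as a vector indexed by all vertex sets which vanishes
  outside the \<open>k\<close>-simplices of \<open>K\<close>.\<close>

type_synonym 'v cochain = "real^('v set)"

definition cochains :: "'v::finite set set \<Rightarrow> nat \<Rightarrow> 'v cochain set" where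
  "cochains K k = {u. \<forall>s. u $ s \<noteq> 0 \<longrightarrow> s \<in> K \<and> card s = k + 1}"

definition coboundary :: "'v::{finite,linorder} set set \<Rightarrow> nat \<Rightarrow> 'v cochain \<Rightarrow> 'v cochain" where
  "coboundary K k u =
     (\<chi> s. if s \<in> K \<and> card s = k + 2
           then \<Sum>i<k+2. (-1) ^ i * u $ (s - {sorted_list_of_set s ! i}) else 0)"

text \<open>Each tetrahedron is parametrized by the standard simplex of \<open>real^3\<close>. A piecewise smooth
  form is represented by its pullbacks to these parameter domains, and a \<open>k\<close>-form at a point by
  its values on lists of \<open>k\<close> tangent vectors.\<close>

definition std_tet_interior :: "(real^3) set" where
  "std_tet_interior = {x. (\<forall>i. 0 < x $ i) \<and> (\<Sum>i\<in>UNIV. x $ i) < 1}"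

definition tet_param :: "'v::{finite,linorder} set \<Rightarrow> real^3 \<Rightarrow> (real, 'v) vec" where
  "tet_param T x = (let vs = sorted_list_of_set T in
     (1 - x$1 - x$2 - x$3) *\<^sub>R axis (vs!0) 1 + x$1 *\<^sub>R axis (vs!1) 1
       + x$2 *\<^sub>R axis (vs!2) 1 + x$3 *\<^sub>R axis (vs!3) 1)"

definition bary :: "'v::{finite,linorder} set \<Rightarrow> 'v \<Rightarrow> real^3 \<Rightarrow> real" where
  "bary T v x = tet_param T x $ v"

definition wedge :: "('a \<Rightarrow> real) list \<Rightarrow> 'a list \<Rightarrow> real" where
  "wedge \<alpha>s ws = (\<Sum>p | p permutes {..<length \<alpha>s}.
     of_int (sign p) * (\<Prod>i<length \<alpha>s. (\<alpha>s ! i) (ws ! p i)))"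

definition whitney_elem ::
    "'v::{finite,linorder} set \<Rightarrow> 'v list \<Rightarrow> real^3 \<Rightarrow> (real^3) list \<Rightarrow> real" where
  "whitney_elem T vs x ws = fact (length vs - 1) *
     (\<Sum>i<length vs. (-1) ^ i * bary T (vs ! i) x *
        wedge (map (\<lambda>v. frechet_derivative (bary T v) (at x)) (take i vs @ drop (Suc i) vs)) ws)"

definition whitney ::
    "'v::{finite,linorder} set set \<Rightarrow> nat \<Rightarrow> 'v cochain \<Rightarrow> 'v set \<Rightarrow> real^3 \<Rightarrow> (real^3) list \<Rightarrow> real" where
  "whitney K k u T x ws =
     (\<Sum>s | s \<in> K \<and> card s = k + 1. u $ s * whitney_elem T (sorted_list_of_set s) x ws)"

definition tet_metric ::
    "'m chart set \<Rightarrow> ('m chart \<Rightarrow> 'm \<Rightarrow> real^3^3) \<Rightarrow> ((real, 'v) vec \<Rightarrow> 'm) \<Rightarrow>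
     'v::{finite,linorder} set \<Rightarrow> real^3 \<Rightarrow> real^3^3" where
  "tet_metric A g h T x =
     (let p = h (tet_param T x);
          c = (SOME c. c \<in> A \<and> p \<in> fst c);
          J = jacobian (snd c \<circ> h \<circ> tet_param T) x
      in transpose J ** g c p ** J)"

text \<open>The inner product induced on \<open>k\<close>-forms by a metric with Gram matrix \<open>G\<close>, normalized
  such that wedges of orthonormal covectors have length one.\<close>

definition form_inner ::
    "nat \<Rightarrow> real^3^3 \<Rightarrow> ((real^3) list \<Rightarrow> real) \<Rightarrow> ((real^3) list \<Rightarrow> real) \<Rightarrow> real" where
  "form_inner k G \<omega> \<eta> = (1 / fact k) *
     (\<Sum>I | length I = k. \<Sum>J | length J = k.
        (\<Prod>a<k. matrix_inv G $ (I ! a) $ (J ! a)) *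
        \<omega> (map (\<lambda>i. axis i 1) I) * \<eta> (map (\<lambda>j. axis j 1) J))"

text \<open>The integral of \<open>W u \<and> \<star>W v\<close>. By definition of the Hodge star the integrand is the
  pointwise inner product of \<open>W u\<close> and \<open>W v\<close> times the Riemannian volume form. Over an
  oriented tetrahedron the integral of a multiple \<open>f\<close> of the volume form is that of
  \<open>f * sqrt (det G)\<close> over the parameter domain, whether or not the parametrization preserves
  orientation.\<close>

definition whitney_ip ::
    "'m chart set \<Rightarrow> ('m chart \<Rightarrow> 'm \<Rightarrow> real^3^3) \<Rightarrow> 'v::{finite,linorder} set set \<Rightarrow>
     ((real, 'v) vec \<Rightarrow> 'm) \<Rightarrow> nat \<Rightarrow> 'v cochain \<Rightarrow> 'v cochain \<Rightarrow> real" where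
  "whitney_ip A g K h k u v =
     (\<Sum>T | T \<in> K \<and> card T = 4.
        LINT x:std_tet_interior|lborel.
          form_inner k (tet_metric A g h T x) (whitney K k u T x) (whitney K k v T x)
            * sqrt (det (tet_metric A g h T x)))"

definition coboundary_adj ::
    "'m chart set \<Rightarrow> ('m chart \<Rightarrow> 'm \<Rightarrow> real^3^3) \<Rightarrow> 'v::{finite,linorder} set set \<Rightarrow>
     ((real, 'v) vec \<Rightarrow> 'm) \<Rightarrow> nat \<Rightarrow> 'v cochain \<Rightarrow> 'v cochain" where
  "coboundary_adj A g K h k v =
     (THE w. w \<in> cochains K k \<and>
        (\<forall>u\<in>cochains K k.
           whitney_ip A g K h (k+1) (coboundary K k u) v = whitney_ip A g K h k u w))"

definition harmonic1 ::
    "'m chart set \<Rightarrow> ('m chart \<Rightarrow> 'm \<Rightarrow> real^3^3) \<Rightarrow> 'v::{finite,linorder} set set \<Rightarrow>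
     ((real, 'v) vec \<Rightarrow> 'm) \<Rightarrow> 'v cochain set" where
  "harmonic1 A g K h =
     {u \<in> cochains K 1. coboundary K 1 u = 0 \<and> coboundary_adj A g K h 0 u = 0}"

definition V_p ::
    "'m chart set \<Rightarrow> ('m chart \<Rightarrow> 'm \<Rightarrow> real^3^3) \<Rightarrow> 'v::{finite,linorder} set set \<Rightarrow>
     ((real, 'v) vec \<Rightarrow> 'm) \<Rightarrow> 'v cochain set" where
  "V_p A g K h =
     {a + b | a b. a \<in> harmonic1 A g K h \<and> b \<in> coboundary_adj A g K h 1 ` cochains K 2}"

definition V_g :: "'v::{finite,linorder} set set \<Rightarrow> 'v cochain set" where
  "V_g K = coboundary K 0 ` cochains K 0"

definition P_p ::
    "'m chart set \<Rightarrow> ('m chart \<Rightarrow> 'm \<Rightarrow> real^3^3) \<Rightarrow> 'v::{finite,linorder} set set \<Rightarrow>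
     ((real, 'v) vec \<Rightarrow> 'm) \<Rightarrow> 'v cochain \<Rightarrow> 'v cochain" where
  "P_p A g K h a =
     (THE x. x \<in> V_p A g K h \<and> (\<forall>z\<in>V_p A g K h. whitney_ip A g K h 1 (a - x) z = 0))"

definition orthonormal_basis_of ::
    "('e::euclidean_space \<Rightarrow> 'e \<Rightarrow> real) \<Rightarrow> 'e set \<Rightarrow> 'e set \<Rightarrow> bool" where
  "orthonormal_basis_of ip V B \<longleftrightarrow>
     finite B \<and> span B = V \<and> (\<forall>b\<in>B. \<forall>b'\<in>B. ip b b' = of_bool (b = b'))"

text \<open>The Borel \<open>\<sigma>\<close>-algebra on the span of \<open>B\<close>, and the Lebesgue measure
  of the coordinates with respect to the basis \<open>B\<close>.\<close>

abbreviation borel_span :: "'e::euclidean_space set \<Rightarrow> 'e measure" where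
  "borel_span B \<equiv> restrict_space borel (span B)"

definition lebesgue_span :: "'e::euclidean_space set \<Rightarrow> 'e measure" where
  "lebesgue_span B =
     distr (\<Pi>\<^sub>M b\<in>B. lborel) (borel_span B) (\<lambda>c. \<Sum>b\<in>B. c b *\<^sub>R b)"

definition gauss_kernel ::
    "('e::euclidean_space \<Rightarrow> 'e \<Rightarrow> real) \<Rightarrow> 'e set \<Rightarrow> 'e \<Rightarrow> ('e \<Rightarrow> 'e \<Rightarrow> real) \<Rightarrow> 'e \<Rightarrow> real" where
  "gauss_kernel ip B m Q x =
     exp (- (\<Sum>b\<in>B. \<Sum>b'\<in>B. ip (x - m) b * Q b b' * ip (x - m) b') / 2)"

text \<open>In coordinates with respect to the \<open>ip\<close>-orthonormal set \<open>B\<close>: mean \<open>m\<close>, symmetric positive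
  definite covariance matrix \<open>S\<close>, and its inverse \<open>Q\<close>.\<close>

definition nondegenerate_gaussian ::
    "('e::euclidean_space \<Rightarrow> 'e \<Rightarrow> real) \<Rightarrow> 'e set \<Rightarrow> 'e measure \<Rightarrow> bool" where
  "nondegenerate_gaussian ip B \<mu> \<longleftrightarrow>
     (\<exists>m S Q. m \<in> span B \<and>
        (\<forall>b\<in>B. \<forall>b'\<in>B. S b b' = S b' b) \<and>
        (\<forall>c. (\<exists>b\<in>B. c b \<noteq> 0) \<longrightarrow> 0 < (\<Sum>b\<in>B. \<Sum>b'\<in>B. c b * S b b' * c b')) \<and>
        (\<forall>b\<in>B. \<forall>b'\<in>B. (\<Sum>e\<in>B. S b e * Q e b') = of_bool (b = b')) \<and>
        \<mu> = density (lebesgue_span B)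
              (\<lambda>x. ennreal (gauss_kernel ip B m Q x / (LINT y|lebesgue_span B. gauss_kernel ip B m Q y))))"

text \<open>\<open>B\<close> and \<open>C\<close> are orthonormal bases of the two summands and \<open>P\<close> is the projection onto
  the first one.\<close>

definition Ext_G ::
    "('e::euclidean_space \<Rightarrow> 'e \<Rightarrow> real) \<Rightarrow> 'e set \<Rightarrow> 'e set \<Rightarrow> ('e \<Rightarrow> 'e) \<Rightarrow> 'e measure \<Rightarrow> 'e measure set" where
  "Ext_G ip B C P \<mu>0 = {\<mu>. nondegenerate_gaussian ip (B \<union> C) \<mu> \<and> distr \<mu> (borel_span B) P = \<mu>0}"

text \<open>Densities are only determined almost everywhere, and so is the conditional distribution
  as a function of \<open>x\<close>.\<close>

definition cond_dist ::
    "'e::euclidean_space set \<Rightarrow> 'e set \<Rightarrow> ('e \<Rightarrow> 'e) \<Rightarrow> 'e measure \<Rightarrow> 'e \<Rightarrow> 'e measure" where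
  "cond_dist B C P \<mu> x =
     density (lebesgue_span C)
       (\<lambda>y. RN_deriv (lebesgue_span (B \<union> C)) \<mu> (x + y)
              / RN_deriv (lebesgue_span B) (distr \<mu> (borel_span B) P) x)"

text \<open>\<^const>\<open>KL_divergence\<close> takes the reference measure as its first measure argument.\<close>

definition rel_entropy :: "'a measure \<Rightarrow> 'a measure \<Rightarrow> real" where
  "rel_entropy \<mu> \<nu> = KL_divergence (exp 1) \<nu> \<mu>"

end

theory Submission
  imports Defs
begin

text \<open>
  Write \<open>f\<close>, \<open>g\<close> for the densities of the two extensions and \<open>p\<close>, \<open>q\<close> for their marginals. Then
  \<open>D(\<mu>\<parallel>\<nu>) - D(\<mu>0\<parallel>\<nu>0)\<close> is the integral of \<open>f ln (f / k)\<close> with \<open>k = g p / q\<close>. As \<open>k\<close> has integral one,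
  the inequality \<open>f ln (f / k) \<ge> f - k\<close> makes the difference nonnegative, and it vanishes iff
  \<open>f = k\<close> almost everywhere, that is, iff the conditional densities agree. Equality is attained by
  the products with one fixed Gaussian on the gauge part. No Gaussian integral has to be evaluated:
  quadratic bounds on the exponent give all the integrability that is needed.

  The geometry only enters through the orthogonality of \<open>V_p\<close> and \<open>V_g\<close>, that is, through
  \<open>\<delta>\<^sub>1 \<delta>\<^sub>0 = 0\<close> and the existence of the adjoints. The latter requires the Whitney inner products to be
  finite and, in degrees zero and one, definite. Finiteness follows by compactness of the
  tetrahedra, definiteness from the fact that every vertex and edge lies in a tetrahedron, as the
  manifold has dimension three.
\<close>

section \<open>Relative entropy and marginals\<close>

text \<open>Relative entropy is a Bochner integral, with value 0 on a nonintegrable integrand, so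
  integrability has to be known before the difference of two entropies can be rewritten.
  \<open>gaussian_density\<close> isolates what gives it: positivity, Gaussian decay, and a
  logarithm of at most quadratic growth. Positivity also makes each measure equivalent to Lebesgue
  measure on its span, so that almost everywhere statements can be moved between \<mu>0, \<nu>0 and
  Lebesgue measure. On the geometric side, \<open>coboundary_adj\<close> and \<open>P_p\<close> are
  definite descriptions and carry no information before existence and uniqueness are proved. The two
  adjoints that occur take values in degrees 0 and 1, which is why definiteness is shown in just
  these degrees. The obstacle is the boundary of the tetrahedra: derivatives of the triangulation
  make sense there only through local smooth extensions. So the pulled back metric is controlled in
  the interior, and bounded there by covering the closed tetrahedron with the domains of such
  extensions.\<close>

lemma ln_le_minus_one_eq_iff:
  fixes a b :: real
  assumes "a > 0" "b > 0"
  shows "a - b \<le> a * ln (a / b)" and "a * ln (a / b) = a - b \<longleftrightarrow> a = b"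
proof -
  have r: "ln (a / b) = - ln (b / a)" using assms by (simp add: ln_div)
  have "ln (b / a) \<le> b / a - 1" using assms by (intro ln_le_minus_one) simp
  then have "a * ln (b / a) \<le> a * (b / a - 1)" using assms by (intro mult_left_mono) auto
  then show "a - b \<le> a * ln (a / b)" using assms by (simp add: r algebra_simps)
  show "a * ln (a / b) = a - b \<longleftrightarrow> a = b"
  proof
    assume "a * ln (a / b) = a - b"
    then have "ln (b / a) = b / a - 1" using assms by (simp add: r field_simps)
    then have "b / a = 1" using assms by (intro ln_eq_minus_one) auto
    then show "a = b" using assms by simp
  qed (use assms in auto)
qed

text \<open>The data processing inequality for the projection to the first factor, with its equality
  case. The marginal identities are almost everywhere statements because they will come from the
  uniqueness of densities, whereas positivity is pointwise, so that logarithms and quotients can be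
  handled without exceptional sets.\<close>

lemma (in pair_sigma_finite) relative_entropy_marginal:
  fixes f g :: "'a \<times> 'b \<Rightarrow> real" and p q :: "'a \<Rightarrow> real"
  assumes meas[measurable]: "f \<in> borel_measurable (M1 \<Otimes>\<^sub>M M2)" "g \<in> borel_measurable (M1 \<Otimes>\<^sub>M M2)"
      "p \<in> borel_measurable M1" "q \<in> borel_measurable M1"
    and pos: "\<And>z. 0 < f z" "\<And>z. 0 < g z" "\<And>x. 0 < p x" "\<And>x. 0 < q x"
    and marg_f: "AE x in M1. (\<integral>\<^sup>+y. ennreal (f (x, y)) \<partial>M2) = ennreal (p x)"
    and marg_g: "AE x in M1. (\<integral>\<^sup>+y. ennreal (g (x, y)) \<partial>M2) = ennreal (q x)"
    and p1: "(\<integral>\<^sup>+x. ennreal (p x) \<partial>M1) = 1"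
    and int_f: "integrable (M1 \<Otimes>\<^sub>M M2) (\<lambda>z. f z * ln (f z / g z))"
    and int_p: "integrable M1 (\<lambda>x. p x * ln (p x / q x))"
  shows "(\<integral>x. p x * ln (p x / q x) \<partial>M1) \<le> (\<integral>z. f z * ln (f z / g z) \<partial>(M1 \<Otimes>\<^sub>M M2))" (is ?le)
    and "(\<integral>z. f z * ln (f z / g z) \<partial>(M1 \<Otimes>\<^sub>M M2)) = (\<integral>x. p x * ln (p x / q x) \<partial>M1) \<longleftrightarrow>
           (AE x in M1. AE y in M2. f (x, y) / p x = g (x, y) / q x)" (is ?eq)
proof -
  \<comment> \<open>The density with the conditionals of \<open>g\<close> and the marginal \<open>p\<close> of \<open>f\<close>: the two relative entropies
    differ by the integral of \<open>f ln (f / k) - f + k\<close>, which is nonnegative pointwise.\<close>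
  define k where "k z = p (fst z) / q (fst z) * g z" for z
  have k_meas[measurable]: "k \<in> borel_measurable (M1 \<Otimes>\<^sub>M M2)" unfolding k_def by measurable
  have k_pos: "0 < k z" for z using pos by (simp add: k_def)
  have nn_f: "(\<integral>\<^sup>+z. ennreal (f z) \<partial>(M1 \<Otimes>\<^sub>M M2)) = 1"
  proof -
    have "(\<integral>\<^sup>+z. ennreal (f z) \<partial>(M1 \<Otimes>\<^sub>M M2)) = (\<integral>\<^sup>+x. \<integral>\<^sup>+y. ennreal (f (x, y)) \<partial>M2 \<partial>M1)"
      by (rule M2.nn_integral_fst[symmetric]) measurable
    also have "\<dots> = (\<integral>\<^sup>+x. ennreal (p x) \<partial>M1)" by (rule nn_integral_cong_AE) (rule marg_f)
    finally show ?thesis using p1 by simp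
  qed
  have nn_k: "(\<integral>\<^sup>+z. ennreal (k z) \<partial>(M1 \<Otimes>\<^sub>M M2)) = 1"
  proof -
    have "(\<integral>\<^sup>+z. ennreal (k z) \<partial>(M1 \<Otimes>\<^sub>M M2)) = (\<integral>\<^sup>+x. \<integral>\<^sup>+y. ennreal (k (x, y)) \<partial>M2 \<partial>M1)"
      by (rule M2.nn_integral_fst[symmetric]) measurable
    also have "\<dots> = (\<integral>\<^sup>+x. ennreal (p x) \<partial>M1)"
    proof (rule nn_integral_cong_AE)
      show "AE x in M1. (\<integral>\<^sup>+y. ennreal (k (x, y)) \<partial>M2) = ennreal (p x)"
        using marg_g AE_space
      proof eventually_elim
        case (elim x)
        have "(\<integral>\<^sup>+y. ennreal (k (x, y)) \<partial>M2) = (\<integral>\<^sup>+y. ennreal (p x / q x) * ennreal (g (x, y)) \<partial>M2)"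
          using pos by (intro nn_integral_cong) (simp add: k_def ennreal_mult[symmetric] less_imp_le)
        also have "\<dots> = ennreal (p x / q x) * (\<integral>\<^sup>+y. ennreal (g (x, y)) \<partial>M2)"
          using elim by (intro nn_integral_cmult) measurable
        also have "\<dots> = ennreal (p x)"
          using elim pos(3)[of x] pos(4)[of x] by (simp add: ennreal_mult[symmetric] less_imp_le)
        finally show ?case .
      qed
    qed
    finally show ?thesis using p1 by simp
  qed
  have if1: "integrable (M1 \<Otimes>\<^sub>M M2) f" "(\<integral>z. f z \<partial>(M1 \<Otimes>\<^sub>M M2)) = 1"
    using nn_f pos(1) by (auto intro!: integrableI_nonneg simp: less_imp_le integral_eq_nn_integral)
  have ik1: "integrable (M1 \<Otimes>\<^sub>M M2) k" "(\<integral>z. k z \<partial>(M1 \<Otimes>\<^sub>M M2)) = 1"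
    using nn_k k_pos by (auto intro!: integrableI_nonneg simp: less_imp_le integral_eq_nn_integral)
  define r where "r x = ln (p x / q x)" for x
  have r_meas[measurable]: "r \<in> borel_measurable M1" unfolding r_def by measurable
  \<comment> \<open>By Tonelli the absolute integral of this function is that of
    \<open>p x * r x\<close>, as \<open>r\<close> depends on the first variable only.\<close>
  have int_r: "integrable (M1 \<Otimes>\<^sub>M M2) (\<lambda>z. f z * r (fst z))"
  proof (rule integrableI_bounded)
    have "(\<integral>\<^sup>+z. ennreal (norm (f z * r (fst z))) \<partial>(M1 \<Otimes>\<^sub>M M2))
        = (\<integral>\<^sup>+x. \<integral>\<^sup>+y. ennreal (norm (f (x, y) * r (fst (x, y)))) \<partial>M2 \<partial>M1)"
      by (rule M2.nn_integral_fst[symmetric]) measurable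
    also have "\<dots> = (\<integral>\<^sup>+x. ennreal (norm (p x * r x)) \<partial>M1)"
    proof (rule nn_integral_cong_AE)
      show "AE x in M1. (\<integral>\<^sup>+y. ennreal (norm (f (x, y) * r (fst (x, y)))) \<partial>M2) = ennreal (norm (p x * r x))"
        using marg_f AE_space
      proof eventually_elim
        case (elim x)
        have "(\<integral>\<^sup>+y. ennreal (norm (f (x, y) * r (fst (x, y)))) \<partial>M2)
            = (\<integral>\<^sup>+y. ennreal \<bar>r x\<bar> * ennreal (f (x, y)) \<partial>M2)"
          using pos by (intro nn_integral_cong) (simp add: abs_mult ennreal_mult less_imp_le mult.commute)
        also have "\<dots> = ennreal \<bar>r x\<bar> * (\<integral>\<^sup>+y. ennreal (f (x, y)) \<partial>M2)"
          using elim by (intro nn_integral_cmult) measurable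
        also have "\<dots> = ennreal (norm (p x * r x))"
          using elim pos(3)[of x] by (simp add: ennreal_mult[symmetric] less_imp_le abs_mult mult.commute)
        finally show ?case .
      qed
    qed
    also have "\<dots> < \<infinity>" using int_p unfolding r_def[symmetric] by (simp add: integrable_iff_bounded)
    finally show "(\<integral>\<^sup>+z. ennreal (norm (f z * r (fst z))) \<partial>(M1 \<Otimes>\<^sub>M M2)) < \<infinity>" .
  qed measurable
  have "(\<integral>z. f z * r (fst z) \<partial>(M1 \<Otimes>\<^sub>M M2)) = (\<integral>x. \<integral>y. f (x, y) * r (fst (x, y)) \<partial>M2 \<partial>M1)"
    by (rule integral_fst'[OF int_r, symmetric])
  also have "\<dots> = (\<integral>x. p x * r x \<partial>M1)"
  proof (rule integral_cong_AE)
    show "AE x in M1. (\<integral>y. f (x, y) * r (fst (x, y)) \<partial>M2) = p x * r x"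
      using marg_f AE_space
    proof eventually_elim
      case (elim x)
      have "(\<integral>y. f (x, y) \<partial>M2) = p x"
        using elim pos by (subst integral_eq_nn_integral) (auto simp: less_imp_le)
      then show ?case by simp
    qed
  qed measurable
  finally have eq_r: "(\<integral>z. f z * r (fst z) \<partial>(M1 \<Otimes>\<^sub>M M2)) = (\<integral>x. p x * ln (p x / q x) \<partial>M1)"
    by (simp add: r_def)
  define d where "d z = f z * ln (f z / k z) - (f z - k z)" for z
  \<comment> \<open>Chain rule: the logarithmic ratio of \<open>f\<close> and \<open>g\<close> is
    that of the marginals plus that of \<open>f\<close> and \<open>k\<close>.\<close>
  have split: "f z * ln (f z / g z) - f z * r (fst z) = f z * ln (f z / k z)" for z
    using pos(1)[of z] pos(2)[of z] pos(3)[of "fst z"] pos(4)[of "fst z"]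
    by (simp add: r_def k_def ln_div ln_mult algebra_simps)
  have d_alt: "d = (\<lambda>z. (f z * ln (f z / g z) - f z * r (fst z)) - (f z - k z))"
    by (rule ext) (simp only: d_def split)
  have d_nonneg: "0 \<le> d z" and d_zero: "d z = 0 \<longleftrightarrow> f z = k z" for z
    using ln_le_minus_one_eq_iff[OF pos(1)[of z] k_pos[of z]] by (auto simp: d_def)
  have int_d: "integrable (M1 \<Otimes>\<^sub>M M2) d"
    unfolding d_alt by (intro Bochner_Integration.integrable_diff int_f int_r if1 ik1)
  have "integral\<^sup>L (M1 \<Otimes>\<^sub>M M2) d = (\<integral>z. f z * ln (f z / g z) \<partial>(M1 \<Otimes>\<^sub>M M2)) - (\<integral>x. p x * ln (p x / q x) \<partial>M1)"
    unfolding d_alt using int_f int_r if1 ik1 eq_r by simp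
  moreover have "0 \<le> integral\<^sup>L (M1 \<Otimes>\<^sub>M M2) d" using d_nonneg by simp
  moreover have "integral\<^sup>L (M1 \<Otimes>\<^sub>M M2) d = 0 \<longleftrightarrow> (AE z in M1 \<Otimes>\<^sub>M M2. f z = k z)"
    by (subst integral_nonneg_eq_0_iff_AE[OF int_d]) (auto simp: d_nonneg d_zero)
  moreover have "(AE z in M1 \<Otimes>\<^sub>M M2. f z = k z) \<longleftrightarrow> (AE x in M1. AE y in M2. f (x, y) = k (x, y))"
    using AE_pair_iff[of "\<lambda>x y. f (x, y) = k (x, y)"] by simp
  moreover have "f (x, y) = k (x, y) \<longleftrightarrow> f (x, y) / p x = g (x, y) / q x" for x y
    using pos(3)[of x] pos(4)[of x] by (auto simp: k_def field_simps)
  ultimately show ?le ?eq by auto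
qed

section \<open>Gaussian densities on spans of orthonormal sets\<close>

lemma space_lebesgue_span[simp]: "space (lebesgue_span B) = span B"
  by (simp add: lebesgue_span_def space_restrict_space)

lemma sets_lebesgue_span[measurable_cong]: "sets (lebesgue_span B) = sets (borel_span B)"
  by (simp add: lebesgue_span_def)

lemma measurable_borel_span[intro]:
  "f \<in> borel_measurable borel \<Longrightarrow> f \<in> measurable (lebesgue_span B) borel"
  unfolding measurable_cong_sets[OF sets_lebesgue_span refl] by (rule measurable_restrict_space1)

text \<open>Up to the factor \<open>sqrt (pi / a)\<close> this is the centred normal density of
  variance \<open>1 / (2 * a)\<close>.\<close>

lemma integrable_exp_neg_square:
  fixes a :: real
  assumes "a > 0"
  shows "integrable lborel (\<lambda>x. exp (- (a * x\<^sup>2)))"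
proof -
  define \<sigma> where "\<sigma> = sqrt (1 / (2 * a))"
  have \<sigma>: "2 * \<sigma>\<^sup>2 = 1 / a" using assms by (simp add: \<sigma>_def)
  have "(\<lambda>x. exp (- (a * x\<^sup>2))) = (\<lambda>x. sqrt (pi / a) * normal_density 0 \<sigma> x)"
  proof
    fix x
    have "2 * pi * \<sigma>\<^sup>2 = pi / a" using \<sigma> by (simp add: field_simps)
    moreover have "x\<^sup>2 / (2 * \<sigma>\<^sup>2) = a * x\<^sup>2" unfolding \<sigma> using assms by (simp add: field_simps)
    ultimately show "exp (- (a * x\<^sup>2)) = sqrt (pi / a) * normal_density 0 \<sigma> x"
      using assms by (simp add: normal_density_def)
  qed
  moreover have "\<sigma> > 0" using assms by (simp add: \<sigma>_def)
  ultimately show ?thesis by simp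
qed

text \<open>Homogeneity of degree two reduces both bounds to the unit sphere of \<open>V\<close>,
  which is compact, so that \<open>q\<close> attains positive extrema there. It serves for Gaussian
  exponents and for comparing coordinates with the ambient Euclidean norm.\<close>

lemma quadratic_bounds:
  fixes q :: "'e::euclidean_space \<Rightarrow> real"
  assumes cont: "continuous_on UNIV q" and hom: "\<And>t y. q (t *\<^sub>R y) = t\<^sup>2 * q y"
    and V: "subspace V" and pos: "\<And>y. y \<in> V \<Longrightarrow> y \<noteq> 0 \<Longrightarrow> 0 < q y"
  obtains \<epsilon> \<kappa> where "0 < \<epsilon>" "0 < \<kappa>"
    "\<And>y. y \<in> V \<Longrightarrow> \<epsilon> * (norm y)\<^sup>2 \<le> q y" "\<And>y. y \<in> V \<Longrightarrow> q y \<le> \<kappa> * (norm y)\<^sup>2"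
proof -
  let ?S = "sphere 0 1 \<inter> V"
  have cpt: "compact ?S" using V by (intro compact_Int_closed closed_subspace) auto
  have q0: "q 0 = 0" using hom[of 0 0] by simp
  have scale: "y = norm y *\<^sub>R (y /\<^sub>R norm y) \<and> y /\<^sub>R norm y \<in> ?S" if "y \<in> V" "y \<noteq> 0" for y
    using that V by (auto simp: subspace_scale)
  have "\<exists>\<epsilon> \<kappa>. 0 < \<epsilon> \<and> 0 < \<kappa> \<and> (\<forall>y\<in>?S. \<epsilon> \<le> q y \<and> q y \<le> \<kappa>)"
  proof (cases "?S = {}")
    \<comment> \<open>The sphere is empty when \<open>V\<close> is the zero space; any positive
      constants do, since \<open>q 0 = 0\<close>.\<close>
    case True
    then show ?thesis by (auto intro: exI[of _ 1])
  next
    case False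
    have cq: "continuous_on ?S q" using cont by (rule continuous_on_subset) simp
    obtain a where a: "a \<in> ?S" "\<And>y. y \<in> ?S \<Longrightarrow> q a \<le> q y"
      using continuous_attains_inf[OF cpt False cq] by blast
    obtain b where b: "b \<in> ?S" "\<And>y. y \<in> ?S \<Longrightarrow> q y \<le> q b"
      using continuous_attains_sup[OF cpt False cq] by blast
    have "0 < q a" "0 < q b" using a(1) b(1) by (auto intro!: pos)
    with a b show ?thesis by blast
  qed
  then obtain \<epsilon> \<kappa> where e: "0 < \<epsilon>" "0 < \<kappa>" "\<And>y. y \<in> ?S \<Longrightarrow> \<epsilon> \<le> q y \<and> q y \<le> \<kappa>" by blast
  have qy: "q y = (norm y)\<^sup>2 * q (y /\<^sub>R norm y)" if "y \<in> V" "y \<noteq> 0" for y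
    using scale[OF that] hom[of "norm y" "y /\<^sub>R norm y"] by metis
  show ?thesis
  proof (rule that[OF e(1,2)])
    fix y assume y: "y \<in> V"
    have "\<epsilon> * (norm y)\<^sup>2 \<le> q y \<and> q y \<le> \<kappa> * (norm y)\<^sup>2"
    proof (cases "y = 0")
      case False
      then show ?thesis
        using e(3)[of "y /\<^sub>R norm y"] scale[OF y False]
        unfolding qy[OF y False] mult.commute[of _ "(norm y)\<^sup>2"]
        by (intro conjI mult_left_mono) auto
    qed (simp add: q0)
    then show "\<epsilon> * (norm y)\<^sup>2 \<le> q y" "q y \<le> \<kappa> * (norm y)\<^sup>2" by auto
  qed
qed

text \<open>\<open>ip\<close> is not assumed to be an inner product on the whole type: the cochains
  form a subspace of the ambient vectors, and the Whitney product ignores all coordinates outside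
  the simplices of its degree. Only its values on \<open>B\<close> are prescribed.\<close>

locale orthonormal_system =
  fixes ip :: "'e::euclidean_space \<Rightarrow> 'e \<Rightarrow> real" and B :: "'e set"
  assumes bilinear: "bilinear ip" and finite: "finite B"
    and orthonormal: "b \<in> B \<Longrightarrow> b' \<in> B \<Longrightarrow> ip b b' = of_bool (b = b')"
begin

lemma linear_ip: "linear (\<lambda>x. ip x b)"
  using bilinear by (simp add: bilinear_def)

lemmas ip_add = linear_add[OF linear_ip] and ip_diff = linear_diff[OF linear_ip]
  and ip_scale = linear_scale[OF linear_ip] and ip_sum_left = linear_sum[OF linear_ip]
  and ip_0 = linear_0[OF linear_ip]

lemma continuous_ip: "continuous_on S (\<lambda>x. ip x b)"
  using linear_ip by (simp add: linear_continuous_on linear_conv_bounded_linear)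

lemma ip_combination: "b' \<in> B \<Longrightarrow> ip (\<Sum>b\<in>B. c b *\<^sub>R b) b' = c b'"
  by (simp add: ip_sum_left ip_scale orthonormal finite cong: sum.cong)

lemma span_expansion: "x \<in> span B \<Longrightarrow> (\<Sum>b\<in>B. ip x b *\<^sub>R b) = x"
proof -
  assume "x \<in> span B"
  then obtain u where u: "x = (\<Sum>b\<in>B. u b *\<^sub>R b)" unfolding span_finite[OF finite] by auto
  then have "ip x b = u b" if "b \<in> B" for b using ip_combination[OF that, of u] by simp
  then show ?thesis using u by simp
qed

lemma span_eqI: "x \<in> span B \<Longrightarrow> y \<in> span B \<Longrightarrow> (\<And>b. b \<in> B \<Longrightarrow> ip x b = ip y b) \<Longrightarrow> x = y"
  by (metis (no_types, lifting) span_expansion sum.cong)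

definition synth :: "('e \<Rightarrow> real) \<Rightarrow> 'e" where
  "synth c = (\<Sum>b\<in>B. c b *\<^sub>R b)"

text \<open>Restricted to \<open>B\<close> so that the result is extensional, hence a point of the
  product space, where \<open>coords\<close> inverts \<open>synth\<close>.\<close>

definition coords :: "'e \<Rightarrow> 'e \<Rightarrow> real" where
  "coords x = (\<lambda>b\<in>B. ip x b)"

lemma synth_in_span[simp]: "synth c \<in> span B"
  unfolding synth_def by (intro span_sum span_scale span_base)

lemma measurable_synth[measurable]: "synth \<in> measurable (\<Pi>\<^sub>M b\<in>B. lborel) (borel_span B)"
proof (rule measurable_restrict_space2)
  show "synth \<in> borel_measurable (\<Pi>\<^sub>M b\<in>B. lborel)"
    unfolding synth_def by (intro borel_measurable_sum borel_measurable_scaleR) auto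
qed auto

lemma borel_measurable_ip[measurable]: "(\<lambda>x. ip x b) \<in> borel_measurable borel"
  by (rule borel_measurable_continuous_onI) (rule continuous_ip)

lemma measurable_coords[measurable]: "coords \<in> measurable (borel_span B) (\<Pi>\<^sub>M b\<in>B. lborel)"
  unfolding coords_def
  by (intro measurable_restrict) (simp add: measurable_restrict_space1)

lemma lebesgue_span_synth: "lebesgue_span B = distr (\<Pi>\<^sub>M b\<in>B. lborel) (borel_span B) synth"
  unfolding lebesgue_span_def synth_def[abs_def] ..

lemma coords_synth: "c \<in> space (\<Pi>\<^sub>M b\<in>B. (lborel :: real measure)) \<Longrightarrow> coords (synth c) = c"
  by (auto simp: coords_def synth_def ip_combination space_PiM PiE_def extensional_def)

text \<open>Sigma-finiteness is not inherited by the pushforward that defines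
  \<open>lebesgue_span\<close>. Pushing on along the inverse map recovers the product measure, from
  which sigma-finiteness and nontriviality can be pulled back.\<close>

lemma distr_coords: "distr (lebesgue_span B) (\<Pi>\<^sub>M b\<in>B. lborel) coords = (\<Pi>\<^sub>M b\<in>B. lborel)"
proof -
  have "distr (lebesgue_span B) (\<Pi>\<^sub>M b\<in>B. lborel) coords
      = distr (\<Pi>\<^sub>M b\<in>B. lborel) (\<Pi>\<^sub>M b\<in>B. lborel) (coords \<circ> synth)"
    unfolding lebesgue_span_synth by (rule distr_distr) measurable
  also have "\<dots> = distr (\<Pi>\<^sub>M b\<in>B. lborel) (\<Pi>\<^sub>M b\<in>B. lborel) (\<lambda>c. c)"
    by (rule distr_cong) (auto simp: coords_synth)
  finally show ?thesis by (simp add: distr_id2)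
qed

lemma sigma_finite_lebesgue_span: "sigma_finite_measure (lebesgue_span B)"
proof (rule sigma_finite_measure_distr)
  interpret finite_product_sigma_finite "\<lambda>_. lborel :: real measure" B
    by standard (rule finite)
  show "sigma_finite_measure (distr (lebesgue_span B) (\<Pi>\<^sub>M b\<in>B. lborel) coords)"
    unfolding distr_coords by (rule sigma_finite_measure_axioms)
qed measurable

text \<open>The unit cube in coordinates has measure one. This is what makes the normalizing
  constants nonzero, as they are never computed.\<close>

lemma not_AE_False: "\<not> (AE x in lebesgue_span B. False)"
proof
  interpret finite_product_sigma_finite "\<lambda>_. lborel :: real measure" B
    by standard (rule finite)
  assume "AE x in lebesgue_span B. False"
  then have "AE c in distr (lebesgue_span B) (\<Pi>\<^sub>M b\<in>B. lborel) coords. False"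
    by (subst AE_distr_iff) (auto intro: measurable_compose)
  then have "AE c in (\<Pi>\<^sub>M b\<in>B. (lborel::real measure)). False" unfolding distr_coords .
  then have "emeasure (\<Pi>\<^sub>M b\<in>B. (lborel::real measure)) (space (\<Pi>\<^sub>M b\<in>B. lborel)) = 0"
    by (simp add: ae_filter_eq_bot_iff[symmetric] trivial_limit_def)
  then have "emeasure (\<Pi>\<^sub>M b\<in>B. (lborel::real measure)) (PiE B (\<lambda>_. {0..1})) = 0"
    by (metis emeasure_space le_zero_eq)
  then show False by (subst (asm) measure_times) auto
qed

lemma integrable_exp_neg_norm:
  assumes "\<delta> > 0"
  shows "integrable (lebesgue_span B) (\<lambda>x. exp (- (\<delta> * (norm x)\<^sup>2)))"
proof -
  interpret finite_product_sigma_finite "\<lambda>_. lborel :: real measure" B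
    by standard (rule finite)
  let ?q = "\<lambda>x. \<Sum>b\<in>B. (ip x b)\<^sup>2"
  obtain \<kappa> where \<kappa>: "0 < \<kappa>" "\<And>y. y \<in> span B \<Longrightarrow> ?q y \<le> \<kappa> * (norm y)\<^sup>2"
  proof (rule quadratic_bounds[of ?q "span B"])
    show "continuous_on UNIV ?q" by (intro continuous_intros continuous_ip)
    show "?q (t *\<^sub>R y) = t\<^sup>2 * ?q y" for t y
      by (simp add: ip_scale power_mult_distrib sum_distrib_left)
    fix y assume y: "y \<in> span B" "y \<noteq> 0"
    then obtain b where "b \<in> B" "ip y b \<noteq> 0" using span_eqI[OF y(1) span_0] ip_0 by auto
    then show "0 < ?q y" by (intro sum_pos2[OF finite, of b]) auto
  qed auto
  \<comment> \<open>\<open>\<kappa>\<close> bounds the sum of the squared coordinates by the squared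
    norm, so this rate makes a product of one-dimensional Gaussians in the coordinates dominate the
    given function.\<close>
  define a where "a = \<delta> / \<kappa>"
  have a: "a > 0" using \<kappa> assms by (simp add: a_def)
  have "integrable (\<Pi>\<^sub>M b\<in>B. lborel) (\<lambda>c. exp (- (\<delta> * (norm (synth c))\<^sup>2)))"
  proof (rule Bochner_Integration.integrable_bound)
    show "integrable (\<Pi>\<^sub>M b\<in>B. lborel) (\<lambda>c. \<Prod>b\<in>B. exp (- (a * (c b)\<^sup>2)))"
      by (intro product_integrable_prod finite integrable_exp_neg_square a)
    have "synth \<in> borel_measurable (\<Pi>\<^sub>M b\<in>B. lborel)"
      using measurable_synth by (simp add: measurable_restrict_space2_iff)
    then show "(\<lambda>c. exp (- (\<delta> * (norm (synth c))\<^sup>2))) \<in> borel_measurable (\<Pi>\<^sub>M b\<in>B. lborel)"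
      by measurable
    show "AE c in \<Pi>\<^sub>M b\<in>B. lborel. norm (exp (- (\<delta> * (norm (synth c))\<^sup>2))) \<le> norm (\<Prod>b\<in>B. exp (- (a * (c b)\<^sup>2)))"
    proof (rule AE_I2)
      fix c :: "'e \<Rightarrow> real"
      have "?q (synth c) = (\<Sum>b\<in>B. (c b)\<^sup>2)"
        by (rule sum.cong) (auto simp: synth_def ip_combination)
      then have "(\<Sum>b\<in>B. (c b)\<^sup>2) \<le> \<kappa> * (norm (synth c))\<^sup>2" using \<kappa>(2)[of "synth c"] by simp
      then have "a * (\<Sum>b\<in>B. (c b)\<^sup>2) \<le> \<delta> * (norm (synth c))\<^sup>2"
        using \<kappa>(1) assms by (simp add: a_def field_simps)
      then show "norm (exp (- (\<delta> * (norm (synth c))\<^sup>2))) \<le> norm (\<Prod>b\<in>B. exp (- (a * (c b)\<^sup>2)))"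
        by (simp add: exp_sum[symmetric] finite sum_negf sum_distrib_left abs_prod)
    qed
  qed
  then show ?thesis unfolding lebesgue_span_synth
    by (subst integrable_distr_eq) (auto intro!: measurable_restrict_space1)
qed

text \<open>The only properties of a normalized Gaussian density on which the entropy argument
  relies. The estimates are confined to the span because the exponent is definite only there; one
  constant \<open>c\<close> serves for both of them.\<close>

definition gaussian_density :: "('e \<Rightarrow> real) \<Rightarrow> bool" where
  "gaussian_density f \<longleftrightarrow> continuous_on UNIV f \<and> (\<forall>x. 0 < f x) \<and>
     (\<integral>\<^sup>+x. ennreal (f x) \<partial>lebesgue_span B) = 1 \<and>
     (\<exists>c \<delta>. 0 < \<delta> \<and> (\<forall>x\<in>span B. f x \<le> c * exp (- (\<delta> * (norm x)\<^sup>2)) \<and> \<bar>ln (f x)\<bar> \<le> c * (1 + (norm x)\<^sup>2)))"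

text \<open>Let \<open>d\<close> be \<open>Q\<close> applied to the coordinates of \<open>x\<close>.
  Then \<open>S\<close> maps \<open>d\<close> back to these coordinates, so the form of
  \<open>Q\<close> at \<open>x\<close> equals the form of \<open>S\<close> at \<open>d\<close>, and
  \<open>d\<close> is nonzero because \<open>x\<close> is.\<close>

lemma precision_form_pos:
  assumes S: "\<And>c. (\<exists>b\<in>B. c b \<noteq> 0) \<Longrightarrow> 0 < (\<Sum>b\<in>B. \<Sum>b'\<in>B. c b * S b b' * c b')"
    and SQ: "\<And>b b'. b \<in> B \<Longrightarrow> b' \<in> B \<Longrightarrow> (\<Sum>e\<in>B. S b e * Q e b') = of_bool (b = b')"
    and x: "x \<in> span B" "x \<noteq> 0"
  shows "0 < (\<Sum>b\<in>B. \<Sum>b'\<in>B. ip x b * Q b b' * ip x b')"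
proof -
  define d where "d e = (\<Sum>b'\<in>B. Q e b' * ip x b')" for e
  have Sd: "(\<Sum>e\<in>B. S b e * d e) = ip x b" if b: "b \<in> B" for b
  proof -
    have "(\<Sum>e\<in>B. S b e * d e) = (\<Sum>e\<in>B. \<Sum>b'\<in>B. S b e * Q e b' * ip x b')"
      by (simp add: d_def sum_distrib_left mult.assoc)
    also have "\<dots> = (\<Sum>b'\<in>B. (\<Sum>e\<in>B. S b e * Q e b') * ip x b')"
      by (subst sum.swap) (simp add: sum_distrib_right)
    also have "\<dots> = (\<Sum>b'\<in>B. if b = b' then ip x b' else 0)"
      by (intro sum.cong) (auto simp: SQ b)
    finally show ?thesis using b by (simp add: finite)
  qed
  have "\<exists>b\<in>B. d b \<noteq> 0"
  proof (rule ccontr)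
    assume "\<not> ?thesis"
    then have "ip x b = 0" if "b \<in> B" for b using Sd[OF that] by simp
    then have "x = 0" using span_eqI[OF x(1) span_0] ip_0 by auto
    with x show False by simp
  qed
  then have "0 < (\<Sum>b\<in>B. \<Sum>b'\<in>B. d b * S b b' * d b')" by (rule S)
  also have "\<dots> = (\<Sum>b\<in>B. d b * ip x b)"
    by (intro sum.cong refl) (simp add: Sd[symmetric] sum_distrib_left mult.assoc)
  also have "\<dots> = (\<Sum>b\<in>B. \<Sum>b'\<in>B. ip x b * Q b b' * ip x b')"
    by (intro sum.cong refl) (simp add: d_def sum_distrib_left sum_distrib_right mult_ac)
  finally show ?thesis .
qed

lemma gaussian_density_normalized_kernel:
  assumes m: "m \<in> span B"
    and S: "\<And>c. (\<exists>b\<in>B. c b \<noteq> 0) \<Longrightarrow> 0 < (\<Sum>b\<in>B. \<Sum>b'\<in>B. c b * S b b' * c b')"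
    and SQ: "\<And>b b'. b \<in> B \<Longrightarrow> b' \<in> B \<Longrightarrow> (\<Sum>e\<in>B. S b e * Q e b') = of_bool (b = b')"
  shows "gaussian_density (\<lambda>x. gauss_kernel ip B m Q x / (LINT y|lebesgue_span B. gauss_kernel ip B m Q y))"
    and "integrable (lebesgue_span B) (gauss_kernel ip B m Q)"
proof -
  define q where "q y = (\<Sum>b\<in>B. \<Sum>b'\<in>B. ip y b * Q b b' * ip y b')" for y
  have qc: "continuous_on UNIV q" unfolding q_def by (intro continuous_intros continuous_ip)
  obtain \<epsilon> \<kappa> where ek: "0 < \<epsilon>" "0 < \<kappa>" "\<And>y. y \<in> span B \<Longrightarrow> \<epsilon> * (norm y)\<^sup>2 \<le> q y"
      "\<And>y. y \<in> span B \<Longrightarrow> q y \<le> \<kappa> * (norm y)\<^sup>2"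
  proof (rule quadratic_bounds[OF qc, of "span B"])
    show "q (t *\<^sub>R y) = t\<^sup>2 * q y" for t y
      by (simp add: q_def ip_scale power2_eq_square sum_distrib_left mult_ac)
    show "0 < q y" if "y \<in> span B" "y \<noteq> 0" for y
      unfolding q_def using S SQ that by (rule precision_form_pos)
  qed auto
  let ?k = "gauss_kernel ip B m Q"
  have k: "?k x = exp (- q (x - m) / 2)" for x by (simp add: gauss_kernel_def q_def)
  have kc: "continuous_on UNIV ?k"
    unfolding k by (intro continuous_intros continuous_on_compose2[OF qc]) auto
  have n2: "(norm (u + v))\<^sup>2 \<le> 2 * (norm u)\<^sup>2 + 2 * (norm v)\<^sup>2" for u v :: 'e
  proof -
    have "(norm (u + v))\<^sup>2 \<le> (norm u + norm v)\<^sup>2" by (intro power_mono norm_triangle_ineq) auto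
    also have "\<dots> \<le> 2 * (norm u)\<^sup>2 + 2 * (norm v)\<^sup>2"
      using sum_squares_bound[of "norm u" "norm v"] by (simp add: power2_sum)
    finally show ?thesis .
  qed
  define c\<^sub>0 where "c\<^sub>0 = exp (\<epsilon> * (norm m)\<^sup>2 / 2)"
  \<comment> \<open>Half of the exponent gives decay at rate \<open>\<epsilon> / 2\<close> around
    \<open>m\<close>. Recentring at the origin through \<open>n2\<close> halves this rate again and
    costs the factor \<open>c\<^sub>0\<close>.\<close>
  have kb: "?k x \<le> c\<^sub>0 * exp (- (\<epsilon> / 4 * (norm x)\<^sup>2))" if x: "x \<in> span B" for x
  proof -
    have "\<epsilon> * (norm (x - m))\<^sup>2 \<le> q (x - m)" using ek(3) span_diff[OF x m] .
    moreover have "\<epsilon> * (norm x)\<^sup>2 \<le> \<epsilon> * (2 * (norm (x - m))\<^sup>2 + 2 * (norm m)\<^sup>2)"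
      using n2[of "x - m" m] ek(1) by (intro mult_left_mono) auto
    ultimately show ?thesis
      by (simp add: k c\<^sub>0_def exp_add[symmetric] algebra_simps)
  qed
  have km: "?k \<in> borel_measurable (lebesgue_span B)"
    using borel_measurable_continuous_onI[OF kc] by blast
  show ki: "integrable (lebesgue_span B) ?k"
  proof (rule Bochner_Integration.integrable_bound[OF _ km])
    show "integrable (lebesgue_span B) (\<lambda>x. c\<^sub>0 * exp (- (\<epsilon> / 4 * (norm x)\<^sup>2)))"
      using ek by (intro integrable_mult_right integrable_exp_neg_norm) auto
    have "c\<^sub>0 > 0" by (simp add: c\<^sub>0_def)
    then show "AE x in lebesgue_span B. norm (?k x) \<le> norm (c\<^sub>0 * exp (- (\<epsilon> / 4 * (norm x)\<^sup>2)))"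
      using kb by (intro AE_I2) (simp add: k)
  qed
  define Z where "Z = (LINT y|lebesgue_span B. ?k y)"
  have "Z \<ge> 0" unfolding Z_def by (intro integral_nonneg_AE AE_I2) (simp add: k)
  \<comment> \<open>A positive function with integral zero would make the whole span a null
    set.\<close>
  moreover have "Z \<noteq> 0"
    using integral_nonneg_eq_0_iff_AE[OF ki] not_AE_False unfolding Z_def by (simp add: k)
  ultimately have Z: "Z > 0" by simp
  \<comment> \<open>The first entry dominates the density, the second the logarithm, whose terms are
    the recentred exponent and \<open>ln Z\<close>.\<close>
  define c where "c = max (c\<^sub>0 / Z) (\<kappa> + \<kappa> * (norm m)\<^sup>2 + \<bar>ln Z\<bar>)"
  have bound: "?k x / Z \<le> c * exp (- (\<epsilon> / 4 * (norm x)\<^sup>2)) \<and> \<bar>ln (?k x / Z)\<bar> \<le> c * (1 + (norm x)\<^sup>2)"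
    if x: "x \<in> span B" for x
  proof
    have "?k x / Z \<le> c\<^sub>0 * exp (- (\<epsilon> / 4 * (norm x)\<^sup>2)) / Z"
      using kb[OF x] Z by (intro divide_right_mono) auto
    also have "\<dots> = c\<^sub>0 / Z * exp (- (\<epsilon> / 4 * (norm x)\<^sup>2))" by simp
    also have "\<dots> \<le> c * exp (- (\<epsilon> / 4 * (norm x)\<^sup>2))"
      by (intro mult_right_mono) (auto simp: c_def)
    finally show "?k x / Z \<le> c * exp (- (\<epsilon> / 4 * (norm x)\<^sup>2))" .
    have qb: "0 \<le> q (x - m)" "q (x - m) \<le> \<kappa> * (norm (x - m))\<^sup>2"
      using ek(1) ek(3,4)[OF span_diff[OF x m]] by (auto intro: order_trans[rotated])
    have "\<kappa> * (norm (x - m))\<^sup>2 \<le> \<kappa> * (2 * (norm x)\<^sup>2 + 2 * (norm m)\<^sup>2)"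
      using n2[of x "-m"] ek(2) by (intro mult_left_mono) auto
    then have "\<bar>ln (?k x / Z)\<bar> \<le> \<kappa> * (norm x)\<^sup>2 + \<kappa> * (norm m)\<^sup>2 + \<bar>ln Z\<bar>"
      using qb Z by (simp add: k ln_div algebra_simps)
    also have "\<dots> \<le> (\<kappa> + \<kappa> * (norm m)\<^sup>2 + \<bar>ln Z\<bar>) * (1 + (norm x)\<^sup>2)"
      using ek(2) by (simp add: algebra_simps)
    also have "\<dots> \<le> c * (1 + (norm x)\<^sup>2)"
      by (intro mult_right_mono) (auto simp: c_def)
    finally show "\<bar>ln (?k x / Z)\<bar> \<le> c * (1 + (norm x)\<^sup>2)" .
  qed
  have "(\<integral>\<^sup>+x. ennreal (?k x / Z) \<partial>lebesgue_span B) = ennreal (\<integral>x. ?k x / Z \<partial>lebesgue_span B)"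
    using Z by (intro nn_integral_eq_integral AE_I2 integrable_divide ki) (auto simp: k)
  also have "\<dots> = 1" using Z by (simp add: Z_def[symmetric])
  finally have "(\<integral>\<^sup>+x. ennreal (?k x / Z) \<partial>lebesgue_span B) = 1" .
  moreover have "continuous_on UNIV (\<lambda>x. ?k x / Z)"
    using Z by (intro continuous_intros kc) auto
  moreover have "\<exists>c \<delta>. 0 < \<delta> \<and> (\<forall>x\<in>span B. ?k x / Z \<le> c * exp (- (\<delta> * (norm x)\<^sup>2)) \<and> \<bar>ln (?k x / Z)\<bar> \<le> c * (1 + (norm x)\<^sup>2))"
    using bound ek(1) by (intro exI[of _ c] exI[of _ "\<epsilon> / 4"]) auto
  ultimately show "gaussian_density (\<lambda>x. ?k x / (LINT y|lebesgue_span B. ?k y))"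
    unfolding gaussian_density_def Z_def[symmetric] using Z by (auto simp: k)
qed

lemma nondegenerate_gaussian_densityE:
  assumes "nondegenerate_gaussian ip B \<mu>"
  obtains f where "gaussian_density f" "\<mu> = density (lebesgue_span B) (\<lambda>x. ennreal (f x))"
proof -
  obtain m S Q where "m \<in> span B"
      "\<forall>c. (\<exists>b\<in>B. c b \<noteq> 0) \<longrightarrow> 0 < (\<Sum>b\<in>B. \<Sum>b'\<in>B. c b * S b b' * c b')"
      "\<forall>b\<in>B. \<forall>b'\<in>B. (\<Sum>e\<in>B. S b e * Q e b') = of_bool (b = b')"
    and \<mu>: "\<mu> = density (lebesgue_span B)
        (\<lambda>x. ennreal (gauss_kernel ip B m Q x / (LINT y|lebesgue_span B. gauss_kernel ip B m Q y)))"
    using assms unfolding nondegenerate_gaussian_def by (elim exE conjE) rule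
  then have "gaussian_density (\<lambda>x. gauss_kernel ip B m Q x / (LINT y|lebesgue_span B. gauss_kernel ip B m Q y))"
    by (intro gaussian_density_normalized_kernel(1)[where S = S]) auto
  then show thesis using \<mu> by (rule that)
qed

lemma gaussian_density_measurable:
  assumes "gaussian_density f"
  shows "f \<in> borel_measurable borel" "f \<in> borel_measurable (lebesgue_span B)"
proof -
  show "f \<in> borel_measurable borel"
    using assms unfolding gaussian_density_def by (intro borel_measurable_continuous_onI) auto
  then show "f \<in> borel_measurable (lebesgue_span B)" by blast
qed

text \<open>The quadratic growth of both logarithms is absorbed by half of the Gaussian decay of
  \<open>f\<close>; the other half remains as an integrable majorant.\<close>

lemma gaussian_density_integrable_ln:
  assumes f: "gaussian_density f" and g: "gaussian_density g"
  shows "integrable (lebesgue_span B) (\<lambda>x. f x * ln (f x / g x))"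
proof -
  obtain c \<delta> where c: "0 < \<delta>" "\<And>x. x \<in> span B \<Longrightarrow> f x \<le> c * exp (- (\<delta> * (norm x)\<^sup>2))"
      "\<And>x. x \<in> span B \<Longrightarrow> \<bar>ln (f x)\<bar> \<le> c * (1 + (norm x)\<^sup>2)"
    using f unfolding gaussian_density_def by blast
  obtain c' where c': "\<And>x. x \<in> span B \<Longrightarrow> \<bar>ln (g x)\<bar> \<le> c' * (1 + (norm x)\<^sup>2)"
    using g unfolding gaussian_density_def by blast
  have pos: "0 < f x" "0 < g x" for x using f g by (auto simp: gaussian_density_def)
  have "0 < c" using c(2)[OF span_0] pos(1)[of 0] by simp
  have "0 \<le> c'" using c'[OF span_0] by simp
  \<comment> \<open>The factors come from the bound on \<open>f\<close>, from the two logarithms,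
    and from trading \<open>1 + r\<close> for \<open>exp (\<delta> / 2 * r)\<close>.\<close>
  define b where "b = c * (c + c') * (1 + 2 / \<delta>)"
  have "0 \<le> b" using \<open>0 < c\<close> \<open>0 \<le> c'\<close> c(1) by (simp add: b_def)
  note [measurable] = gaussian_density_measurable[OF f] gaussian_density_measurable[OF g]
  show ?thesis
  proof (rule Bochner_Integration.integrable_bound)
    show "integrable (lebesgue_span B) (\<lambda>x. b * exp (- (\<delta> / 2 * (norm x)\<^sup>2)))"
      using c(1) by (intro integrable_mult_right integrable_exp_neg_norm) auto
    show "AE x in lebesgue_span B. norm (f x * ln (f x / g x)) \<le> norm (b * exp (- (\<delta> / 2 * (norm x)\<^sup>2)))"
    proof (rule AE_I2, unfold space_lebesgue_span)
      fix x assume x: "x \<in> span B"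
      define r where "r = (norm x)\<^sup>2"
      have r: "r \<ge> 0" by (simp add: r_def)
      have e1: "1 + \<delta> / 2 * r \<le> exp (\<delta> / 2 * r)" by (rule exp_ge_add_one_self)
      then have e2: "1 + r \<le> (1 + 2 / \<delta>) * exp (\<delta> / 2 * r)"
      proof -
        have "r \<le> 2 / \<delta> * exp (\<delta> / 2 * r)" using e1 c(1) by (simp add: field_simps)
        moreover have "1 \<le> exp (\<delta> / 2 * r)" using c(1) r by simp
        moreover have "(1 + 2 / \<delta>) * exp (\<delta> / 2 * r) = exp (\<delta> / 2 * r) + 2 / \<delta> * exp (\<delta> / 2 * r)"
          by (simp add: distrib_right)
        ultimately show ?thesis by linarith
      qed
      have "\<bar>ln (f x / g x)\<bar> \<le> (c + c') * (1 + r)"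
        using c(3)[OF x] c'[OF x] pos(1)[of x] pos(2)[of x] by (simp add: ln_div r_def algebra_simps)
      then have "f x * \<bar>ln (f x / g x)\<bar> \<le> (c * exp (- (\<delta> * r))) * ((c + c') * (1 + r))"
        using c(2)[OF x] pos(1)[of x] \<open>0 < c\<close> by (intro mult_mono) (auto simp: r_def)
      also have "\<dots> \<le> (c * exp (- (\<delta> * r))) * ((c + c') * ((1 + 2 / \<delta>) * exp (\<delta> / 2 * r)))"
        using e2 \<open>0 < c\<close> \<open>0 \<le> c'\<close> by (intro mult_left_mono) auto
      also have "\<dots> = b * (exp (- (\<delta> * r)) * exp (\<delta> / 2 * r))" by (simp add: b_def)
      also have "\<dots> = b * exp (- (\<delta> / 2 * r))" by (simp add: exp_add[symmetric])
      finally show "norm (f x * ln (f x / g x)) \<le> norm (b * exp (- (\<delta> / 2 * (norm x)\<^sup>2)))"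
        using pos(1)[of x] \<open>0 \<le> b\<close> by (simp add: r_def abs_mult)
    qed
  qed measurable
qed

lemma rel_entropy_gaussian_density:
  assumes f: "gaussian_density f" and g: "gaussian_density g"
  shows "rel_entropy (density (lebesgue_span B) f) (density (lebesgue_span B) g)
    = (\<integral>x. f x * ln (f x / g x) \<partial>lebesgue_span B)"
proof -
  interpret sigma_finite_measure "lebesgue_span B" by (rule sigma_finite_lebesgue_span)
  have pos: "0 < f x" "0 < g x" for x using f g by (auto simp: gaussian_density_def)
  have "KL_divergence (exp 1) (density (lebesgue_span B) g) (density (lebesgue_span B) f)
      = (\<integral>x. f x * log (exp 1) (f x / g x) \<partial>lebesgue_span B)"
    using gaussian_density_measurable[OF f] gaussian_density_measurable[OF g] pos
    by (intro KL_density_density) (auto simp: less_imp_le less_imp_neq[symmetric])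
  then show ?thesis by (simp add: rel_entropy_def log_def)
qed

end

section \<open>Gaussian extensions to an orthogonal sum\<close>

text \<open>\<open>P\<close> is prescribed only on sums of elements of the two spans; these sums
  carry all the measures to be projected.\<close>

locale orthogonal_pair =
  fixes ip :: "'e::euclidean_space \<Rightarrow> 'e \<Rightarrow> real" and B C :: "'e set" and P :: "'e \<Rightarrow> 'e"
  assumes union: "orthonormal_system ip (B \<union> C)" and disjoint: "B \<inter> C = {}"
    and projection: "x \<in> span B \<Longrightarrow> y \<in> span C \<Longrightarrow> P (x + y) = x"
begin

sublocale U: orthonormal_system ip "B \<union> C" by (rule union)
sublocale B: orthonormal_system ip B
  by standard (use U.bilinear U.finite U.orthonormal in auto)
sublocale C: orthonormal_system ip C
  by standard (use U.bilinear U.finite U.orthonormal in auto)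
sublocale LB: sigma_finite_measure "lebesgue_span B" by (rule B.sigma_finite_lebesgue_span)
sublocale LC: sigma_finite_measure "lebesgue_span C" by (rule C.sigma_finite_lebesgue_span)
sublocale LU: sigma_finite_measure "lebesgue_span (B \<union> C)" by (rule U.sigma_finite_lebesgue_span)
sublocale pair_sigma_finite "lebesgue_span B" "lebesgue_span C" ..

section \<open>Lebesgue measure on an orthogonal sum as a product measure\<close>

lemma ip_span_left:
  assumes "x \<in> span B" "c \<in> C"
  shows "ip x c = 0"
proof -
  have "ip (\<Sum>e\<in>B. ip x e *\<^sub>R e) c = 0"
    using disjoint U.orthonormal assms(2)
    by (auto simp: U.ip_sum_left U.ip_scale intro!: sum.neutral)
  then show ?thesis by (simp add: B.span_expansion[OF assms(1)])
qed

lemma ip_span_right: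
  assumes "y \<in> span C" "b \<in> B"
  shows "ip y b = 0"
proof -
  have "ip (\<Sum>e\<in>C. ip y e *\<^sub>R e) b = 0"
    using disjoint U.orthonormal assms(2)
    by (auto simp: U.ip_sum_left U.ip_scale intro!: sum.neutral)
  then show ?thesis by (simp add: C.span_expansion[OF assms(1)])
qed

lemma add_in_span: "x \<in> span B \<Longrightarrow> y \<in> span C \<Longrightarrow> x + y \<in> span (B \<union> C)"
  unfolding span_Un by blast

lemma borel_measurable_add_fst_snd:
  "(\<lambda>(x, y). x + y) \<in> borel_measurable (lebesgue_span B \<Otimes>\<^sub>M lebesgue_span C)"
proof -
  have [measurable]: "(\<lambda>x. x) \<in> borel_measurable (lebesgue_span D)" for D :: "'e set"
    by (rule measurable_borel_span) simp
  show ?thesis by (simp add: split_beta)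
qed

lemma measurable_add[measurable]:
  "(\<lambda>(x, y). x + y) \<in> measurable (lebesgue_span B \<Otimes>\<^sub>M lebesgue_span C) (borel_span (B \<union> C))"
  by (rule measurable_restrict_space2)
    (auto simp: space_pair_measure intro: add_in_span borel_measurable_add_fst_snd)

text \<open>In coordinates, adding the two components is \<open>merge\<close>, and
  \<open>merge\<close> carries the product of the two coordinate Lebesgue measures to that of the
  union. All uses of Fubini for the splitting rest on this.\<close>

lemma lebesgue_span_Un:
  "lebesgue_span (B \<union> C)
    = distr (lebesgue_span B \<Otimes>\<^sub>M lebesgue_span C) (borel_span (B \<union> C)) (\<lambda>(x, y). x + y)"
proof -
  interpret product_sigma_finite "\<lambda>_. lborel :: real measure" by standard
  let ?PB = "\<Pi>\<^sub>M b\<in>B. (lborel :: real measure)" and ?PC = "\<Pi>\<^sub>M b\<in>C. (lborel :: real measure)"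
    and ?PU = "\<Pi>\<^sub>M b\<in>B \<union> C. (lborel :: real measure)"
  have m1: "(\<lambda>(c, d). (B.synth c, C.synth d)) \<in> measurable (?PB \<Otimes>\<^sub>M ?PC) (borel_span B \<Otimes>\<^sub>M borel_span C)"
    by measurable
  have m2: "(\<lambda>(x, y). x + y) \<in> measurable (borel_span B \<Otimes>\<^sub>M borel_span C) (borel_span (B \<union> C))"
    using measurable_add
    by (simp add: measurable_cong_sets[OF sets_pair_measure_cong[OF sets_lebesgue_span sets_lebesgue_span] refl])
  have "distr (lebesgue_span B \<Otimes>\<^sub>M lebesgue_span C) (borel_span (B \<union> C)) (\<lambda>(x, y). x + y)
      = distr (distr (?PB \<Otimes>\<^sub>M ?PC) (borel_span B \<Otimes>\<^sub>M borel_span C) (\<lambda>(c, d). (B.synth c, C.synth d)))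
          (borel_span (B \<union> C)) (\<lambda>(x, y). x + y)"
    unfolding B.lebesgue_span_synth C.lebesgue_span_synth
    by (subst pair_measure_distr)
      (auto simp: C.lebesgue_span_synth[symmetric] LC.sigma_finite_measure_axioms)
  also have "\<dots> = distr (?PB \<Otimes>\<^sub>M ?PC) (borel_span (B \<union> C))
      ((\<lambda>(x, y). x + y) \<circ> (\<lambda>(c, d). (B.synth c, C.synth d)))"
    by (rule distr_distr[OF m2 m1])
  also have "\<dots> = distr (?PB \<Otimes>\<^sub>M ?PC) (borel_span (B \<union> C)) (U.synth \<circ> merge B C)"
  proof (rule distr_cong)
    fix z assume "z \<in> space (?PB \<Otimes>\<^sub>M ?PC)"
    have "U.synth (merge B C (c, d)) = B.synth c + C.synth d" for c d
    proof -
      have "(\<Sum>b\<in>C. merge B C (c, d) b *\<^sub>R b) = (\<Sum>b\<in>C. d b *\<^sub>R b)"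
        using disjoint by (intro sum.cong) (auto simp: merge_def)
      then show ?thesis
        using disjoint B.finite C.finite
        by (simp add: U.synth_def B.synth_def C.synth_def sum.union_disjoint merge_def)
    qed
    then show "((\<lambda>(x, y). x + y) \<circ> (\<lambda>(c, d). (B.synth c, C.synth d))) z = (U.synth \<circ> merge B C) z"
      by (cases z) simp
  qed auto
  also have "\<dots> = distr (distr (?PB \<Otimes>\<^sub>M ?PC) ?PU (merge B C)) (borel_span (B \<union> C)) U.synth"
    by (rule distr_distr[symmetric]) measurable
  also have "\<dots> = lebesgue_span (B \<union> C)"
    unfolding U.lebesgue_span_synth
    by (subst distr_merge[OF disjoint B.finite C.finite]) simp
  finally show ?thesis ..
qed

lemma measurable_comp_add:
  assumes "F \<in> measurable (lebesgue_span (B \<union> C)) N"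
  shows "(\<lambda>(x, y). F (x + y)) \<in> measurable (lebesgue_span B \<Otimes>\<^sub>M lebesgue_span C) N"
proof -
  have "F \<in> measurable (borel_span (B \<union> C)) N"
    using assms by (simp add: measurable_cong_sets[OF sets_lebesgue_span refl])
  from measurable_compose[OF measurable_add this] show ?thesis by (simp add: split_beta')
qed

lemma nn_integral_Un:
  assumes F: "F \<in> borel_measurable (lebesgue_span (B \<union> C))"
  shows "(\<integral>\<^sup>+z. F z \<partial>lebesgue_span (B \<union> C))
    = (\<integral>\<^sup>+x. \<integral>\<^sup>+y. F (x + y) \<partial>lebesgue_span C \<partial>lebesgue_span B)"
proof -
  have "F \<in> borel_measurable (borel_span (B \<union> C))"
    using F by (simp add: measurable_cong_sets[OF sets_lebesgue_span refl])
  then have "(\<integral>\<^sup>+z. F z \<partial>lebesgue_span (B \<union> C))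
      = (\<integral>\<^sup>+z. (case z of (x, y) \<Rightarrow> F (x + y)) \<partial>(lebesgue_span B \<Otimes>\<^sub>M lebesgue_span C))"
    by (subst lebesgue_span_Un) (simp add: nn_integral_distr split_beta')
  also have "\<dots> = (\<integral>\<^sup>+x. \<integral>\<^sup>+y. F (x + y) \<partial>lebesgue_span C \<partial>lebesgue_span B)"
    using LC.nn_integral_fst[OF measurable_comp_add[OF F]] by simp
  finally show ?thesis .
qed

lemma integral_Un:
  fixes F :: "'e \<Rightarrow> real"
  assumes F: "F \<in> borel_measurable (lebesgue_span (B \<union> C))"
  shows "(\<integral>z. F z \<partial>lebesgue_span (B \<union> C))
      = (\<integral>z. F (fst z + snd z) \<partial>(lebesgue_span B \<Otimes>\<^sub>M lebesgue_span C))"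
    and "integrable (lebesgue_span (B \<union> C)) F
      \<longleftrightarrow> integrable (lebesgue_span B \<Otimes>\<^sub>M lebesgue_span C) (\<lambda>z. F (fst z + snd z))"
proof -
  have "F \<in> borel_measurable (borel_span (B \<union> C))"
    using F by (simp add: measurable_cong_sets[OF sets_lebesgue_span refl])
  then show "(\<integral>z. F z \<partial>lebesgue_span (B \<union> C))
      = (\<integral>z. F (fst z + snd z) \<partial>(lebesgue_span B \<Otimes>\<^sub>M lebesgue_span C))"
    "integrable (lebesgue_span (B \<union> C)) F
      \<longleftrightarrow> integrable (lebesgue_span B \<Otimes>\<^sub>M lebesgue_span C) (\<lambda>z. F (fst z + snd z))"
    by (subst lebesgue_span_Un, simp add: integral_distr integrable_distr_eq split_beta')+
qed

text \<open>The exceptional set is enclosed in a measurable null set \<open>N\<close>; by Tonelli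
  almost every slice of \<open>N\<close> parallel to \<open>span C\<close> is null.\<close>

lemma AE_Un:
  assumes "AE z in lebesgue_span (B \<union> C). Q z"
  shows "AE x in lebesgue_span B. AE y in lebesgue_span C. Q (x + y)"
proof -
  obtain N where N: "{z \<in> space (lebesgue_span (B \<union> C)). \<not> Q z} \<subseteq> N" "emeasure (lebesgue_span (B \<union> C)) N = 0"
      "N \<in> sets (lebesgue_span (B \<union> C))"
    using assms by (rule AE_E)
  have "(\<integral>\<^sup>+x. \<integral>\<^sup>+y. indicator N (x + y) \<partial>lebesgue_span C \<partial>lebesgue_span B) = 0"
    using nn_integral_Un[of "indicator N"] N by simp
  moreover have m: "(\<lambda>(x, y). indicator N (x + y) :: ennreal) \<in> borel_measurable (lebesgue_span B \<Otimes>\<^sub>M lebesgue_span C)"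
    using N(3) by (intro measurable_comp_add) simp
  moreover have "(\<lambda>x. \<integral>\<^sup>+y. indicator N (x + y) \<partial>lebesgue_span C) \<in> borel_measurable (lebesgue_span B)"
    using LC.borel_measurable_nn_integral[OF m] by simp
  ultimately have "AE x in lebesgue_span B. (\<integral>\<^sup>+y. indicator N (x + y) \<partial>lebesgue_span C) = 0"
    by (subst (asm) nn_integral_0_iff_AE) auto
  then show ?thesis
    using AE_space
  proof eventually_elim
    case (elim x)
    have "(\<lambda>y. indicator N (x + y) :: ennreal) \<in> borel_measurable (lebesgue_span C)"
      using measurable_Pair2[OF m, of x] elim by simp
    with elim have "AE y in lebesgue_span C. (indicator N (x + y) :: ennreal) = 0"
      by (subst (asm) nn_integral_0_iff_AE) auto
    then show ?case
      using AE_space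
    proof eventually_elim
      case (elim y)
      then have "x + y \<notin> N" by (simp add: indicator_def split: if_splits)
      moreover have "x + y \<in> span (B \<union> C)" using \<open>x \<in> space (lebesgue_span B)\<close> elim by (simp add: add_in_span)
      ultimately show ?case using N(1) by auto
    qed
  qed
qed

section \<open>Marginal densities and conditional distributions\<close>

lemma measurable_projection: "P \<in> measurable (lebesgue_span (B \<union> C)) (borel_span B)"
proof (rule measurable_restrict_space2)
  \<comment> \<open>On the relevant span \<open>P\<close> is the orthogonal expansion along
    \<open>B\<close>, which is continuous on the whole space; this is the source of
    measurability.\<close>
  have eq: "P z = (\<Sum>b\<in>B. ip z b *\<^sub>R b)" if z: "z \<in> span (B \<union> C)" for z
  proof -
    obtain x y where xy: "z = x + y" "x \<in> span B" "y \<in> span C" using z unfolding span_Un by blast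
    have "(\<Sum>b\<in>B. ip z b *\<^sub>R b) = (\<Sum>b\<in>B. ip x b *\<^sub>R b)"
      using xy by (intro sum.cong) (auto simp: B.ip_add ip_span_right)
    then show ?thesis using xy projection B.span_expansion by simp
  qed
  show "P \<in> space (lebesgue_span (B \<union> C)) \<rightarrow> span B"
    by (auto simp: eq) (intro span_sum span_scale span_base)
  have "(\<lambda>z. \<Sum>b\<in>B. ip z b *\<^sub>R b) \<in> borel_measurable borel"
    by (intro borel_measurable_continuous_onI continuous_intros B.continuous_ip)
  then have "(\<lambda>z. \<Sum>b\<in>B. ip z b *\<^sub>R b) \<in> borel_measurable (lebesgue_span (B \<union> C))" by blast
  then show "P \<in> borel_measurable (lebesgue_span (B \<union> C))"
    by (rule measurable_cong[THEN iffD1, rotated]) (simp add: eq)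
qed

text \<open>Integration over the fibres of \<open>P\<close>: the indicator of the preimage of
  \<open>A\<close> at \<open>x + y\<close> is the indicator of \<open>A\<close> at \<open>x\<close>,
  so it leaves the inner integral.\<close>

lemma distr_projection_density:
  assumes F: "F \<in> borel_measurable (lebesgue_span (B \<union> C))"
  shows "distr (density (lebesgue_span (B \<union> C)) F) (borel_span B) P
    = density (lebesgue_span B) (\<lambda>x. \<integral>\<^sup>+y. F (x + y) \<partial>lebesgue_span C)" (is "?l = ?r")
proof (rule measure_eqI)
  show "sets ?l = sets ?r" by (simp add: sets_lebesgue_span)
  fix A assume "A \<in> sets ?l"
  then have A: "A \<in> sets (borel_span B)" "A \<in> sets (lebesgue_span B)" by (auto simp: sets_lebesgue_span)
  have PA: "P -` A \<inter> span (B \<union> C) \<in> sets (lebesgue_span (B \<union> C))"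
    using measurable_sets[OF measurable_projection A(1)] by simp
  have Pm: "P \<in> measurable (density (lebesgue_span (B \<union> C)) F) (borel_span B)"
    using measurable_projection by simp
  have mF: "(\<lambda>x. \<integral>\<^sup>+y. F (x + y) \<partial>lebesgue_span C) \<in> borel_measurable (lebesgue_span B)"
    using LC.borel_measurable_nn_integral[OF measurable_comp_add[OF F]] by simp
  have "emeasure ?l A = (\<integral>\<^sup>+z. F z * indicator (P -` A \<inter> span (B \<union> C)) z \<partial>lebesgue_span (B \<union> C))"
    using F PA by (subst emeasure_distr[OF Pm A(1)]) (simp add: emeasure_density)
  also have "\<dots> = (\<integral>\<^sup>+x. \<integral>\<^sup>+y. F (x + y) * indicator (P -` A \<inter> span (B \<union> C)) (x + y) \<partial>lebesgue_span C \<partial>lebesgue_span B)"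
    using F PA by (intro nn_integral_Un) auto
  also have "\<dots> = (\<integral>\<^sup>+x. (\<integral>\<^sup>+y. F (x + y) \<partial>lebesgue_span C) * indicator A x \<partial>lebesgue_span B)"
  proof (rule nn_integral_cong)
    fix x assume "x \<in> space (lebesgue_span B)"
    then have x: "x \<in> span B" by simp
    have "(\<lambda>y. F (x + y)) \<in> borel_measurable (lebesgue_span C)"
      using measurable_Pair2[OF measurable_comp_add[OF F], of x] x by simp
    moreover have "(\<integral>\<^sup>+y. F (x + y) * indicator (P -` A \<inter> span (B \<union> C)) (x + y) \<partial>lebesgue_span C)
      = (\<integral>\<^sup>+y. F (x + y) * indicator A x \<partial>lebesgue_span C)"
      using x by (intro nn_integral_cong) (auto simp: projection add_in_span indicator_def)
    ultimately show "(\<integral>\<^sup>+y. F (x + y) * indicator (P -` A \<inter> span (B \<union> C)) (x + y) \<partial>lebesgue_span C)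
      = (\<integral>\<^sup>+y. F (x + y) \<partial>lebesgue_span C) * indicator A x"
      by (simp add: nn_integral_multc)
  qed
  also have "\<dots> = emeasure ?r A" using A mF by (simp add: emeasure_density)
  finally show "emeasure ?l A = emeasure ?r A" .
qed

lemma projection_density_marginal:
  assumes f: "f \<in> borel_measurable (lebesgue_span (B \<union> C))" and p: "p \<in> borel_measurable (lebesgue_span B)"
    and "distr (density (lebesgue_span (B \<union> C)) f) (borel_span B) P = density (lebesgue_span B) p"
  shows "AE x in lebesgue_span B. (\<integral>\<^sup>+y. f (x + y) \<partial>lebesgue_span C) = p x"
proof (rule LB.density_unique)
  show "(\<lambda>x. \<integral>\<^sup>+y. f (x + y) \<partial>lebesgue_span C) \<in> borel_measurable (lebesgue_span B)"
    using LC.borel_measurable_nn_integral[OF measurable_comp_add[OF f]] by simp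
  show "density (lebesgue_span B) (\<lambda>x. \<integral>\<^sup>+y. f (x + y) \<partial>lebesgue_span C) = density (lebesgue_span B) p"
    using assms(3) by (simp add: distr_projection_density[OF f])
qed (rule p)

text \<open>\<open>cond_dist\<close> is built from Radon-Nikodym derivatives, which agree with the
  chosen densities only almost everywhere. \<open>AE_Un\<close> turns the exceptional set in the sum
  into null sets in almost every fibre, where it does not affect the conditional measure.\<close>

lemma cond_dist_density:
  fixes f p :: "'e \<Rightarrow> real"
  assumes f: "f \<in> borel_measurable (lebesgue_span (B \<union> C))" and p: "p \<in> borel_measurable (lebesgue_span B)"
    and pos: "\<And>z. 0 < f z" "\<And>x. 0 < p x"
    and \<mu>: "\<mu> = density (lebesgue_span (B \<union> C)) f"
    and marg: "distr \<mu> (borel_span B) P = density (lebesgue_span B) p"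
  shows "AE x in lebesgue_span B.
    cond_dist B C P \<mu> x = density (lebesgue_span C) (\<lambda>y. ennreal (f (x + y) / p x))"
proof -
  let ?R = "RN_deriv (lebesgue_span (B \<union> C)) \<mu>"
  have "AE z in lebesgue_span (B \<union> C). ennreal (f z) = ?R z"
    using f by (intro LU.RN_deriv_unique) (auto simp: \<mu>)
  then have "AE x in lebesgue_span B. AE y in lebesgue_span C. ennreal (f (x + y)) = ?R (x + y)"
    by (rule AE_Un)
  moreover have "AE x in lebesgue_span B. ennreal (p x) = RN_deriv (lebesgue_span B) (distr \<mu> (borel_span B) P) x"
    using p by (intro LB.RN_deriv_unique) (auto simp: marg)
  ultimately show ?thesis using AE_space
  proof eventually_elim
    case (elim x)
    have R: "(\<lambda>y. ?R (x + y)) \<in> borel_measurable (lebesgue_span C)"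
      using measurable_Pair2[OF measurable_comp_add[of ?R borel], of x] elim(3) by simp
    have F: "(\<lambda>y. f (x + y)) \<in> borel_measurable (lebesgue_span C)"
      using measurable_Pair2[OF measurable_comp_add[OF f], of x] elim(3) by simp
    show ?case
      unfolding cond_dist_def elim(2)[symmetric]
    proof (rule density_cong)
      show "AE y in lebesgue_span C. ?R (x + y) / ennreal (p x) = ennreal (f (x + y) / p x)"
        using elim(1) by eventually_elim (metis divide_ennreal less_imp_le pos)
    qed (use R F in measurable)
  qed
qed

lemma rel_entropy_Ext_G:
  assumes \<mu>: "\<mu> \<in> Ext_G ip B C P \<mu>0" and \<nu>: "\<nu> \<in> Ext_G ip B C P \<nu>0"
    and \<mu>0: "nondegenerate_gaussian ip B \<mu>0" and \<nu>0: "nondegenerate_gaussian ip B \<nu>0"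
  shows "rel_entropy \<mu>0 \<nu>0 \<le> rel_entropy \<mu> \<nu>" (is ?le)
    and "rel_entropy \<mu> \<nu> = rel_entropy \<mu>0 \<nu>0 \<longleftrightarrow> (AE x in \<mu>0. cond_dist B C P \<mu> x = cond_dist B C P \<nu> x)" (is ?eq)
proof -
  obtain p where p: "B.gaussian_density p" "\<mu>0 = density (lebesgue_span B) p"
    using \<mu>0 by (rule B.nondegenerate_gaussian_densityE)
  obtain q where q: "B.gaussian_density q" "\<nu>0 = density (lebesgue_span B) q"
    using \<nu>0 by (rule B.nondegenerate_gaussian_densityE)
  obtain f where f: "U.gaussian_density f" "\<mu> = density (lebesgue_span (B \<union> C)) f"
    using \<mu> unfolding Ext_G_def by (blast elim: U.nondegenerate_gaussian_densityE)
  obtain g where g: "U.gaussian_density g" "\<nu> = density (lebesgue_span (B \<union> C)) g"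
    using \<nu> unfolding Ext_G_def by (blast elim: U.nondegenerate_gaussian_densityE)
  note meas = B.gaussian_density_measurable(2)[OF p(1)] B.gaussian_density_measurable(2)[OF q(1)]
    U.gaussian_density_measurable(2)[OF f(1)] U.gaussian_density_measurable(2)[OF g(1)]
  have pos: "0 < p x" "0 < q x" "0 < f x" "0 < g x" for x
    using p q f g by (auto simp: B.gaussian_density_def U.gaussian_density_def)
  have marg: "distr \<mu> (borel_span B) P = density (lebesgue_span B) p"
      "distr \<nu> (borel_span B) P = density (lebesgue_span B) q"
    using \<mu> \<nu> p q by (auto simp: Ext_G_def)
  have mp: "AE x in lebesgue_span B. (\<integral>\<^sup>+y. ennreal (f (fst (x, y) + snd (x, y))) \<partial>lebesgue_span C) = ennreal (p x)"
    using projection_density_marginal[of "\<lambda>z. ennreal (f z)" "\<lambda>x. ennreal (p x)"] meas marg f(2) by simp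
  have mq: "AE x in lebesgue_span B. (\<integral>\<^sup>+y. ennreal (g (fst (x, y) + snd (x, y))) \<partial>lebesgue_span C) = ennreal (q x)"
    using projection_density_marginal[of "\<lambda>z. ennreal (g z)" "\<lambda>x. ennreal (q x)"] meas marg g(2) by simp
  have p1: "(\<integral>\<^sup>+x. ennreal (p x) \<partial>lebesgue_span B) = 1" using p by (simp add: B.gaussian_density_def)
  have m2: "(\<lambda>z. f (fst z + snd z)) \<in> borel_measurable (lebesgue_span B \<Otimes>\<^sub>M lebesgue_span C)"
      "(\<lambda>z. g (fst z + snd z)) \<in> borel_measurable (lebesgue_span B \<Otimes>\<^sub>M lebesgue_span C)"
    using measurable_comp_add[OF meas(3)] measurable_comp_add[OF meas(4)] by (simp_all add: split_beta')
  have mln: "(\<lambda>z. f z * ln (f z / g z)) \<in> borel_measurable (lebesgue_span (B \<union> C))"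
    using meas by measurable
  have int_f: "integrable (lebesgue_span B \<Otimes>\<^sub>M lebesgue_span C)
      (\<lambda>z. f (fst z + snd z) * ln (f (fst z + snd z) / g (fst z + snd z)))"
    using U.gaussian_density_integrable_ln[OF f(1) g(1)] integral_Un(2)[OF mln] by simp
  note re = relative_entropy_marginal[OF m2 meas(1,2) pos(3,4,1,2) mp mq p1 int_f
      B.gaussian_density_integrable_ln[OF p(1) q(1)]]
  have D: "rel_entropy \<mu> \<nu> = (\<integral>z. f (fst z + snd z) * ln (f (fst z + snd z) / g (fst z + snd z))
      \<partial>(lebesgue_span B \<Otimes>\<^sub>M lebesgue_span C))"
    unfolding f(2) g(2) U.rel_entropy_gaussian_density[OF f(1) g(1)] by (rule integral_Un(1)[OF mln])
  have D0: "rel_entropy \<mu>0 \<nu>0 = (\<integral>x. p x * ln (p x / q x) \<partial>lebesgue_span B)"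
    unfolding p(2) q(2) by (rule B.rel_entropy_gaussian_density[OF p(1) q(1)])
  show ?le unfolding D D0 by (rule re(1))
  have "rel_entropy \<mu> \<nu> = rel_entropy \<mu>0 \<nu>0 \<longleftrightarrow>
      (AE x in lebesgue_span B. AE y in lebesgue_span C. f (x + y) / p x = g (x + y) / q x)"
    unfolding D D0 re(2) by simp
  \<comment> \<open>For fixed \<open>x\<close>, two densities over a sigma-finite measure define the
    same measure exactly when they agree almost everywhere in \<open>y\<close>.\<close>
  also have "\<dots> \<longleftrightarrow> (AE x in lebesgue_span B. cond_dist B C P \<mu> x = cond_dist B C P \<nu> x)"
  proof (rule eventually_subst)
    show "AE x in lebesgue_span B. (AE y in lebesgue_span C. f (x + y) / p x = g (x + y) / q x)
      \<longleftrightarrow> cond_dist B C P \<mu> x = cond_dist B C P \<nu> x"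
      using cond_dist_density[OF meas(3,1) pos(3,1) f(2) marg(1)]
        cond_dist_density[OF meas(4,2) pos(4,2) g(2) marg(2)] AE_space
    proof eventually_elim
      case (elim x)
      have "(\<lambda>y. f (x + y)) \<in> borel_measurable (lebesgue_span C)" "(\<lambda>y. g (x + y)) \<in> borel_measurable (lebesgue_span C)"
        using measurable_Pair2[OF measurable_comp_add[OF meas(3)], of x]
          measurable_Pair2[OF measurable_comp_add[OF meas(4)], of x] elim(3) by simp_all
      then have "density (lebesgue_span C) (\<lambda>y. ennreal (f (x + y) / p x)) = density (lebesgue_span C) (\<lambda>y. ennreal (g (x + y) / q x))
          \<longleftrightarrow> (AE y in lebesgue_span C. ennreal (f (x + y) / p x) = ennreal (g (x + y) / q x))"
        by (intro LC.density_unique_iff measurable_compose[OF _ measurable_ennreal] borel_measurable_divide) auto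
      then show ?case using pos by (simp add: elim(1,2) less_imp_le)
    qed
  qed
  \<comment> \<open>The density \<open>p\<close> of \<open>\<mu>0\<close> is positive everywhere, so
    \<open>\<mu>0\<close> and Lebesgue measure have the same null sets.\<close>
  also have "\<dots> \<longleftrightarrow> (AE x in \<mu>0. cond_dist B C P \<mu> x = cond_dist B C P \<nu> x)"
    unfolding p(2) using meas(1) pos(1) by (subst AE_density) auto
  finally show ?eq .
qed

text \<open>The witness is the product with the standard Gaussian on \<^term>\<open>span C\<close>.\<close>

lemma product_extension:
  assumes "nondegenerate_gaussian ip B \<mu>0"
  obtains \<mu> where "\<mu> \<in> Ext_G ip B C P \<mu>0"
    "AE x in \<mu>0. cond_dist B C P \<mu> x = density (lebesgue_span C) (\<lambda>y. ennreal
       (gauss_kernel ip C 0 (\<lambda>b b'. of_bool (b = b')) y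
         / (LINT y|lebesgue_span C. gauss_kernel ip C 0 (\<lambda>b b'. of_bool (b = b')) y)))"
proof -
  obtain m S Q where m: "m \<in> span B"
    and sym: "\<forall>b\<in>B. \<forall>b'\<in>B. S b b' = S b' b"
    and S: "\<forall>c. (\<exists>b\<in>B. c b \<noteq> 0) \<longrightarrow> 0 < (\<Sum>b\<in>B. \<Sum>b'\<in>B. c b * S b b' * c b')"
    and SQ: "\<forall>b\<in>B. \<forall>b'\<in>B. (\<Sum>e\<in>B. S b e * Q e b') = of_bool (b = b')"
    and \<mu>0: "\<mu>0 = density (lebesgue_span B)
        (\<lambda>x. ennreal (gauss_kernel ip B m Q x / (LINT y|lebesgue_span B. gauss_kernel ip B m Q y)))"
    using assms unfolding nondegenerate_gaussian_def by (elim exE conjE) rule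
  note S = S[rule_format] and SQ = SQ[rule_format]
  let ?I = "\<lambda>b b'. of_bool (b = b') :: real"
  \<comment> \<open>Block diagonal with the identity on \<open>C\<close>: the covariance of
    \<open>\<mu>0\<close> together with an independent standard Gaussian. \<open>Q'\<close> is the
    inverse matrix.\<close>
  define S' where "S' b b' = (if b \<in> B \<and> b' \<in> B then S b b' else ?I b b')" for b b'
  define Q' where "Q' b b' = (if b \<in> B \<and> b' \<in> B then Q b b' else ?I b b')" for b b'
  have sumU: "(\<Sum>b\<in>B \<union> C. h b) = (\<Sum>b\<in>B. h b) + (\<Sum>b\<in>C. h b)" for h :: "'e \<Rightarrow> real"
    using disjoint B.finite C.finite by (rule sum.union_disjoint[rotated 2])
  have notin: "b \<in> C \<Longrightarrow> b \<notin> B" for b using disjoint by blast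
  \<comment> \<open>Applied with \<open>T = S\<close> for positive definiteness and with
    \<open>T = Q\<close> for the factorization of the kernel.\<close>
  have block: "(\<Sum>b\<in>B \<union> C. \<Sum>b'\<in>B \<union> C. u b * (if b \<in> B \<and> b' \<in> B then T b b' else ?I b b') * u b')
      = (\<Sum>b\<in>B. \<Sum>b'\<in>B. u b * T b b' * u b') + (\<Sum>b\<in>C. u b * u b)" for u T
  proof -
    have "(\<Sum>b'\<in>B \<union> C. u b * (if b \<in> B \<and> b' \<in> B then T b b' else ?I b b') * u b')
        = (\<Sum>b'\<in>B. u b * T b b' * u b')" if b: "b \<in> B" for b
    proof -
      have "(\<Sum>b'\<in>C. u b * (if b \<in> B \<and> b' \<in> B then T b b' else ?I b b') * u b') = 0"
        using b notin by (intro sum.neutral) auto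
      moreover have "(\<Sum>b'\<in>B. u b * (if b \<in> B \<and> b' \<in> B then T b b' else ?I b b') * u b') = (\<Sum>b'\<in>B. u b * T b b' * u b')"
        using b by (intro sum.cong) auto
      ultimately show ?thesis by (simp add: sumU)
    qed
    moreover have "(\<Sum>b'\<in>B \<union> C. u b * (if b \<in> B \<and> b' \<in> B then T b b' else ?I b b') * u b')
        = u b * u b" if b: "b \<in> C" for b
    proof -
      have "(\<Sum>b'\<in>B \<union> C. u b * (if b \<in> B \<and> b' \<in> B then T b b' else ?I b b') * u b')
          = (\<Sum>b'\<in>B \<union> C. if b = b' then u b * u b' else 0)"
        using b notin by (intro sum.cong) auto
      then show ?thesis using b U.finite by simp
    qed
    ultimately show ?thesis by (simp add: sumU[of "\<lambda>b. \<Sum>b'\<in>B \<union> C. _ b b'"])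
  qed
  have S'pos: "0 < (\<Sum>b\<in>B \<union> C. \<Sum>b'\<in>B \<union> C. c b * S' b b' * c b')" if c: "\<exists>b\<in>B \<union> C. c b \<noteq> 0" for c
  proof -
    have nn: "0 \<le> (\<Sum>b\<in>C. c b * c b)" by (intro sum_nonneg) auto
    show ?thesis
    proof (cases "\<exists>b\<in>B. c b \<noteq> 0")
      case True
      then show ?thesis using S[OF True] nn unfolding S'_def block by simp
    next
      case False
      then obtain b where b: "b \<in> C" "c b \<noteq> 0" using c by blast
      have "0 < (\<Sum>b\<in>C. c b * c b)" using b by (intro sum_pos2[OF C.finite, of b]) (auto simp: zero_less_mult_iff linorder_neq_iff)
      moreover have "(\<Sum>b\<in>B. \<Sum>b'\<in>B. c b * S b b' * c b') = 0" using False by (auto intro!: sum.neutral)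
      ultimately show ?thesis unfolding S'_def block by simp
    qed
  qed
  have S'Q': "(\<Sum>e\<in>B \<union> C. S' b e * Q' e b') = of_bool (b = b')" if bb: "b \<in> B \<union> C" "b' \<in> B \<union> C" for b b'
  proof (cases "b \<in> B")
    case bB: True
    show ?thesis
    proof (cases "b' \<in> B")
      case True
      have "(\<Sum>e\<in>C. S' b e * Q' e b') = 0"
        using bB True notin by (intro sum.neutral) (auto simp: S'_def Q'_def)
      moreover have "(\<Sum>e\<in>B. S' b e * Q' e b') = (\<Sum>e\<in>B. S b e * Q e b')"
        using bB True by (intro sum.cong) (auto simp: S'_def Q'_def)
      ultimately show ?thesis using SQ[OF bB True] by (simp add: sumU)
    next
      case False
      then show ?thesis using bB notin
        by (subst sum.neutral) (auto simp: S'_def Q'_def)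
    qed
  next
    case False
    have "(\<Sum>e\<in>B \<union> C. S' b e * Q' e b') = (\<Sum>e\<in>B \<union> C. if b = e then ?I b b' else 0)"
      using False by (intro sum.cong) (auto simp: S'_def Q'_def)
    then show ?thesis using bb U.finite by simp
  qed
  have mU: "m \<in> span (B \<union> C)" using m by (meson Un_upper1 span_mono subsetD)
  define k where "k = gauss_kernel ip (B \<union> C) m Q'"
  define k1 where "k1 = gauss_kernel ip B m Q"
  define k2 where "k2 = gauss_kernel ip C 0 ?I"
  have k_split: "k (x + y) = k1 x * k2 y" if x: "x \<in> span B" and y: "y \<in> span C" for x y
  proof -
    have "ip (x + y - m) b = ip (x - m) b" if "b \<in> B" for b
      using ip_span_right[OF y that] by (simp add: B.ip_add B.ip_diff)
    moreover have "ip (x + y - m) b = ip y b" if "b \<in> C" for b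
      using ip_span_left[OF x that] ip_span_left[OF m that] by (simp add: B.ip_add B.ip_diff)
    moreover have "(\<Sum>b\<in>C. \<Sum>b'\<in>C. ip y b * ?I b b' * ip y b') = (\<Sum>b\<in>C. ip y b * ip y b)"
    proof (rule sum.cong[OF refl])
      fix b assume "b \<in> C"
      have "(\<Sum>b'\<in>C. ip y b * ?I b b' * ip y b') = (\<Sum>b'\<in>C. if b = b' then ip y b * ip y b' else 0)"
        by (intro sum.cong) auto
      then show "(\<Sum>b'\<in>C. ip y b * ?I b b' * ip y b') = ip y b * ip y b"
        using \<open>b \<in> C\<close> C.finite by simp
    qed
    ultimately have "k (x + y) = exp (- ((\<Sum>b\<in>B. \<Sum>b'\<in>B. ip (x - m) b * Q b b' * ip (x - m) b')
        + (\<Sum>b\<in>C. \<Sum>b'\<in>C. ip y b * ?I b b' * ip y b')) / 2)"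
      unfolding k_def gauss_kernel_def Q'_def block by (simp cong: sum.cong)
    also have "\<dots> = k1 x * k2 y"
      by (simp add: k1_def k2_def gauss_kernel_def exp_add[symmetric] add_divide_distrib)
    finally show ?thesis .
  qed
  have Ipos: "0 < (\<Sum>b\<in>C. \<Sum>b'\<in>C. c b * ?I b b' * c b')" if ex: "\<exists>b\<in>C. c b \<noteq> 0" for c
  proof -
    have "(\<Sum>b\<in>C. \<Sum>b'\<in>C. c b * ?I b b' * c b') = (\<Sum>b\<in>C. c b * c b)"
    proof (rule sum.cong[OF refl])
      fix b assume "b \<in> C"
      have "(\<Sum>b'\<in>C. c b * ?I b b' * c b') = (\<Sum>b'\<in>C. if b = b' then c b * c b' else 0)"
        by (intro sum.cong) auto
      then show "(\<Sum>b'\<in>C. c b * ?I b b' * c b') = c b * c b" using \<open>b \<in> C\<close> C.finite by simp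
    qed
    moreover obtain b where "b \<in> C" "c b \<noteq> 0" using ex by blast
    ultimately show ?thesis by (simp only:) (intro sum_pos2[OF C.finite, of b], auto simp: zero_less_mult_iff linorder_neq_iff)
  qed
  have II: "(\<Sum>e\<in>C. ?I b e * ?I e b') = of_bool (b = b')" if "b \<in> C" "b' \<in> C" for b b'
  proof -
    have "(\<Sum>e\<in>C. ?I b e * ?I e b') = (\<Sum>e\<in>C. if b = e then ?I b b' else 0)" by (intro sum.cong) auto
    then show ?thesis using that C.finite by simp
  qed
  define Z where "Z = (LINT z|lebesgue_span (B \<union> C). k z)"
  define Z1 where "Z1 = (LINT z|lebesgue_span B. k1 z)"
  define Z2 where "Z2 = (LINT z|lebesgue_span C. k2 z)"
  have gU1: "U.gaussian_density (\<lambda>z. k z / Z)"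
    unfolding k_def Z_def using mU S'pos S'Q' by (rule U.gaussian_density_normalized_kernel(1))
  have gU2: "integrable (lebesgue_span (B \<union> C)) k"
    unfolding k_def Z_def using mU S'pos S'Q' by (rule U.gaussian_density_normalized_kernel(2))
  have gB1: "B.gaussian_density (\<lambda>z. k1 z / Z1)"
    unfolding k1_def Z1_def using m S SQ by (rule B.gaussian_density_normalized_kernel(1))
  have gB2: "integrable (lebesgue_span B) k1"
    unfolding k1_def Z1_def using m S SQ by (rule B.gaussian_density_normalized_kernel(2))
  have gC1: "C.gaussian_density (\<lambda>z. k2 z / Z2)"
    unfolding k2_def Z2_def using span_0 Ipos II by (rule C.gaussian_density_normalized_kernel(1))
  have gC2: "integrable (lebesgue_span C) k2"
    unfolding k2_def Z2_def using span_0 Ipos II by (rule C.gaussian_density_normalized_kernel(2))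
  \<comment> \<open>Fubini yields the product rule for the normalizing constants without computing
    any of them; integrability of the product is inherited from \<open>k\<close>.\<close>
  have Zs: "Z = Z1 * Z2"
  proof -
    have eq: "k (fst z + snd z) = k1 (fst z) * k2 (snd z)"
      if "z \<in> space (lebesgue_span B \<Otimes>\<^sub>M lebesgue_span C)" for z
      using that k_split by (auto simp: space_pair_measure)
    have "integrable (lebesgue_span B \<Otimes>\<^sub>M lebesgue_span C) (\<lambda>z. k (fst z + snd z))"
      using gU2 integral_Un(2)[OF borel_measurable_integrable[OF gU2]] by simp
    then have i: "integrable (lebesgue_span B \<Otimes>\<^sub>M lebesgue_span C) (\<lambda>z. k1 (fst z) * k2 (snd z))"
      using eq by (subst (asm) Bochner_Integration.integrable_cong[OF refl]) auto
    have "Z = (\<integral>z. k (fst z + snd z) \<partial>(lebesgue_span B \<Otimes>\<^sub>M lebesgue_span C))"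
      unfolding Z_def by (rule integral_Un(1)[OF borel_measurable_integrable[OF gU2]])
    also have "\<dots> = (\<integral>z. k1 (fst z) * k2 (snd z) \<partial>(lebesgue_span B \<Otimes>\<^sub>M lebesgue_span C))"
      by (intro Bochner_Integration.integral_cong refl eq)
    also have "\<dots> = (\<integral>x. \<integral>y. k1 x * k2 y \<partial>lebesgue_span C \<partial>lebesgue_span B)"
      using integral_fst'[OF i] by simp
    also have "\<dots> = Z1 * Z2" by (simp add: Z1_def Z2_def)
    finally show ?thesis .
  qed
  define \<mu> where "\<mu> = density (lebesgue_span (B \<union> C)) (\<lambda>z. ennreal (k z / Z))"
  have ng: "nondegenerate_gaussian ip (B \<union> C) \<mu>"
    unfolding nondegenerate_gaussian_def
  proof (intro exI conjI)
    show "m \<in> span (B \<union> C)" by (rule mU)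
    show "\<forall>b\<in>B \<union> C. \<forall>b'\<in>B \<union> C. S' b b' = S' b' b" using sym by (auto simp: S'_def)
    show "\<forall>c. (\<exists>b\<in>B \<union> C. c b \<noteq> 0) \<longrightarrow> 0 < (\<Sum>b\<in>B \<union> C. \<Sum>b'\<in>B \<union> C. c b * S' b b' * c b')"
      using S'pos by blast
    show "\<forall>b\<in>B \<union> C. \<forall>b'\<in>B \<union> C. (\<Sum>e\<in>B \<union> C. S' b e * Q' e b') = of_bool (b = b')"
      using S'Q' by blast
    show "\<mu> = density (lebesgue_span (B \<union> C)) (\<lambda>x. ennreal (gauss_kernel ip (B \<union> C) m Q' x
        / (LINT y|lebesgue_span (B \<union> C). gauss_kernel ip (B \<union> C) m Q' y)))"
      unfolding \<mu>_def Z_def k_def ..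
  qed
  have pos: "0 < k z / Z" "0 < k1 z / Z1" "0 < k2 z / Z2" for z
    using gU1 gB1 gC1 unfolding U.gaussian_density_def B.gaussian_density_def C.gaussian_density_def by blast+
  have split: "k (x + y) / Z = k1 x / Z1 * (k2 y / Z2)" if "x \<in> span B" "y \<in> span C" for x y
    using k_split[OF that] by (simp add: Zs)
  note meas = U.gaussian_density_measurable(2)[OF gU1] B.gaussian_density_measurable(2)[OF gB1]
    C.gaussian_density_measurable(2)[OF gC1]
  have d: "distr \<mu> (borel_span B) P = density (lebesgue_span B) (\<lambda>x. ennreal (k1 x / Z1))"
  proof -
    have "distr \<mu> (borel_span B) P
        = density (lebesgue_span B) (\<lambda>x. \<integral>\<^sup>+y. ennreal (k (x + y) / Z) \<partial>lebesgue_span C)"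
      unfolding \<mu>_def using meas by (intro distr_projection_density) simp
    also have "\<dots> = density (lebesgue_span B) (\<lambda>x. ennreal (k1 x / Z1))"
    proof (rule density_cong)
      have mk: "(\<lambda>z. ennreal (k z / Z)) \<in> borel_measurable (lebesgue_span (B \<union> C))" using meas by simp
      show "(\<lambda>x. \<integral>\<^sup>+y. ennreal (k (x + y) / Z) \<partial>lebesgue_span C) \<in> borel_measurable (lebesgue_span B)"
        using LC.borel_measurable_nn_integral[OF measurable_comp_add[OF mk]] by simp
      show "AE x in lebesgue_span B. (\<integral>\<^sup>+y. ennreal (k (x + y) / Z) \<partial>lebesgue_span C) = ennreal (k1 x / Z1)"
      proof (rule AE_I2)
        fix x assume "x \<in> space (lebesgue_span B)"
        then have "(\<integral>\<^sup>+y. ennreal (k (x + y) / Z) \<partial>lebesgue_span C)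
            = (\<integral>\<^sup>+y. ennreal (k1 x / Z1) * ennreal (k2 y / Z2) \<partial>lebesgue_span C)"
          by (intro nn_integral_cong) (simp only: split space_lebesgue_span ennreal_mult[OF pos(2,3)[THEN less_imp_le]])
        also have "\<dots> = ennreal (k1 x / Z1) * (\<integral>\<^sup>+y. ennreal (k2 y / Z2) \<partial>lebesgue_span C)"
          using meas by (intro nn_integral_cmult) simp
        finally show "(\<integral>\<^sup>+y. ennreal (k (x + y) / Z) \<partial>lebesgue_span C) = ennreal (k1 x / Z1)"
          using gC1 by (simp add: C.gaussian_density_def)
      qed
    qed (use meas in simp)
    finally show ?thesis .
  qed
  then have "\<mu> \<in> Ext_G ip B C P \<mu>0" using ng by (simp add: Ext_G_def \<mu>0 k1_def Z1_def)
  moreover have "AE x in \<mu>0. cond_dist B C P \<mu> x = density (lebesgue_span C) (\<lambda>y. ennreal (k2 y / Z2))"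
  proof -
    have "AE x in lebesgue_span B. cond_dist B C P \<mu> x = density (lebesgue_span C) (\<lambda>y. ennreal (k2 y / Z2))"
      using cond_dist_density[OF meas(1,2) pos(1,2) \<mu>_def d] AE_space
    proof eventually_elim
      case (elim x)
      have "ennreal (k (x + y) / Z / (k1 x / Z1)) = ennreal (k2 y / Z2)" if "y \<in> span C" for y
        using split[of x y] that elim(2) pos(2)[of x] by (metis less_irrefl nonzero_mult_div_cancel_left space_lebesgue_span)
      moreover have "(\<lambda>y. k (x + y) / Z) \<in> borel_measurable (lebesgue_span C)"
        using measurable_Pair2[OF measurable_comp_add[OF meas(1)], of x] elim(2) by simp
      then have "(\<lambda>y. ennreal (k (x + y) / Z / (k1 x / Z1))) \<in> borel_measurable (lebesgue_span C)"
        by (rule measurable_compose[OF borel_measurable_divide[OF _ borel_measurable_const] measurable_ennreal])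
      ultimately show ?case unfolding elim(1) using meas(3)
        by (intro density_cong AE_I2) (simp_all only: space_lebesgue_span measurable_compose[OF _ measurable_ennreal])
    qed
    then show ?thesis unfolding \<mu>0 k1_def[symmetric] Z1_def[symmetric]
      using meas(2) by (subst AE_density) auto
  qed
  ultimately show thesis by (rule that[unfolded k2_def[symmetric] Z2_def[symmetric]])
qed

theorem rel_entropy_minimum:
  assumes \<mu>0: "nondegenerate_gaussian ip B \<mu>0" and \<nu>0: "nondegenerate_gaussian ip B \<nu>0"
  shows "\<exists>\<mu>\<in>Ext_G ip B C P \<mu>0. \<exists>\<nu>\<in>Ext_G ip B C P \<nu>0. rel_entropy \<mu> \<nu> = rel_entropy \<mu>0 \<nu>0"
proof -
  let ?s = "density (lebesgue_span C) (\<lambda>y. ennreal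
       (gauss_kernel ip C 0 (\<lambda>b b'. of_bool (b = b')) y
         / (LINT y|lebesgue_span C. gauss_kernel ip C 0 (\<lambda>b b'. of_bool (b = b')) y)))"
  obtain p where p: "B.gaussian_density p" "\<mu>0 = density (lebesgue_span B) p"
    using \<mu>0 by (rule B.nondegenerate_gaussian_densityE)
  obtain q where q: "B.gaussian_density q" "\<nu>0 = density (lebesgue_span B) q"
    using \<nu>0 by (rule B.nondegenerate_gaussian_densityE)
  \<comment> \<open>Both measures have positive densities, hence the same null sets. The conditional
    of the extension of \<open>\<nu>0\<close> is known almost everywhere for \<open>\<nu>0\<close>,
    but is needed almost everywhere for \<open>\<mu>0\<close>.\<close>
  have AE: "(AE x in \<mu>0. R x) \<longleftrightarrow> (AE x in \<nu>0. R x)" for R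
    unfolding p(2) q(2)
    using p(1) q(1) B.gaussian_density_measurable(2)[OF p(1)] B.gaussian_density_measurable(2)[OF q(1)]
    by (simp add: AE_density B.gaussian_density_def)
  obtain \<mu> where \<mu>: "\<mu> \<in> Ext_G ip B C P \<mu>0" "AE x in \<mu>0. cond_dist B C P \<mu> x = ?s"
    using product_extension[OF \<mu>0] .
  obtain \<nu> where \<nu>: "\<nu> \<in> Ext_G ip B C P \<nu>0" "AE x in \<nu>0. cond_dist B C P \<nu> x = ?s"
    using product_extension[OF \<nu>0] .
  have "AE x in \<mu>0. cond_dist B C P \<mu> x = cond_dist B C P \<nu> x"
    using \<mu>(2) \<nu>(2)[folded AE] by eventually_elim simp
  then have "rel_entropy \<mu> \<nu> = rel_entropy \<mu>0 \<nu>0"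
    by (simp add: rel_entropy_Ext_G(2)[OF \<mu>(1) \<nu>(1) \<mu>0 \<nu>0])
  with \<mu>(1) \<nu>(1) show ?thesis by blast
qed

end

section \<open>The metric on a tetrahedron\<close>

definition pos_def :: "real^'n^'n \<Rightarrow> bool" where
  "pos_def G \<longleftrightarrow> transpose G = G \<and> (\<forall>w. w \<noteq> 0 \<longrightarrow> 0 < w \<bullet> (G *v w))"

lemma continuous_on_det:
  fixes G :: "'a::topological_space \<Rightarrow> real^'n^'n"
  assumes "continuous_on S G"
  shows "continuous_on S (\<lambda>x. det (G x))"
  unfolding det_def by (intro continuous_intros assms)

lemma continuous_on_matrix_mult:
  fixes G :: "'a::topological_space \<Rightarrow> real^'n^'m" and H :: "'a \<Rightarrow> real^'k^'n"
  assumes "continuous_on S G" "continuous_on S H"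
  shows "continuous_on S (\<lambda>x. G x ** H x)"
  unfolding matrix_matrix_mult_def by (intro continuous_intros assms)

lemma continuous_on_transpose:
  fixes G :: "'a::topological_space \<Rightarrow> real^'n^'m"
  assumes "continuous_on S G"
  shows "continuous_on S (\<lambda>x. transpose (G x))"
  unfolding transpose_def by (intro continuous_intros assms)

text \<open>Were the determinant not positive, it would vanish somewhere on the segment from the
  identity to \<open>G\<close>. A kernel vector there contradicts the positivity of both end
  forms.\<close>

lemma pos_def_det_pos:
  fixes G :: "real^'n^'n"
  assumes "pos_def G"
  shows "0 < det G"
proof (rule ccontr)
  assume neg: "\<not> 0 < det G"
  define F where "F t = (1 - t) *\<^sub>R mat 1 + t *\<^sub>R G" for t :: real
  have c: "continuous_on {0..1} (\<lambda>t. det (F t))"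
    unfolding F_def by (intro continuous_on_det continuous_intros)
  have "det (F 1) \<le> 0" "0 \<le> det (F 0)" using neg by (auto simp: F_def)
  then obtain t where t: "0 \<le> t" "t \<le> 1" "det (F t) = 0"
    using IVT2'[of "\<lambda>t. det (F t)" 1 0 0] c by auto
  then obtain w where w: "w \<noteq> 0" "F t *v w = 0"
    using matrix_left_invertible_ker[of "F t"] invertible_det_nz[of "F t"] invertible_left_inverse by blast
  have "F t *v w = (1 - t) *\<^sub>R w + t *\<^sub>R (G *v w)"
    by (simp add: F_def matrix_vector_mult_add_rdistrib scaleR_matrix_vector_assoc[symmetric])
  then have "0 = (1 - t) * (w \<bullet> w) + t * (w \<bullet> (G *v w))"
    using w by (metis inner_add_right inner_scaleR_right inner_zero_right)
  moreover have "0 < w \<bullet> w" "0 < w \<bullet> (G *v w)" using assms w by (auto simp: pos_def_def)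
  ultimately show False using t
    by (smt (verit) mult_nonneg_nonneg mult_pos_pos)
qed

text \<open>The form of the product at \<open>w\<close> is that of \<open>G\<close> at
  \<open>J *v w\<close>: a metric pulled back along an immersion is again a metric.\<close>

lemma pos_def_congruence:
  fixes G :: "real^'n^'n" and J :: "real^'n^'n"
  assumes G: "pos_def G" and J: "\<And>w. w \<noteq> 0 \<Longrightarrow> J *v w \<noteq> 0"
  shows "pos_def (transpose J ** G ** J)"
proof -
  have "w \<bullet> ((transpose J ** G ** J) *v w) = (J *v w) \<bullet> (G *v (J *v w))" for w
    by (simp add: matrix_vector_mul_assoc[symmetric] dot_lmul_matrix[symmetric] inner_commute)
      (metis dot_lmul_matrix inner_commute)
  then show ?thesis using G J
    by (auto simp: pos_def_def matrix_transpose_mul matrix_mul_assoc)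
qed

lemma matrix_inv_inverse:
  fixes G :: "real^'n^'n"
  assumes "det G \<noteq> 0"
  shows "G ** matrix_inv G = mat 1" "matrix_inv G ** G = mat 1"
proof -
  have "\<exists>B. G ** B = mat 1 \<and> B ** G = mat 1"
    using assms invertible_det_nz[of G] by (simp add: invertible_def)
  then show "G ** matrix_inv G = mat 1" "matrix_inv G ** G = mat 1"
    unfolding matrix_inv_def by (metis (mono_tags, lifting) someI_ex)+
qed

text \<open>With \<open>v = matrix_inv G *v w\<close>, the form of the inverse at \<open>w\<close>
  is that of \<open>G\<close> at \<open>v\<close>.\<close>

lemma pos_def_matrix_inv:
  fixes G :: "real^'n^'n"
  assumes "pos_def G"
  shows "pos_def (matrix_inv G)"
proof -
  have d: "det G \<noteq> 0" using pos_def_det_pos[OF assms] by simp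
  note inv = matrix_inv_inverse[OF d]
  have G: "transpose G = G" using assms by (simp add: pos_def_def)
  have "transpose (matrix_inv G) = transpose (matrix_inv G) ** (G ** matrix_inv G)"
    using inv by simp
  also have "\<dots> = transpose (G ** matrix_inv G) ** matrix_inv G"
    by (simp add: matrix_transpose_mul G matrix_mul_assoc)
  also have "\<dots> = matrix_inv G" using inv by (simp add: transpose_mat)
  finally have "transpose (matrix_inv G) = matrix_inv G" .
  moreover have "0 < w \<bullet> (matrix_inv G *v w)" if "w \<noteq> 0" for w
  proof -
    have w: "w = G *v (matrix_inv G *v w)" using inv by (simp add: matrix_vector_mul_assoc)
    then have "matrix_inv G *v w \<noteq> 0" using that by (metis matrix_vector_mult_0_right)
    then have "0 < (matrix_inv G *v w) \<bullet> (G *v (matrix_inv G *v w))" using assms by (simp add: pos_def_def)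
    then show ?thesis using w by (simp add: inner_commute)
  qed
  ultimately show ?thesis by (simp add: pos_def_def)
qed

text \<open>By Cramer's rule the entries of the inverse are quotients of determinants.\<close>

lemma continuous_on_matrix_inv_component:
  "continuous_on {G :: real^'n^'n. 0 < det G} (\<lambda>G. matrix_inv G $ i $ j)"
proof -
  have "matrix_inv G $ i $ j = det (\<chi> k l. if l = i then axis j 1 $ k else G $ k $ l) / det G"
    if "0 < det G" for G :: "real^'n^'n"
  proof -
    have "G *v (matrix_inv G *v axis j 1) = axis j 1"
      using matrix_inv_inverse(1)[of G] that by (simp add: matrix_vector_mul_assoc)
    then have "matrix_inv G *v axis j 1 = (\<chi> i. det (\<chi> k l. if l = i then axis j 1 $ k else G $ k $ l) / det G)"
      using cramer[of G] that by simp
    then show ?thesis by (simp add: matrix_vector_mult_basis column_def vec_eq_iff)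
  qed
  moreover have "continuous_on {G :: real^'n^'n. 0 < det G} (\<lambda>G. det (\<chi> k l. if l = i then axis j 1 $ k else G $ k $ l) / det G)"
  proof (intro continuous_on_divide continuous_on_det continuous_on_id continuous_on_vec_lambda)
    show "continuous_on {G :: real^'n^'n. 0 < det G} (\<lambda>G. if l = i then axis j 1 $ k else G $ k $ l)" for k l
      by (cases "l = i") (auto intro!: continuous_intros)
  qed auto
  ultimately show ?thesis by (subst continuous_on_cong[OF refl]) auto
qed

section \<open>Bounded continuous functions on the open tetrahedron\<close>

definition std_tet :: "(real^3) set" where
  "std_tet = {x. (\<forall>i. 0 \<le> x $ i) \<and> (\<Sum>i\<in>UNIV. x $ i) \<le> 1}"

lemma std_tet_interior_subset: "std_tet_interior \<subseteq> std_tet"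
  by (auto simp: std_tet_interior_def std_tet_def less_imp_le)

lemma open_std_tet_interior: "open std_tet_interior"
proof -
  have eq: "std_tet_interior = (\<Inter>i. {x. 0 < x $ i}) \<inter> {x. (\<Sum>i\<in>UNIV. x $ i) < 1}"
    by (auto simp: std_tet_interior_def)
  show ?thesis
    unfolding eq by (intro open_Int open_INT ballI open_Collect_less continuous_intros) simp
qed

lemma compact_std_tet: "compact std_tet"
proof (rule compact_eq_bounded_closed[THEN iffD2], rule conjI)
  have "norm x \<le> 1" if "x \<in> std_tet" for x :: "real^3"
  proof -
    have "norm x \<le> (\<Sum>i\<in>UNIV. \<bar>x $ i\<bar>)" by (rule norm_le_l1_cart)
    also have "\<dots> = (\<Sum>i\<in>UNIV. x $ i)" using that by (auto simp: std_tet_def)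
    finally show ?thesis using that by (simp add: std_tet_def)
  qed
  then show "bounded std_tet" by (auto simp: bounded_iff)
  have eq: "std_tet = (\<Inter>i. {x. 0 \<le> x $ i}) \<inter> {x. (\<Sum>i\<in>UNIV. x $ i) \<le> 1}"
    by (auto simp: std_tet_def)
  show "closed std_tet"
    unfolding eq by (intro closed_Int closed_INT ballI closed_Collect_le continuous_intros)
qed

text \<open>A class of integrands that is closed under sums and products and guarantees
  integrability, since the open tetrahedron has finite measure.\<close>

definition tame :: "(real^3 \<Rightarrow> real) \<Rightarrow> bool" where
  "tame f \<longleftrightarrow> continuous_on std_tet_interior f \<and> bounded (f ` std_tet_interior)"

text \<open>Continuity inside alone would allow blow-up at the boundary. If \<open>f\<close> agrees
  near each point of the closed tetrahedron with a function continuous across the boundary,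
  compactness leaves finitely many local bounds, and the sum of their absolute values is a global
  one.\<close>

lemma tame_local:
  assumes loc: "\<And>x. x \<in> std_tet \<Longrightarrow> \<exists>U F. open U \<and> x \<in> U \<and> continuous_on U F \<and>
      (\<forall>y \<in> U \<inter> std_tet_interior. f y = F y)"
  shows "tame f"
  unfolding tame_def
proof
  have "isCont f x" if x: "x \<in> std_tet_interior" for x
  proof -
    obtain U F where U: "open U" "x \<in> U" "continuous_on U F" "\<forall>y \<in> U \<inter> std_tet_interior. f y = F y"
      using loc x std_tet_interior_subset by blast
    have "continuous_on (U \<inter> std_tet_interior) f"
      using continuous_on_subset[OF U(3), of "U \<inter> std_tet_interior"] U(4)
      by (subst continuous_on_cong[OF refl, of _ f F]) auto
    then show ?thesis using x U(1,2) continuous_on_eq_continuous_at[OF open_Int[OF U(1) open_std_tet_interior], of f]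
      by auto
  qed
  then show "continuous_on std_tet_interior f"
    by (simp add: continuous_at_imp_continuous_on)
  have "\<exists>U c. open U \<and> x \<in> U \<and> (\<forall>y \<in> U \<inter> std_tet_interior. \<bar>f y\<bar> \<le> c)" if x: "x \<in> std_tet" for x
  proof -
    obtain U F where U: "open U" "x \<in> U" "continuous_on U F" "\<forall>y \<in> U \<inter> std_tet_interior. f y = F y"
      using loc x by blast
    have "open (U \<inter> F -` {F x - 1 <..< F x + 1})"
      using continuous_open_preimage[OF U(3,1)] by simp
    moreover have "\<bar>f y\<bar> \<le> \<bar>F x\<bar> + 1" if "y \<in> (U \<inter> F -` {F x - 1 <..< F x + 1}) \<inter> std_tet_interior" for y
      using that U(4) by auto
    ultimately show ?thesis using U(2) by (intro exI[of _ "U \<inter> F -` {F x - 1 <..< F x + 1}"] exI[of _ "\<bar>F x\<bar> + 1"]) auto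
  qed
  then obtain U c where Uc: "\<And>x. x \<in> std_tet \<Longrightarrow> open (U x) \<and> x \<in> U x \<and> (\<forall>y \<in> U x \<inter> std_tet_interior. \<bar>f y\<bar> \<le> c x)"
    by metis
  obtain D where D: "D \<subseteq> std_tet" "finite D" "std_tet \<subseteq> (\<Union>x\<in>D. U x)"
    using compactE_image[OF compact_std_tet, of std_tet U] Uc by blast
  have "\<bar>f y\<bar> \<le> (\<Sum>x\<in>D. \<bar>c x\<bar>)" if y: "y \<in> std_tet_interior" for y
  proof -
    obtain x where x: "x \<in> D" "y \<in> U x" using D y std_tet_interior_subset by blast
    then have "\<bar>f y\<bar> \<le> c x" using Uc[of x] D(1) y by blast
    then have "\<bar>f y\<bar> \<le> \<bar>c x\<bar>" by simp
    also have "\<dots> \<le> (\<Sum>x\<in>D. \<bar>c x\<bar>)" using x D by (intro member_le_sum) auto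
    finally show ?thesis .
  qed
  then show "bounded (f ` std_tet_interior)" by (auto simp: bounded_iff)
qed

lemma tame_continuous: "continuous_on UNIV f \<Longrightarrow> tame f"
  by (rule tame_local) (auto intro!: exI[of _ UNIV])

lemma tame_add: "tame f \<Longrightarrow> tame g \<Longrightarrow> tame (\<lambda>x. f x + g x)"
  unfolding tame_def by (auto intro: continuous_intros bounded_plus_comp)

lemma tame_mult: "tame f \<Longrightarrow> tame g \<Longrightarrow> tame (\<lambda>x. f x * g x)"
proof -
  assume fg: "tame f" "tame g"
  then obtain a b where "\<And>x. x \<in> std_tet_interior \<Longrightarrow> \<bar>f x\<bar> \<le> a" "\<And>x. x \<in> std_tet_interior \<Longrightarrow> \<bar>g x\<bar> \<le> b"
    by (auto simp: tame_def bounded_iff)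
  then have "\<bar>f x * g x\<bar> \<le> a * b" if "x \<in> std_tet_interior" for x
    unfolding abs_mult using that by (intro mult_mono) (auto intro: order_trans[OF abs_ge_zero])
  with fg show ?thesis unfolding tame_def by (auto intro!: continuous_intros simp: bounded_iff)
qed

lemma tame_const: "tame (\<lambda>x. c)"
  by (rule tame_continuous) (rule continuous_on_const)

lemma tame_sum: "(\<And>i. i \<in> I \<Longrightarrow> tame (f i)) \<Longrightarrow> tame (\<lambda>x. \<Sum>i\<in>I. f i x)"
  by (induction I rule: infinite_finite_induct) (auto intro: tame_add tame_const)

lemma tame_prod: "(\<And>i. i \<in> I \<Longrightarrow> tame (f i)) \<Longrightarrow> tame (\<lambda>x. \<Prod>i\<in>I. f i x)"
  by (induction I rule: infinite_finite_induct) (auto intro: tame_mult tame_const)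

lemma tame_set_integrable:
  assumes "tame f"
  shows "set_integrable lborel std_tet_interior f"
proof -
  obtain b where b: "\<And>x. x \<in> std_tet_interior \<Longrightarrow> \<bar>f x\<bar> \<le> b"
    using assms by (auto simp: tame_def bounded_iff)
  show ?thesis
    unfolding set_integrable_def
  proof (rule Bochner_Integration.integrable_bound)
    have "bounded std_tet_interior"
      using compact_imp_bounded[OF compact_std_tet] std_tet_interior_subset bounded_subset by blast
    then have "emeasure lborel std_tet_interior < \<infinity>" by (rule emeasure_bounded_finite)
    then show "integrable lborel (\<lambda>x. b * indicator std_tet_interior x)"
      using open_std_tet_interior by (intro integrable_mult_right integrable_real_indicator) auto
    have "(\<lambda>x. indicator std_tet_interior x *\<^sub>R f x) \<in> borel_measurable borel"
      using assms open_std_tet_interior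
      by (intro borel_measurable_continuous_on_indicator) (auto simp: tame_def)
    then show "(\<lambda>x. indicator std_tet_interior x *\<^sub>R f x) \<in> borel_measurable lborel"
      by simp
    show "AE x in lborel. norm (indicator std_tet_interior x *\<^sub>R f x) \<le> norm (b * indicator std_tet_interior x)"
      using b by (intro AE_I2) (force simp: indicator_def)
  qed
qed

section \<open>The affine parametrization of a tetrahedron and its linear part
  \<open>tet_lin\<close>, the derivative at every point\<close>

definition tet_lin :: "'v::{finite,linorder} set \<Rightarrow> real^3 \<Rightarrow> (real, 'v) vec" where
  "tet_lin T w = (let vs = sorted_list_of_set T in
     (- w$1 - w$2 - w$3) *\<^sub>R axis (vs!0) 1 + w$1 *\<^sub>R axis (vs!1) 1
       + w$2 *\<^sub>R axis (vs!2) 1 + w$3 *\<^sub>R axis (vs!3) 1)"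

lemma linear_tet_lin: "linear (tet_lin T)"
  by (rule linearI) (simp_all add: tet_lin_def Let_def algebra_simps)

lemma tet_param_affine: "tet_param T x = axis (sorted_list_of_set T ! 0) 1 + tet_lin T x"
  by (simp add: tet_param_def tet_lin_def Let_def algebra_simps)

lemma has_derivative_tet_param: "(tet_param T has_derivative tet_lin T) (at x within S)"
proof -
  have "(tet_lin T has_derivative tet_lin T) (at x within S)"
    using linear_tet_lin linear_conv_bounded_linear bounded_linear_imp_has_derivative by blast
  from has_derivative_add[OF has_derivative_const this] show ?thesis
    by (simp add: tet_param_affine[abs_def])
qed

lemma continuous_on_tet_param: "continuous_on S (tet_param T)"
  by (rule has_derivative_continuous_on) (rule has_derivative_tet_param)

lemma has_derivative_bary: "(bary T v has_derivative (\<lambda>w. tet_lin T w $ v)) (at x)"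
  unfolding bary_def[abs_def]
  by (rule bounded_linear.has_derivative[OF bounded_linear_vec_nth has_derivative_tet_param])

lemma frechet_derivative_bary: "frechet_derivative (bary T v) (at x) = (\<lambda>w. tet_lin T w $ v)"
  using frechet_derivative_at[OF has_derivative_bary] by metis

locale tetrahedron =
  fixes T :: "'v::{finite,linorder} set"
  assumes card_T: "card T = 4"
begin

definition vtx :: "nat \<Rightarrow> 'v" where "vtx i = sorted_list_of_set T ! i"

lemma length_T: "length (sorted_list_of_set T) = 4"
  using card_T by simp

lemma vtx_inj: "i < 4 \<Longrightarrow> j < 4 \<Longrightarrow> vtx i = vtx j \<longleftrightarrow> i = j"
  unfolding vtx_def using length_T by (intro nth_eq_iff_index_eq) auto

lemma vtx_in_T: "i < 4 \<Longrightarrow> vtx i \<in> T"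
  unfolding vtx_def using nth_mem[of i "sorted_list_of_set T"] length_T by simp

lemma notin_T: "v \<notin> T \<Longrightarrow> v \<noteq> vtx 0 \<and> v \<noteq> vtx 1 \<and> v \<noteq> vtx 2 \<and> v \<noteq> vtx 3"
  using vtx_in_T by auto

lemma T_eq: "T = {vtx 0, vtx 1, vtx 2, vtx 3}"
proof -
  have "T = set (sorted_list_of_set T)" by simp
  also have "\<dots> = vtx ` {..<4}" unfolding vtx_def set_conv_nth length_T by auto
  also have "{..<4::nat} = {0,1,2,3}" by auto
  finally show ?thesis by simp
qed

lemma tet_lin_vtx:
  "tet_lin T w = (- w$1 - w$2 - w$3) *\<^sub>R axis (vtx 0) 1 + w$1 *\<^sub>R axis (vtx 1) 1
    + w$2 *\<^sub>R axis (vtx 2) 1 + w$3 *\<^sub>R axis (vtx 3) 1"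
  by (simp add: tet_lin_def Let_def vtx_def)

lemma tet_lin_nth:
  "tet_lin T w $ vtx 0 = - w$1 - w$2 - w$3" "tet_lin T w $ vtx 1 = w$1"
  "tet_lin T w $ vtx 2 = w$2" "tet_lin T w $ vtx 3 = w$3"
  by (simp_all add: tet_lin_vtx axis_def vtx_inj)

lemma tet_lin_notin: "v \<notin> T \<Longrightarrow> tet_lin T w $ v = 0"
  using notin_T[of v] by (simp add: tet_lin_vtx axis_def)

lemma sum_axis: "(\<Sum>v\<in>UNIV. axis a (1::real) $ v) = 1"
  by (simp add: axis_def sum.delta)

lemma sum_tet_lin: "(\<Sum>v\<in>UNIV. tet_lin T w $ v) = 0"
  by (simp add: tet_lin_vtx sum.distrib sum_axis flip: sum_distrib_left)

lemma tet_lin_nonzero: "w \<noteq> 0 \<Longrightarrow> tet_lin T w \<noteq> 0"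
proof
  assume "w \<noteq> 0" "tet_lin T w = 0"
  then have "w$1 = 0" "w$2 = 0" "w$3 = 0" using tet_lin_nth[of w] by simp_all
  then have "w = 0" by (simp add: vec_eq_iff forall_3)
  with \<open>w \<noteq> 0\<close> show False by simp
qed

lemma tet_param_in_simplex: "x \<in> std_tet \<Longrightarrow> tet_param T x \<in> closed_simplex T"
proof -
  assume x: "x \<in> std_tet"
  have tp: "tet_param T x = (1 - x$1 - x$2 - x$3) *\<^sub>R axis (vtx 0) 1 + x$1 *\<^sub>R axis (vtx 1) 1
    + x$2 *\<^sub>R axis (vtx 2) 1 + x$3 *\<^sub>R axis (vtx 3) 1"
    by (simp add: tet_param_def Let_def vtx_def)
  have "0 \<le> tet_param T x $ v" for v
    using x unfolding tp by (auto simp: std_tet_def axis_def sum_3)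
  moreover have "(\<Sum>v\<in>UNIV. tet_param T x $ v) = 1"
    by (simp add: tet_param_affine sum.distrib sum_axis sum_tet_lin)
  moreover have "tet_param T x $ v = 0" if "v \<notin> T" for v
    using that notin_T[of v] by (simp add: tet_param_affine tet_lin_notin axis_def vtx_def[symmetric])
  ultimately show ?thesis by (simp add: closed_simplex_def)
qed

end

section \<open>The pulled back metric, in charts and up to the boundary\<close>

lemma smooth_onD:
  assumes "smooth_on N F"
  shows "open N" "x \<in> N \<Longrightarrow> (F has_derivative frechet_derivative F (at x)) (at x)"
    "continuous_on N F" "continuous_on N (\<lambda>x. frechet_derivative F (at x) w)"
proof -
  have "k_smooth_on (Suc 0) N F" "k_smooth_on 0 N F" using assms unfolding smooth_on_def by blast+
  then show "x \<in> N \<Longrightarrow> (F has_derivative frechet_derivative F (at x)) (at x)"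
    "continuous_on N F" "continuous_on N (\<lambda>x. frechet_derivative F (at x) w)"
    by (auto simp: frechet_derivative_works)
  show "open N" using assms by (simp add: smooth_on_def)
qed

locale triangulated_manifold =
  fixes M :: "'m::t2_space set" and A :: "'m chart set" and g :: "'m chart \<Rightarrow> 'm \<Rightarrow> real^3^3"
    and K :: "'v::{finite,linorder} set set" and h :: "(real, 'v) vec \<Rightarrow> 'm"
  assumes manifold: "closed_oriented_3manifold M A" and metric: "riemannian_metric A g"
    and triangulation: "smooth_triangulation M A K h"
begin

lemma h_in_M: "s \<in> K \<Longrightarrow> x \<in> closed_simplex s \<Longrightarrow> h x \<in> M"
  using triangulation by (auto simp: smooth_triangulation_def realization_def homeomorphism_def)

lemma chart_cover: "p \<in> M \<Longrightarrow> \<exists>c\<in>A. p \<in> fst c"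
  using manifold by (auto simp: closed_oriented_3manifold_def)

lemma chart_inj: "c \<in> A \<Longrightarrow> inj_on (snd c) (fst c)"
proof -
  assume "c \<in> A"
  then obtain \<psi> where "homeomorphism (fst c) (snd c ` fst c) (snd c) \<psi>"
    using manifold unfolding closed_oriented_3manifold_def by blast
  then show ?thesis by (intro inj_on_inverseI[of _ \<psi>]) (simp add: homeomorphism_def)
qed

text \<open>\<open>\<Phi>\<close> is a smooth extension, across the boundary, of the chart
  expression of the parametrized triangulation; the two are known to agree only on the closed
  tetrahedron. Injectivity of the derivative is provided at the base point \<open>x\<close>.\<close>

lemma tet_chart:
  assumes T: "T \<in> K" "card T = 4" and x: "x \<in> std_tet" and c: "c \<in> A" "h (tet_param T x) \<in> fst c"
  obtains U \<Phi> D where "open U" "x \<in> U" "\<And>y. y \<in> U \<Longrightarrow> (\<Phi> has_derivative D y) (at y)"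
    "\<And>w. continuous_on U (\<lambda>y. D y w)"
    "\<And>y. y \<in> U \<Longrightarrow> y \<in> std_tet \<Longrightarrow> h (tet_param T y) \<in> fst c \<and> \<Phi> y = snd c (h (tet_param T y))"
    "\<And>w. w \<noteq> 0 \<Longrightarrow> D x w \<noteq> 0"
proof -
  interpret tetrahedron T by standard (rule T)
  obtain N F where N: "tet_param T x \<in> N" "smooth_on N F"
      "\<forall>y \<in> N \<inter> closed_simplex T. h y \<in> fst c \<and> F y = snd c (h y)"
      "\<forall>w. (\<forall>v. v \<notin> T \<longrightarrow> w $ v = 0) \<and> (\<Sum>v\<in>UNIV. w $ v) = 0 \<and> w \<noteq> 0 \<longrightarrow>
              frechet_derivative F (at (tet_param T x)) w \<noteq> 0"
    using triangulation T(1) c tet_param_in_simplex[OF x] unfolding smooth_triangulation_def by blast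
  note F = smooth_onD[OF N(2)]
  define U where "U = tet_param T -` N"
  have U: "open U" unfolding U_def
    using continuous_open_preimage[OF continuous_on_tet_param[of UNIV] open_UNIV F(1)] by simp
  show thesis
  proof (rule that[of U "F \<circ> tet_param T" "\<lambda>y w. frechet_derivative F (at (tet_param T y)) (tet_lin T w)"])
    show "(F \<circ> tet_param T has_derivative (\<lambda>w. frechet_derivative F (at (tet_param T y)) (tet_lin T w))) (at y)"
      if "y \<in> U" for y
      using diff_chain_at[OF has_derivative_tet_param F(2)] that by (simp add: U_def o_def)
    show "continuous_on U (\<lambda>y. frechet_derivative F (at (tet_param T y)) (tet_lin T w))" for w
      using continuous_on_compose2[OF F(4) continuous_on_tet_param] by (simp add: U_def)
    show "frechet_derivative F (at (tet_param T x)) (tet_lin T w) \<noteq> 0" if "w \<noteq> 0" for w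
      using N(4) that tet_lin_nonzero tet_lin_notin sum_tet_lin by blast
  qed (use U N tet_param_in_simplex in \<open>auto simp: U_def\<close>)
qed

text \<open>\<open>tet_metric\<close> picks a chart at each point by \<open>SOME\<close>, so its
  expression may jump from point to point. The transformation law of the metric and the chain rule
  for the transition map show that any chart gives the same Gram matrix. The point is interior so
  that the derivative in \<open>tet_metric\<close> is determined by values on the
  tetrahedron.\<close>

lemma tet_metric_chart:
  assumes T: "T \<in> K" "card T = 4" and c: "c \<in> A"
    and U: "open U" "y \<in> U" "(\<Phi> has_derivative D) (at y)"
      "\<And>z. z \<in> U \<Longrightarrow> z \<in> std_tet \<Longrightarrow> h (tet_param T z) \<in> fst c \<and> \<Phi> z = snd c (h (tet_param T z))"
    and y: "y \<in> std_tet_interior"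
  shows "tet_metric A g h T y = transpose (matrix D) ** g c (h (tet_param T y)) ** matrix D"
proof -
  define p where "p = h (tet_param T y)"
  have yt: "y \<in> std_tet" using y std_tet_interior_subset by blast
  have pc: "p \<in> fst c" "\<Phi> y = snd c p" using U yt by (auto simp: p_def)
  define d where "d = (SOME c. c \<in> A \<and> p \<in> fst c)"
  have d: "d \<in> A" "p \<in> fst d" using someI[of "\<lambda>c. c \<in> A \<and> p \<in> fst c" c] c pc by (auto simp: d_def)
  obtain U' \<Phi>' D' where U': "open U'" "y \<in> U'" "\<And>z. z \<in> U' \<Longrightarrow> (\<Phi>' has_derivative D' z) (at z)"
    "\<And>z. z \<in> U' \<Longrightarrow> z \<in> std_tet \<Longrightarrow> h (tet_param T z) \<in> fst d \<and> \<Phi>' z = snd d (h (tet_param T z))"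
    using tet_chart[OF T yt d(1), folded p_def] d(2) by metis
  define V where "V = U \<inter> U' \<inter> std_tet_interior"
  have V: "open V" "y \<in> V" using U U' y open_std_tet_interior by (auto simp: V_def)
  have D': "(\<Phi>' has_derivative D' y) (at y)" using U' by blast
  \<comment> \<open>On the open set \<open>V\<close> inside the tetrahedron the extension and the
    actual map agree, hence so do their derivatives at \<open>y\<close>.\<close>
  have "((snd d \<circ> h \<circ> tet_param T) has_derivative D' y) (at y)"
    by (rule has_derivative_transform_within_open[OF D' V])
      (use U'(4) std_tet_interior_subset in \<open>auto simp: V_def\<close>)
  then have J: "jacobian (snd d \<circ> h \<circ> tet_param T) y = matrix (D' y)"
    unfolding jacobian_def by (metis frechet_derivative_at)
  define t where "t = frechet_derivative (transition c d) (at (\<Phi> y))"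
  have cd: "smooth_on (snd c ` (fst c \<inter> fst d)) (transition c d)"
    using manifold c d(1) unfolding closed_oriented_3manifold_def by blast
  have "(transition c d has_derivative t) (at (\<Phi> y))"
    unfolding t_def using smooth_onD(2)[OF cd] pc d(2) by blast
  then have "(transition c d \<circ> \<Phi> has_derivative t \<circ> D) (at y)"
    by (rule diff_chain_at[OF U(3)])
  then have "(\<Phi>' has_derivative t \<circ> D) (at y)"
  proof (rule has_derivative_transform_within_open[OF _ V])
    fix z assume z: "z \<in> V"
    then have z': "z \<in> std_tet" "z \<in> U" "z \<in> U'" using std_tet_interior_subset by (auto simp: V_def)
    then show "(transition c d \<circ> \<Phi>) z = \<Phi>' z"
      using U(4)[of z] U'(4)[of z] chart_inj[OF c] by (simp add: transition_def)
  qed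
  then have eq: "D' y = t \<circ> D" using D' has_derivative_unique by blast
  have lin: "linear D" "linear t"
    using U(3) \<open>(transition c d has_derivative t) (at (\<Phi> y))\<close> has_derivative_linear by blast+
  have J2: "matrix (D' y) = matrix t ** matrix D" unfolding eq by (rule matrix_compose[OF lin])
  have gg: "g c p = transpose (matrix t) ** g d p ** matrix t"
    using metric c d pc unfolding riemannian_metric_def t_def jacobian_def by (metis IntI)
  have "tet_metric A g h T y = transpose (matrix (D' y)) ** g d p ** matrix (D' y)"
    unfolding tet_metric_def Let_def p_def[symmetric] d_def[symmetric] J ..
  also have "\<dots> = transpose (matrix D) ** g c p ** matrix D"
    unfolding J2 gg by (simp add: matrix_transpose_mul matrix_mul_assoc)
  finally show ?thesis by (simp add: p_def)
qed

text \<open>\<open>G\<close> is the Gram matrix computed with the smooth extension in one fixed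
  chart, so it is continuous across the boundary. This is the local form required by
  \<open>tame_local\<close>, and definiteness at \<open>x\<close> keeps inverse and determinant
  under control.\<close>

lemma tet_metric_local:
  assumes T: "T \<in> K" "card T = 4" and x: "x \<in> std_tet"
  obtains U G where "open U" "x \<in> U" "continuous_on U G" "pos_def (G x)"
    "\<And>y. y \<in> U \<Longrightarrow> y \<in> std_tet_interior \<Longrightarrow> tet_metric A g h T y = G y"
proof -
  interpret tetrahedron T by standard (rule T)
  obtain c where c: "c \<in> A" "h (tet_param T x) \<in> fst c"
    using chart_cover h_in_M T(1) tet_param_in_simplex[OF x] by blast
  obtain U \<Phi> D where U: "open U" "x \<in> U" "\<And>y. y \<in> U \<Longrightarrow> (\<Phi> has_derivative D y) (at y)"
    "\<And>w. continuous_on U (\<lambda>y. D y w)"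
    "\<And>y. y \<in> U \<Longrightarrow> y \<in> std_tet \<Longrightarrow> h (tet_param T y) \<in> fst c \<and> \<Phi> y = snd c (h (tet_param T y))"
    "\<And>w. w \<noteq> 0 \<Longrightarrow> D x w \<noteq> 0"
    using tet_chart[OF T x c] by metis
  let ?O = "snd c ` fst c"
  define V where "V = U \<inter> \<Phi> -` ?O"
  define \<gamma> where "\<gamma> x = g c (inv_into (fst c) (snd c) x)" for x
  define G where "G y = transpose (matrix (D y)) ** \<gamma> (\<Phi> y) ** matrix (D y)" for y
  have "open ?O" using manifold c by (auto simp: closed_oriented_3manifold_def)
  have c\<Phi>: "continuous_on U \<Phi>"
    by (rule has_derivative_continuous_on) (rule has_derivative_at_withinI[OF U(3)])
  have \<gamma>: "smooth_on ?O \<gamma>" using metric c by (simp add: riemannian_metric_def \<gamma>_def[abs_def])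
  have VU: "V \<subseteq> U" by (auto simp: V_def)
  have cD: "continuous_on V (\<lambda>y. matrix (D y))"
    unfolding matrix_def using U(4) VU by (intro continuous_intros) (rule continuous_on_subset)
  show thesis
  proof (rule that[of V G])
    show "open V" unfolding V_def by (rule continuous_open_preimage[OF c\<Phi> U(1) \<open>open ?O\<close>])
    show "x \<in> V" using U c x by (auto simp: V_def)
    show "continuous_on V G" unfolding G_def
    proof (intro continuous_on_matrix_mult continuous_on_transpose cD)
      show "continuous_on V (\<lambda>y. \<gamma> (\<Phi> y))"
        by (rule continuous_on_compose2[OF smooth_onD(3)[OF \<gamma>] continuous_on_subset[OF c\<Phi> VU]])
          (auto simp: V_def)
    qed
    have \<gamma>h: "\<gamma> (\<Phi> y) = g c (h (tet_param T y))" if "y \<in> U" "y \<in> std_tet" for y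
      using U(5)[OF that] chart_inj[OF c(1)] by (simp add: \<gamma>_def)
    show "pos_def (G x)"
      unfolding G_def
    proof (rule pos_def_congruence)
      show "pos_def (\<gamma> (\<Phi> x))"
        unfolding \<gamma>h[OF U(2) x] pos_def_def using metric c unfolding riemannian_metric_def by blast
      have "linear (D x)" using U(2,3) has_derivative_linear by blast
      then show "matrix (D x) *v w \<noteq> 0" if "w \<noteq> 0" for w using U(6)[OF that] by simp
    qed
    show "tet_metric A g h T y = G y" if y: "y \<in> V" "y \<in> std_tet_interior" for y
    proof -
      have yU: "y \<in> U" "y \<in> std_tet" using y std_tet_interior_subset by (auto simp: V_def)
      show ?thesis
        using tet_metric_chart[OF T c(1) U(1) yU(1) U(3)[OF yU(1)] U(5) y(2)]
        by (simp add: G_def \<gamma>h[OF yU])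
    qed
  qed
qed

lemma pos_def_tet_metric:
  assumes T: "T \<in> K" "card T = 4" and x: "x \<in> std_tet_interior"
  shows "pos_def (tet_metric A g h T x)"
proof -
  have "x \<in> std_tet" using x std_tet_interior_subset by blast
  then obtain U G where "x \<in> U" "pos_def (G x)"
    "\<And>y. y \<in> U \<Longrightarrow> y \<in> std_tet_interior \<Longrightarrow> tet_metric A g h T y = G y"
    using tet_metric_local[OF T] by metis
  with x show ?thesis by simp
qed

lemma tame_tet_metric:
  assumes T: "T \<in> K" "card T = 4" and f: "continuous_on {G. 0 < det G} f"
  shows "tame (\<lambda>x. f (tet_metric A g h T x))"
proof (rule tame_local)
  fix x assume "x \<in> std_tet"
  then obtain U G where U: "open U" "x \<in> U" "continuous_on U G" "pos_def (G x)"
    "\<And>y. y \<in> U \<Longrightarrow> y \<in> std_tet_interior \<Longrightarrow> tet_metric A g h T y = G y"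
    using tet_metric_local[OF T] by metis
  \<comment> \<open>The neighbourhood is shrunk to where the determinant stays positive, since only
    there \<open>f\<close> is known to be continuous.\<close>
  let ?V = "U \<inter> (\<lambda>y. det (G y)) -` {0<..}"
  have "open ?V"
    by (rule continuous_open_preimage[OF continuous_on_det[OF U(3)] U(1)]) simp
  moreover have "x \<in> ?V" using U pos_def_det_pos by auto
  moreover have "continuous_on ?V (\<lambda>y. f (G y))"
    by (rule continuous_on_compose2[OF f continuous_on_subset[OF U(3)]]) auto
  ultimately show "\<exists>V F. open V \<and> x \<in> V \<and> continuous_on V F \<and> (\<forall>y\<in>V \<inter> std_tet_interior. f (tet_metric A g h T y) = F y)"
    using U(5) by (intro exI[of _ ?V] exI[of _ "\<lambda>y. f (G y)"]) auto
qed

text \<open>A maximal simplex of dimension at most two would be mapped by \<^term>\<open>h\<close> onto a nonempty open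
  piece of the manifold, but in a chart its smooth image is a null set.\<close>

lemma small_simplex_not_maximal:
  assumes s: "s \<in> K" "card s \<le> 3"
  obtains t where "t \<in> K" "s \<subset> t"
proof (rule ccontr)
  assume "\<not> thesis"
  with that have max: "\<And>t. t \<in> K \<Longrightarrow> s \<subseteq> t \<Longrightarrow> t = s" by blast
  have sc: "simplicial_cplx K" using triangulation by (simp add: smooth_triangulation_def)
  have ne: "s \<noteq> {}" using s sc by (auto simp: simplicial_cplx_def)
  then have cs: "0 < card s" by (simp add: card_gt_0_iff)
  obtain h' where h': "homeomorphism (realization K) M h h'"
    using triangulation by (auto simp: smooth_triangulation_def)
  define x\<^sub>0 :: "(real, 'v) vec" where "x\<^sub>0 = (\<chi> v. if v \<in> s then 1 / card s else 0)"
  have x0: "x\<^sub>0 \<in> closed_simplex s" using ne by (simp add: closed_simplex_def x\<^sub>0_def sum.If_cases)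
  obtain c where c: "c \<in> A" "h x\<^sub>0 \<in> fst c" using chart_cover h_in_M[OF s(1) x0] by blast
  obtain N F where N: "x\<^sub>0 \<in> N" "smooth_on N F"
      "\<forall>y \<in> N \<inter> closed_simplex s. h y \<in> fst c \<and> F y = snd c (h y)"
    using triangulation s(1) c x0 unfolding smooth_triangulation_def by blast
  note F = smooth_onD[OF N(2)]
  define P where "P = (\<Inter>v\<in>s. {x :: (real, 'v) vec. 0 < x $ v})"
  have "open P" unfolding P_def by (intro open_INT ballI open_Collect_less continuous_intros) simp
  \<comment> \<open>A point of the realization with positive coordinates on \<open>s\<close> lies in
    a simplex containing \<open>s\<close>, which by maximality is \<open>s\<close> itself. So this
    relatively open neighbourhood of the barycentre stays inside one closed simplex.\<close>
  define W where "W = realization K \<inter> (P \<inter> N)"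
  have Wo: "openin (top_of_set (realization K)) W"
    unfolding W_def using \<open>open P\<close> F(1) by (intro openin_open_Int) auto
  have Ws: "W \<subseteq> closed_simplex s"
  proof
    fix x assume x: "x \<in> W"
    then obtain t where t: "t \<in> K" "x \<in> closed_simplex t" by (auto simp: W_def realization_def)
    have "s \<subseteq> t" using x t(2) by (force simp: W_def P_def closed_simplex_def)
    then show "x \<in> closed_simplex s" using max t by metis
  qed
  have x0W: "x\<^sub>0 \<in> W" using x0 N(1) s(1) cs by (auto simp: W_def realization_def P_def x\<^sub>0_def)
  have W: "h x \<in> fst c" "F x = snd c (h x)" if "x \<in> W" for x
    using that Ws N(3) by (auto simp: W_def)
  have co: "openin (top_of_set M) (fst c)" "open (snd c ` fst c)"
    and "\<exists>\<psi>. homeomorphism (fst c) (snd c ` fst c) (snd c) \<psi>"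
    using manifold c by (auto simp: closed_oriented_3manifold_def)
  then obtain \<psi> where \<psi>: "homeomorphism (fst c) (snd c ` fst c) (snd c) \<psi>" by blast
  have "openin (top_of_set M) (h ` W)" by (rule homeomorphism_imp_open_map[OF h' Wo])
  then have "openin (top_of_set (fst c)) (h ` W)"
    by (rule openin_subset_trans) (use W openin_imp_subset[OF co(1)] in auto)
  then have "openin (top_of_set (snd c ` fst c)) (snd c ` h ` W)" by (rule homeomorphism_imp_open_map[OF \<psi>])
  then have "open (snd c ` h ` W)" using co(2) openin_open_trans by blast
  moreover have "snd c ` h ` W = F ` W" using W(2) by (auto simp: image_image intro!: image_cong)
  ultimately have op: "open (F ` W)" by simp
  \<comment> \<open>Repetitions are allowed, so that dimensions zero, one and two are covered by the
    same parametrization over the plane.\<close>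
  obtain a b d where abd: "s = {a, b, d}"
  proof -
    show thesis
    proof (cases "card s = 1 \<or> card s = 2")
      case True
      then show thesis using that by (metis card_1_singletonE card_2_iff insert_absorb2)
    next
      case False
      then have "card s = 3" using cs s(2) by linarith
      then show thesis using that by (metis card_3_iff)
    qed
  qed
  define q :: "real^2 \<Rightarrow> (real, 'v) vec" where
    "q x = axis a 1 + (x$1 *\<^sub>R (axis b 1 - axis a 1) + x$2 *\<^sub>R (axis d 1 - axis a 1))" for x
  have "linear (\<lambda>x. x$1 *\<^sub>R (axis b 1 - axis a 1) + x$2 *\<^sub>R (axis d 1 - axis a 1) :: (real, 'v) vec)"
    by (rule linearI) (simp_all add: algebra_simps)
  then have dq: "q differentiable at x" for x
    unfolding q_def[abs_def]
    by (intro differentiable_add differentiable_const linear_imp_differentiable) auto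
  have "W \<subseteq> q ` (q -` W)"
  proof
    fix x assume x: "x \<in> W"
    then have xs: "x \<in> closed_simplex s" using Ws by blast
    have "(\<Sum>v\<in>s. x $ v) = 1"
      using xs sum.mono_neutral_left[of UNIV s "($) x"] by (auto simp: closed_simplex_def)
    \<comment> \<open>The conditions count a repeated vertex once; the definition of
      \<open>y\<close> below uses the same convention.\<close>
    then have sum1: "x $ a + (if b \<noteq> a then x $ b else 0) + (if d \<noteq> a \<and> d \<noteq> b then x $ d else 0) = 1"
      unfolding abd by (cases "a = b"; cases "a = d"; cases "b = d") (auto simp: insert_commute)
    have out: "x $ v = 0" if "v \<noteq> a" "v \<noteq> b" "v \<noteq> d" for v
      using xs that by (simp add: closed_simplex_def abd)
    define y :: "real^2" where
      "y = vector [if b \<noteq> a then x $ b else 0, if d \<noteq> a \<and> d \<noteq> b then x $ d else 0]"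
    have "q y = x"
      unfolding vec_eq_iff
    proof
      fix v
      show "q y $ v = x $ v"
        using sum1 out[of v] by (auto simp: q_def y_def vector_2 axis_def split: if_splits)
    qed
    then have "\<exists>y. q y = x" ..
    then show "x \<in> q ` (q -` W)" using x by blast
  qed
  then have eq: "F ` W = (F \<circ> q) ` (q -` W)" by (auto simp: image_comp[symmetric])
  have "(F \<circ> q) differentiable_on (q -` W)"
  proof (rule differentiable_at_imp_differentiable_on)
    fix x assume "x \<in> q -` W"
    then have "q x \<in> N" by (auto simp: W_def)
    then have "F differentiable at (q x)" using F(2) differentiable_def by blast
    with dq show "F \<circ> q differentiable at x" by (rule differentiable_chain_at)
  qed
  \<comment> \<open>A differentiable map from the plane to three-space has a null image.\<close>
  then have "negligible (F ` W)"
    unfolding eq by (rule negligible_differentiable_image_lowdim[rotated]) simp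
  then show False using open_not_negligible[OF op] x0W by blast
qed

text \<open>A larger simplex could have more than four vertices. Adding its vertices one at a time
  stays in \<open>K\<close>, which is closed under faces, and stops exactly at four.\<close>

lemma in_tetrahedron:
  assumes "s \<in> K" "card s \<le> 4"
  obtains T where "T \<in> K" "card T = 4" "s \<subseteq> T"
proof -
  have "\<exists>T\<in>K. card T = 4 \<and> s \<subseteq> T" using assms
  proof (induction "4 - card s" arbitrary: s)
    case 0
    then show ?case by (auto intro!: bexI[of _ s])
  next
    case (Suc n)
    then have "s \<in> K" "card s \<le> 3" by auto
    then obtain t where t: "t \<in> K" "s \<subset> t" by (rule small_simplex_not_maximal)
    then obtain v where v: "v \<in> t" "v \<notin> s" by blast
    have "insert v s \<in> K"
      using triangulation t v by (auto simp: smooth_triangulation_def simplicial_cplx_def)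
    moreover have "card (insert v s) = Suc (card s)" using v by simp
    ultimately obtain T where "T \<in> K" "card T = 4" "insert v s \<subseteq> T"
      using Suc.hyps(1)[of "insert v s"] Suc.hyps(2) \<open>card s \<le> 3\<close> by fastforce
    then show ?case by blast
  qed
  then show thesis using that by blast
qed

end

section \<open>Whitney inner products and adjoints\<close>

lemma whitney_elem_continuous:
  "continuous_on S (\<lambda>x. whitney_elem T vs x ws)"
proof -
  have "continuous_on S (\<lambda>x. bary T v x)" for v
    unfolding bary_def by (intro continuous_intros continuous_on_tet_param)
  then show ?thesis
    unfolding whitney_elem_def frechet_derivative_bary by (intro continuous_intros)
qed

lemma whitney_continuous: "continuous_on S (\<lambda>x. whitney K k u T x ws)"
  unfolding whitney_def by (intro continuous_intros whitney_elem_continuous)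

lemma whitney_add: "whitney K k (u + v) T x ws = whitney K k u T x ws + whitney K k v T x ws"
  by (simp add: whitney_def sum.distrib distrib_right)

lemma whitney_scale: "whitney K k (c *\<^sub>R u) T x ws = c * whitney K k u T x ws"
  by (simp add: whitney_def sum_distrib_left mult.assoc)

lemma wedge_Nil: "wedge [] ws = 1"
  by (simp add: wedge_def sign_id)

lemma wedge_single: "wedge [\<alpha>] [w] = \<alpha> w"
proof -
  have "{p. p permutes {0::nat}} = {id}" by (auto simp: permutes_sing)
  then show ?thesis by (simp add: wedge_def lessThan_Suc sign_id)
qed

lemma whitney_elem_0: "whitney_elem T [v] x [] = bary T v x"
  by (simp add: whitney_elem_def wedge_Nil)

lemma whitney_elem_1:
  "whitney_elem T [a, b] x [w] = bary T a x * tet_lin T w $ b - bary T b x * tet_lin T w $ a"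
  by (simp add: whitney_elem_def wedge_single frechet_derivative_bary numeral_2_eq_2 lessThan_Suc)

lemma card_2_sorted_list:
  fixes s :: "'v::{finite,linorder} set"
  assumes "card s = 2"
  obtains a b where "a < b" "s = {a, b}" "sorted_list_of_set s = [a, b]"
proof -
  obtain x y where xy: "s = {x, y}" "x \<noteq> y" using assms by (meson card_2_iff)
  define a b where "a = min x y" and "b = max x y"
  have ab: "a < b" "s = {a, b}" using xy by (auto simp: a_def b_def min_def max_def)
  moreover have "sorted_list_of_set s = [a, b]"
    using ab by (intro sorted_list_of_set_unique[THEN iffD1]) auto
  ultimately show thesis using that by blast
qed

lemma form_inner_0: "form_inner 0 G \<omega> \<eta> = \<omega> [] * \<eta> []"
  by (simp add: form_inner_def)

lemma form_inner_1:
  "form_inner 1 G \<omega> \<omega>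
    = (\<chi> i. \<omega> [axis i 1]) \<bullet> (matrix_inv G *v (\<chi> i. \<omega> [axis i 1]))"
proof -
  have *: "(\<Sum>I | length I = Suc 0. f I) = (\<Sum>i\<in>UNIV. f [i])" for f :: "3 list \<Rightarrow> real"
    by (rule sum.reindex_bij_witness[of _ "\<lambda>i. [i]" hd]) (auto simp: length_Suc_conv)
  show ?thesis
    by (simp add: form_inner_def * inner_vec_def matrix_vector_mult_def sum_distrib_left mult_ac)
qed

lemma form_inner_commute:
  assumes "pos_def G"
  shows "form_inner k G \<omega> \<eta> = form_inner k G \<eta> \<omega>"
proof -
  have "transpose (matrix_inv G) = matrix_inv G"
    using pos_def_matrix_inv[OF assms] by (simp add: pos_def_def)
  then have sym: "matrix_inv G $ i $ j = matrix_inv G $ j $ i" for i j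
    by (simp add: transpose_def vec_eq_iff)
  have "(\<Prod>a<k. matrix_inv G $ (I ! a) $ (J ! a)) = (\<Prod>a<k. matrix_inv G $ (J ! a) $ (I ! a))" for I J
    by (intro prod.cong refl sym)
  then show ?thesis
    unfolding form_inner_def by (subst sum.swap) (simp add: mult_ac)
qed

lemma form_inner_add: "form_inner k G (\<lambda>ws. \<omega> ws + \<omega>' ws) \<eta> = form_inner k G \<omega> \<eta> + form_inner k G \<omega>' \<eta>"
  by (simp add: form_inner_def sum.distrib algebra_simps)

lemma form_inner_scale: "form_inner k G (\<lambda>ws. c * \<omega> ws) \<eta> = c * form_inner k G \<omega> \<eta>"
  by (simp add: form_inner_def sum_distrib_left mult_ac)

text \<open>Each point is approached along the segment to the interior point \<open>c\<close>, the
  barycentre of the tetrahedron. It lets vanishing in the interior be transported to the vertices,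
  where cochains are read off.\<close>

lemma std_tet_subset_closure: "std_tet \<subseteq> closure std_tet_interior"
proof
  fix x assume x: "x \<in> std_tet"
  define c :: "real^3" where "c = (\<chi> i. 1 / 4)"
  define y where "y n = x + (1 / real (Suc n)) *\<^sub>R (c - x)" for n
  have "y n \<in> std_tet_interior" for n
  proof -
    let ?t = "1 / real (Suc n)"
    have t: "0 < ?t" "?t \<le> 1" by (auto simp: field_simps)
    have yn: "y n $ i = (1 - ?t) * x $ i + ?t * (1 / 4)" for i
      by (simp add: y_def c_def algebra_simps)
    have "0 < y n $ i" for i
      unfolding yn using t x by (intro add_nonneg_pos mult_nonneg_nonneg) (auto simp: std_tet_def)
    moreover have "(\<Sum>i\<in>UNIV. y n $ i) < 1"
    proof -
      have "(\<Sum>i\<in>UNIV. y n $ i) = (1 - ?t) * (\<Sum>i\<in>UNIV. x $ i) + ?t * (3 / 4)"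
        unfolding yn by (simp add: sum_3 algebra_simps)
      also have "\<dots> \<le> (1 - ?t) * 1 + ?t * (3 / 4)"
        using t x by (intro add_right_mono mult_left_mono) (auto simp: std_tet_def)
      also have "\<dots> < 1"
      proof -
        have "(1 - r) * 1 + r * (3 / 4) < 1" if "0 < r" for r :: real using that by simp
        then show ?thesis using t(1) .
      qed
      finally show ?thesis .
    qed
    ultimately show ?thesis by (simp add: std_tet_interior_def)
  qed
  moreover have "y \<longlonglongrightarrow> x"
  proof -
    have "(\<lambda>n. x + (1 / real (Suc n)) *\<^sub>R (c - x)) \<longlonglongrightarrow> x + 0 *\<^sub>R (c - x)"
      by (intro tendsto_intros LIMSEQ_Suc[OF lim_1_over_n])
    then show ?thesis by (simp add: y_def[abs_def])
  qed
  ultimately show "x \<in> closure std_tet_interior" unfolding closure_sequential by blast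
qed

lemma zero_on_std_tet:
  fixes f :: "real^3 \<Rightarrow> real"
  assumes "continuous_on UNIV f" "\<And>x. x \<in> std_tet_interior \<Longrightarrow> f x = 0" "x \<in> std_tet"
  shows "f x = 0"
proof (rule continuous_constant_on_closure[where S = std_tet_interior])
  show "continuous_on (closure std_tet_interior) f" by (rule continuous_on_subset[OF assms(1)]) simp
  show "x \<in> closure std_tet_interior" using assms(3) std_tet_subset_closure by blast
qed (rule assms(2))

text \<open>The subset of the interior where \<open>f\<close> is positive is open and null, hence
  empty.\<close>

lemma tame_integral_eq_0:
  assumes f: "tame f" and nn: "\<And>x. x \<in> std_tet_interior \<Longrightarrow> 0 \<le> f x"
    and z: "(LINT x:std_tet_interior|lborel. f x) = 0" and x: "x \<in> std_tet_interior"
  shows "f x = 0"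
proof -
  let ?V = "std_tet_interior \<inter> f -` {0<..}"
  have "(LINT x|lborel. indicator std_tet_interior x *\<^sub>R f x) = 0"
    using z by (simp add: set_lebesgue_integral_def)
  then have "AE x in lborel. indicator std_tet_interior x *\<^sub>R f x = 0"
    using tame_set_integrable[OF f] nn unfolding set_integrable_def
    by (subst (asm) integral_nonneg_eq_0_iff_AE) (auto simp: indicator_def)
  then have ae: "AE x in lborel. x \<notin> ?V" by eventually_elim (auto simp: indicator_def)
  have op: "open ?V"
    using f open_std_tet_interior by (intro continuous_open_preimage) (auto simp: tame_def)
  then have "?V \<in> null_sets lborel" using ae by (subst AE_iff_null_sets) auto
  then have "negligible ?V" by (simp add: negligible_iff_null_sets null_sets_completionI)
  then have "?V = {}" using open_not_negligible[OF op] by blast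
  then show ?thesis using x nn[OF x] by fastforce
qed

section \<open>Values of Whitney forms at the vertices\<close>

context tetrahedron
begin

text \<open>The preimages of the vertices under \<open>tet_param T\<close>; the origin belongs to
  \<open>vtx 0\<close>.\<close>

definition pt :: "nat \<Rightarrow> real^3" where
  "pt i = (if i = 1 then axis 1 1 else if i = 2 then axis 2 1 else if i = 3 then axis 3 1 else 0)"

lemma pt_in_std_tet: "pt i \<in> std_tet"
  by (auto simp: pt_def std_tet_def sum_3 axis_def)

lemma tet_param_pt: "i < 4 \<Longrightarrow> tet_param T (pt i) = axis (vtx i) 1"
proof -
  assume "i < 4"
  then have "i = 0 \<or> i = 1 \<or> i = 2 \<or> i = 3" by auto
  then show ?thesis
    by (elim disjE) (simp_all add: tet_param_def Let_def vtx_def pt_def axis_def)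
qed

lemma bary_pt: "i < 4 \<Longrightarrow> bary T v (pt i) = of_bool (v = vtx i)"
  by (simp add: bary_def tet_param_pt axis_def)

lemma tet_lin_pt:
  assumes "i < 4" "j < 4"
  shows "tet_lin T (pt j - pt i) $ v = of_bool (v = vtx j) - of_bool (v = vtx i)"
proof -
  have "tet_lin T (pt j - pt i) = tet_param T (pt j) - tet_param T (pt i)"
    by (simp add: tet_param_affine linear_diff[OF linear_tet_lin])
  then show ?thesis using assms by (simp add: tet_param_pt axis_def)
qed

lemma vtx_cases: "v \<in> T \<Longrightarrow> \<exists>i<4. v = vtx i"
proof -
  assume "v \<in> T"
  then have "v \<in> {vtx 0, vtx 1, vtx 2, vtx 3}" using T_eq by blast
  then show ?thesis by (auto intro: exI[of _ 0] exI[of _ 1] exI[of _ 2] exI[of _ 3])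
qed

lemma whitney_0_pt:
  assumes "i < 4" "{vtx i} \<in> K"
  shows "whitney K 0 u T (pt i) [] = u $ {vtx i}"
proof -
  have "whitney K 0 u T (pt i) [] = (\<Sum>s | s \<in> K \<and> card s = 1. if s = {vtx i} then u $ s else 0)"
    unfolding whitney_def
  proof (rule sum.cong)
    fix s assume "s \<in> {s \<in> K. card s = 1}"
    then obtain v where "s = {v}" by (auto simp: card_1_singleton_iff)
    then show "u $ s * whitney_elem T (sorted_list_of_set s) (pt i) [] = (if s = {vtx i} then u $ s else 0)"
      using assms by (simp add: whitney_elem_0 bary_pt)
  qed simp
  then show ?thesis using assms by simp
qed

text \<open>A Whitney form is constant along an edge in the direction of that edge, so its value at
  one end replaces the edge integral. Edges not containing \<open>vtx i\<close> contribute nothing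
  there because their coordinates vanish, and any other edge through \<open>vtx i\<close> misses
  \<open>vtx j\<close>.\<close>

lemma whitney_1_pt:
  assumes ij: "i < 4" "j < 4" "vtx i < vtx j" "{vtx i, vtx j} \<in> K"
  shows "whitney K 1 u T (pt i) [pt j - pt i] = u $ {vtx i, vtx j}"
proof -
  have "whitney K 1 u T (pt i) [pt j - pt i]
      = (\<Sum>s | s \<in> K \<and> card s = 2. if s = {vtx i, vtx j} then u $ s else 0)"
    unfolding whitney_def
  proof (rule sum.cong)
    fix s assume "s \<in> {s \<in> K. card s = 2}"
    then obtain a b where ab: "a < b" "s = {a, b}" "sorted_list_of_set s = [a, b]"
      using card_2_sorted_list by blast
    have "s = {vtx i, vtx j} \<longleftrightarrow> a = vtx i \<and> b = vtx j"
      using ab ij(3) by (auto simp: doubleton_eq_iff)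
    then show "u $ s * whitney_elem T (sorted_list_of_set s) (pt i) [pt j - pt i]
        = (if s = {vtx i, vtx j} then u $ s else 0)"
      unfolding ab(3) whitney_elem_1 bary_pt[OF ij(1)] tet_lin_pt[OF ij(1,2)]
      using ab(1) ij(3) by auto
  qed (simp add: numeral_2_eq_2)
  then show ?thesis using ij by simp
qed

lemma whitney_1_linear: "linear (\<lambda>w. whitney K 1 u T x [w])"
proof -
  have "linear (\<lambda>w. u $ s * whitney_elem T (sorted_list_of_set s) x [w])" if s: "card s = 2" for s
  proof -
    obtain a b where "sorted_list_of_set s = [a, b]" using card_2_sorted_list[OF s] by blast
    then show ?thesis
      by (intro linearI)
        (simp_all add: whitney_elem_1 linear_add[OF linear_tet_lin] linear_scale[OF linear_tet_lin] algebra_simps)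
  qed
  then show ?thesis unfolding whitney_def by (intro linear_compose_sum) auto
qed

end

text \<open>\<open>ip\<close> is definite on \<open>W\<close> only. In a Euclidean orthonormal basis
  \<open>D\<close> of \<open>W\<close>, the map \<open>L\<close> records the functional given by
  \<open>w\<close>; it is injective on \<open>W\<close> by definiteness and therefore onto by
  dimension.\<close>

lemma riesz_subspace:
  fixes ip :: "'e::euclidean_space \<Rightarrow> 'e \<Rightarrow> real"
  assumes bil: "bilinear ip" and W: "subspace W"
    and nondeg: "\<And>w. w \<in> W \<Longrightarrow> ip w w = 0 \<Longrightarrow> w = 0" and \<phi>: "linear \<phi>"
  shows "\<exists>!w. w \<in> W \<and> (\<forall>u\<in>W. \<phi> u = ip u w)"
proof (rule ex_ex1I)
  have lin: "linear (\<lambda>x. ip x y)" "linear (ip x)" for x y using bil by (auto simp: bilinear_def)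
  obtain D where D: "D \<subseteq> W" "pairwise orthogonal D" "\<And>b. b \<in> D \<Longrightarrow> norm b = 1" "independent D" "span D = W"
    using orthonormal_basis_subspace[OF W] by metis
  have fD: "finite D" using D(4) by (rule independent_imp_finite)
  have coeff: "(\<Sum>b\<in>D. c b *\<^sub>R b) \<bullet> d = c d" if "d \<in> D" for c d
  proof -
    have "(\<Sum>b\<in>D. c b *\<^sub>R b) \<bullet> d = (\<Sum>b\<in>D. if b = d then c d else 0)"
      unfolding inner_sum_left using D(2,3) that
      by (intro sum.cong) (auto simp: pairwise_def orthogonal_def norm_eq_1)
    then show ?thesis using fD that by simp
  qed
  have ext: "f u = f' u" if "linear f" "linear f'" "\<And>b. b \<in> D \<Longrightarrow> f b = f' b" "u \<in> W" for f f' :: "'e \<Rightarrow> real" and u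
    using linear_eq_on_span[OF that(1,2), of D u] that D(5) by blast
  define L where "L w = (\<Sum>b\<in>D. ip b w *\<^sub>R b)" for w
  have L: "linear L"
    unfolding L_def using lin(2)
    by (intro linearI) (simp_all add: linear_add linear_scale scaleR_add_left sum.distrib scaleR_sum_right)
  have sums_W: "(\<Sum>b\<in>D. c b *\<^sub>R b) \<in> W" for c
    using D(1) W by (auto intro!: subspace_sum subspace_scale)
  have "inj_on L W"
    unfolding linear_inj_on_iff_eq_0[OF L W]
  proof (intro ballI impI)
    fix w assume w: "w \<in> W" "L w = 0"
    then have "ip b w = 0" if "b \<in> D" for b using coeff[OF that, of "\<lambda>b. ip b w"] by (simp add: L_def)
    then have "ip w w = 0" using ext[OF lin(1) linear_zero, of w w] w(1) by simp
    then show "w = 0" using nondeg w by blast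
  qed
  then have "dim (L ` W) = dim W" using dim_image_eq[OF L] W by (metis span_eq_iff)
  moreover have "L ` W \<subseteq> W" using sums_W by (auto simp: L_def)
  ultimately have LW: "L ` W = W"
    by (intro subspace_dim_equal) (auto intro: linear_subspace_image[OF L] W)
  obtain w where w: "w \<in> W" "L w = (\<Sum>b\<in>D. \<phi> b *\<^sub>R b)" using sums_W[of \<phi>] LW by (metis imageE)
  have "\<phi> b = ip b w" if "b \<in> D" for b
    using coeff[OF that, of \<phi>] coeff[OF that, of "\<lambda>b. ip b w"] w(2) by (simp add: L_def)
  then show "\<exists>w. w \<in> W \<and> (\<forall>u\<in>W. \<phi> u = ip u w)"
    using w(1) ext[OF \<phi> lin(1)] by blast
next
  have lin: "linear (ip x)" for x using bil by (auto simp: bilinear_def)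
  fix w w' assume w: "w \<in> W \<and> (\<forall>u\<in>W. \<phi> u = ip u w)" "w' \<in> W \<and> (\<forall>u\<in>W. \<phi> u = ip u w')"
  then have "w - w' \<in> W" using W by (auto intro: subspace_diff)
  with w have "ip (w - w') (w - w') = 0" by (simp add: linear_diff[OF lin])
  with \<open>w - w' \<in> W\<close> show "w = w'" using nondeg by fastforce
qed

section \<open>The simplicial coboundary\<close>

lemma subspace_cochains: "subspace (cochains K k)"
  by (auto simp: subspace_def cochains_def) (metis add_0)+

lemma linear_coboundary: "linear (coboundary K k)"
  by (rule linearI)
    (auto simp: coboundary_def vec_eq_iff sum.distrib[symmetric] sum_distrib_left algebra_simps intro!: sum.cong)

lemma coboundary_in_cochains: "coboundary K k u \<in> cochains K (k + 1)"
  by (auto simp: coboundary_def cochains_def split: if_splits)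

text \<open>On an ordered triangle \<open>a < b < c\<close> the differences of \<open>u\<close>
  along the three edges cancel.\<close>

lemma coboundary_coboundary:
  assumes "simplicial_cplx K"
  shows "coboundary K 1 (coboundary K 0 u) = 0"
  unfolding vec_eq_iff
proof
  fix s :: "'a set"
  show "coboundary K 1 (coboundary K 0 u) $ s = 0 $ s"
  proof (cases "s \<in> K \<and> card s = 3")
    case True
    define l where "l = sorted_list_of_set s"
    have l: "length l = 3" "distinct l" "set l = s" "sorted l" using True by (auto simp: l_def)
    then obtain a b c where abc: "l = [a, b, c]"
      by (auto simp: numeral_3_eq_3 length_Suc_conv)
    have lt: "a < b" "b < c" using l abc by (auto simp: less_le)
    have s: "s = {a, b, c}" using l abc by auto
    \<comment> \<open>Closure of \<open>K\<close> under faces puts the edge into \<open>K\<close>;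
      otherwise \<open>coboundary\<close> would take its default value 0 there.\<close>
    have edge: "coboundary K 0 u $ {x, y} = u $ {y} - u $ {x}" if "x < y" "{x, y} \<subseteq> s" for x y
    proof -
      have "{x, y} \<in> K" using assms True that unfolding simplicial_cplx_def by blast
      moreover have "sorted_list_of_set {x, y} = [x, y]"
        using that by (intro sorted_list_of_set_unique[THEN iffD1]) auto
      moreover have "{x, y} - {x} = {y}" "{x, y} - {y} = {x}" "card {x, y} = 2" using that by auto
      ultimately show ?thesis by (simp add: coboundary_def numeral_2_eq_2)
    qed
    have faces: "s - {a} = {b, c}" "s - {b} = {a, c}" "s - {c} = {a, b}" using lt s by auto
    have exp: "coboundary K 1 w $ s = w $ (s - {a}) - w $ (s - {b}) + w $ (s - {c})" for w
      using True by (simp add: coboundary_def abc[unfolded l_def] eval_nat_numeral lessThan_Suc)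
    have "coboundary K 1 (coboundary K 0 u) $ s
        = coboundary K 0 u $ (s - {a}) - coboundary K 0 u $ (s - {b}) + coboundary K 0 u $ (s - {c})"
      by (rule exp)
    also have "\<dots> = 0"
      unfolding faces using lt s by (simp add: edge)
    finally show ?thesis by simp
  next
    case False
    then have "coboundary K 1 w $ s = 0" for w
      by (auto simp: coboundary_def numeral_3_eq_3)
    then show ?thesis by simp
  qed
qed

section \<open>Whitney inner products, adjoints and the orthogonal splitting\<close>

context triangulated_manifold
begin

abbreviation ip :: "nat \<Rightarrow> 'v cochain \<Rightarrow> 'v cochain \<Rightarrow> real" where
  "ip \<equiv> whitney_ip A g K h"

abbreviation \<delta> :: "nat \<Rightarrow> 'v cochain \<Rightarrow> 'v cochain" where
  "\<delta> \<equiv> coboundary K"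

definition integrand :: "nat \<Rightarrow> 'v cochain \<Rightarrow> 'v cochain \<Rightarrow> 'v set \<Rightarrow> real^3 \<Rightarrow> real" where
  "integrand k u v T x = form_inner k (tet_metric A g h T x) (whitney K k u T x) (whitney K k v T x)
     * sqrt (det (tet_metric A g h T x))"

lemma ip_integrand: "ip k u v = (\<Sum>T | T \<in> K \<and> card T = 4. LINT x:std_tet_interior|lborel. integrand k u v T x)"
  by (simp add: whitney_ip_def integrand_def)

lemma tame_integrand:
  assumes "T \<in> K" "card T = 4"
  shows "tame (integrand k u v T)"
proof -
  have "tame (\<lambda>x. sqrt (det (tet_metric A g h T x)))"
    by (rule tame_tet_metric[OF assms]) (intro continuous_intros continuous_on_det)
  moreover have "tame (\<lambda>x. matrix_inv (tet_metric A g h T x) $ i $ j)" for i j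
    by (rule tame_tet_metric[OF assms continuous_on_matrix_inv_component])
  moreover have "tame (\<lambda>x. whitney K k w T x ws)" for w ws
    by (rule tame_continuous) (rule whitney_continuous)
  ultimately show ?thesis
    unfolding integrand_def[abs_def] form_inner_def
    by (intro tame_mult tame_sum tame_prod tame_const)
qed

lemmas integrable_integrand = tame_set_integrable[OF tame_integrand]

text \<open>Symmetry holds pointwise through the symmetry of the inverse Gram matrix, which is known
  in the interior, where the integral is taken.\<close>

lemma ip_commute: "ip k u v = ip k v u"
  unfolding ip_integrand
proof (intro sum.cong refl set_lebesgue_integral_cong)
  fix T assume "T \<in> {T \<in> K. card T = 4}"
  then show "\<forall>x. x \<in> std_tet_interior \<longrightarrow> integrand k u v T x = integrand k v u T x"
    unfolding integrand_def using form_inner_commute pos_def_tet_metric by simp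
qed (use open_std_tet_interior in simp)

lemma linear_ip_left: "linear (\<lambda>u. ip k u v)"
proof (rule linearI)
  fix u u' :: "'v cochain" and c :: real
  have w: "whitney K k (u + u') T x = (\<lambda>ws. whitney K k u T x ws + whitney K k u' T x ws)"
    "whitney K k (c *\<^sub>R u) T x = (\<lambda>ws. c * whitney K k u T x ws)" for T x
    by (intro ext whitney_add whitney_scale)+
  have "integrand k (u + u') v T = (\<lambda>x. integrand k u v T x + integrand k u' v T x)" for T
    by (simp add: fun_eq_iff integrand_def w form_inner_add distrib_right)
  \<comment> \<open>Additivity of the integral is where the finiteness of the Whitney integrals
    enters.\<close>
  then show "ip k (u + u') v = ip k u v + ip k u' v"
    unfolding ip_integrand sum.distrib[symmetric]
    by (intro sum.cong refl) (simp add: set_integral_add(2) integrable_integrand)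
  have "integrand k (c *\<^sub>R u) v T = (\<lambda>x. c * integrand k u v T x)" for T
    by (simp add: fun_eq_iff integrand_def w form_inner_scale mult.assoc)
  then show "ip k (c *\<^sub>R u) v = c *\<^sub>R ip k u v"
    unfolding ip_integrand by (simp add: sum_distrib_left)
qed

lemma bilinear_ip: "bilinear (ip k)"
proof -
  have "ip k u = (\<lambda>v. ip k v u)" for u using ip_commute by blast
  then show ?thesis unfolding bilinear_def using linear_ip_left by metis
qed

text \<open>Every vertex and every edge lies in a tetrahedron, and the cochain is read off from its Whitney
  form at the vertices of that tetrahedron.\<close>

lemma ip_definite:
  assumes k: "k = 0 \<or> k = 1" and u: "u \<in> cochains K k" and z: "ip k u u = 0"
  shows "u = 0"
proof -
  have nn: "0 \<le> form_inner k G \<omega> \<omega>" if "pos_def G" for G \<omega>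
    using k
  proof
    assume "k = 1"
    let ?w = "\<chi> i. \<omega> [axis i 1]"
    have "0 \<le> ?w \<bullet> (matrix_inv G *v ?w)"
      using pos_def_matrix_inv[OF that] by (cases "?w = 0") (auto simp: pos_def_def less_imp_le)
    then show ?thesis unfolding \<open>k = 1\<close> form_inner_1 .
  qed (simp add: form_inner_0)
  have inn: "0 \<le> integrand k u u T x" if "T \<in> K" "card T = 4" "x \<in> std_tet_interior" for T x
    using nn[OF pos_def_tet_metric[OF that]] pos_def_det_pos[OF pos_def_tet_metric[OF that]]
    by (simp add: integrand_def)
  have "0 \<le> (LINT x:std_tet_interior|lborel. integrand k u u T x)" if "T \<in> K" "card T = 4" for T
    using inn[OF that] unfolding set_lebesgue_integral_def
    by (intro integral_nonneg_AE AE_I2) (simp add: indicator_def)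
  then have zT: "(LINT x:std_tet_interior|lborel. integrand k u u T x) = 0" if "T \<in> K" "card T = 4" for T
    using z that unfolding ip_integrand by (subst (asm) sum_nonneg_eq_0_iff) auto
  have form0: "form_inner k (tet_metric A g h T x) (whitney K k u T x) (whitney K k u T x) = 0"
    if T: "T \<in> K" "card T = 4" and x: "x \<in> std_tet_interior" for T x
  proof -
    have "integrand k u u T x = 0"
      by (rule tame_integral_eq_0[OF tame_integrand[OF T] inn[OF T] zT[OF T] x])
    then show ?thesis using pos_def_det_pos[OF pos_def_tet_metric[OF T x]] by (simp add: integrand_def)
  qed
  have "u $ s = 0" if s: "s \<in> K" "card s = k + 1" for s
  proof -
    have "card s \<le> 4" using s(2) k by auto
    then obtain T where T: "T \<in> K" "card T = 4" "s \<subseteq> T" by (rule in_tetrahedron[OF s(1)])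
    interpret tetrahedron T by standard (rule T)
    show ?thesis
    proof (cases "k = 0")
      case True
      then obtain v where v: "s = {v}" using s(2) by (auto simp: card_1_singleton_iff)
      obtain i where i: "i < 4" "v = vtx i" using vtx_cases T(3) v by blast
      have "whitney K 0 u T x [] = 0" if "x \<in> std_tet_interior" for x
        using form0[OF T(1,2) that] True by (simp add: form_inner_0)
      then have "whitney K 0 u T (pt i) [] = 0"
        by (rule zero_on_std_tet[OF whitney_continuous _ pt_in_std_tet])
      then show ?thesis using whitney_0_pt[of i K u] i s(1) v by simp
    next
      case False
      then have k1: "k = 1" using k by simp
      then have "card s = 2" using s(2) by simp
      then obtain a b where ab: "a < b" "s = {a, b}" by (rule card_2_sorted_list)
      obtain i where i: "i < 4" "a = vtx i" using vtx_cases T(3) ab by blast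
      obtain j where j: "j < 4" "b = vtx j" using vtx_cases T(3) ab by blast
      have "whitney K 1 u T x [axis m 1] = 0" if x: "x \<in> std_tet_interior" for x m
      proof -
        let ?w = "\<chi> i. whitney K 1 u T x [axis i 1]"
        have "?w \<bullet> (matrix_inv (tet_metric A g h T x) *v ?w) = 0"
          using form0[OF T(1,2) x] unfolding k1 form_inner_1 .
        then have "?w = 0"
          using pos_def_matrix_inv[OF pos_def_tet_metric[OF T(1,2) x]] unfolding pos_def_def
          by (metis less_irrefl)
        then show ?thesis by (simp add: vec_eq_iff)
      qed
      \<comment> \<open>The vertex is a boundary point, so the vanishing in the interior reaches it
        by continuity.\<close>
      then have "whitney K 1 u T (pt i) [axis m 1] = 0" for m
        by (rule zero_on_std_tet[OF whitney_continuous _ pt_in_std_tet])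
      \<comment> \<open>Linearity passes from the coordinate vectors to the edge vector
        \<open>pt j - pt i\<close>.\<close>
      then have "(\<lambda>w. whitney K 1 u T (pt i) [w]) = (\<lambda>w. 0)"
        by (intro linear_eq_stdbasis whitney_1_linear linear_zero) (auto simp: Basis_vec_def)
      then have "whitney K 1 u T (pt i) [pt j - pt i] = 0" by metis
      then show ?thesis using whitney_1_pt[of i j K u] i j s(1) ab by simp
    qed
  qed
  then show "u = 0" using u by (auto simp: cochains_def vec_eq_iff)
qed

text \<open>Definiteness enters in the degree of the result, \<open>k\<close>, where it makes the
  Riesz representative unique; in degree \<open>k + 1\<close> linearity suffices.\<close>

lemma coboundary_adj:
  assumes k: "k = 0 \<or> k = 1"
  shows "coboundary_adj A g K h k v \<in> cochains K k"
    and "u \<in> cochains K k \<Longrightarrow> ip (k + 1) (\<delta> k u) v = ip k u (coboundary_adj A g K h k v)"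
proof -
  have "linear (\<lambda>u. ip (k + 1) (\<delta> k u) v)"
    using linear_compose[OF linear_coboundary linear_ip_left] by (simp add: o_def)
  then have "\<exists>!w. w \<in> cochains K k \<and> (\<forall>u\<in>cochains K k. ip (k + 1) (\<delta> k u) v = ip k u w)"
    by (intro riesz_subspace bilinear_ip subspace_cochains ip_definite[OF k])
  from theI'[OF this, folded coboundary_adj_def]
  show "coboundary_adj A g K h k v \<in> cochains K k"
    and "u \<in> cochains K k \<Longrightarrow> ip (k + 1) (\<delta> k u) v = ip k u (coboundary_adj A g K h k v)" by blast+
qed

text \<open>For \<open>y = \<delta> 0 u\<close>, moving \<open>\<delta> 0\<close> across gives zero
  against a harmonic \<open>a\<close>, and moving the adjoint of \<open>\<delta> 1\<close> across
  gives the pairing of \<open>\<delta> 1 (\<delta> 0 u)\<close> with \<open>c\<close>.\<close>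

lemma V_g_orthogonal_V_p:
  assumes y: "y \<in> V_g K" and x: "x \<in> V_p A g K h"
  shows "ip 1 y x = 0"
proof -
  note lin = linear_0[OF linear_ip_left] linear_add[OF linear_ip_left]
  obtain u where u: "u \<in> cochains K 0" "y = \<delta> 0 u" using y by (auto simp: V_g_def)
  obtain a c where ac: "x = a + coboundary_adj A g K h 1 c" "coboundary_adj A g K h 0 a = 0"
    using x by (auto simp: V_p_def harmonic1_def)
  have "ip 1 y a = ip 0 u 0" using coboundary_adj(2)[of 0 u a] u ac by simp
  also have "\<dots> = 0" using lin(1) by (simp add: ip_commute[of 0 u 0])
  finally have 1: "ip 1 y a = 0" .
  have "y \<in> cochains K 1" using coboundary_in_cochains[of K 0 u] u by simp
  then have "ip 1 y (coboundary_adj A g K h 1 c) = ip 2 (\<delta> 1 y) c"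
    using coboundary_adj(2)[of 1 y c] by (simp add: numeral_2_eq_2)
  also have "\<delta> 1 y = 0"
    using coboundary_coboundary[of K u] u triangulation by (simp add: smooth_triangulation_def)
  finally have 2: "ip 1 y (coboundary_adj A g K h 1 c) = 0" using lin(1) by simp
  have "ip 1 y x = ip 1 x y" by (rule ip_commute)
  also have "\<dots> = ip 1 a y + ip 1 (coboundary_adj A g K h 1 c) y" unfolding ac(1) by (rule lin(2))
  finally show ?thesis using 1 2 ip_commute[of 1 y a] ip_commute[of 1 y "coboundary_adj A g K h 1 c"] by simp
qed

lemma orthogonal_pair_V_p_V_g:
  assumes B: "orthonormal_basis_of (ip 1) (V_p A g K h) B" and C: "orthonormal_basis_of (ip 1) (V_g K) C"
  shows "orthogonal_pair (ip 1) B C (P_p A g K h)"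
proof -
  note lin = linear_diff[OF linear_ip_left] linear_add[OF linear_ip_left]
  have B': "finite B" "span B = V_p A g K h" "\<And>b b'. b \<in> B \<Longrightarrow> b' \<in> B \<Longrightarrow> ip 1 b b' = of_bool (b = b')"
    and C': "finite C" "span C = V_g K" "\<And>b b'. b \<in> C \<Longrightarrow> b' \<in> C \<Longrightarrow> ip 1 b b' = of_bool (b = b')"
    using B C by (auto simp: orthonormal_basis_of_def)
  have cross: "ip 1 c b = 0" "ip 1 b c = 0" if "b \<in> B" "c \<in> C" for b c
    using V_g_orthogonal_V_p[of c b] that B'(2) C'(2) span_base ip_commute by metis+
  have disj: "B \<inter> C = {}" using cross B'(3) by fastforce
  interpret B: orthonormal_system "ip 1" B by standard (use bilinear_ip B' in auto)
  show ?thesis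
  proof
    fix b b' assume "b \<in> B \<union> C" "b' \<in> B \<union> C"
    then show "ip 1 b b' = of_bool (b = b')" using B'(3) C'(3) cross disj by auto
  next
    fix x y assume x: "x \<in> span B" and y: "y \<in> span C"
    show "P_p A g K h (x + y) = x"
      unfolding P_p_def B'(2)[symmetric]
    proof (rule the_equality)
      show "x \<in> span B \<and> (\<forall>z\<in>span B. ip 1 (x + y - x) z = 0)"
        using x y V_g_orthogonal_V_p B'(2) C'(2) by simp
      fix x' assume x': "x' \<in> span B \<and> (\<forall>z\<in>span B. ip 1 (x + y - x') z = 0)"
      show "x' = x"
      \<comment> \<open>As \<open>y\<close> is orthogonal to \<open>B\<close>, any candidate has the
        same coordinates along \<open>B\<close> as \<open>x\<close>.\<close>
      proof (rule B.span_eqI)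
        fix b assume b: "b \<in> B"
        then have "ip 1 (x + y - x') b = 0" "ip 1 y b = 0"
          using x' span_base[OF b] V_g_orthogonal_V_p y B'(2) C'(2) by auto
        then show "ip 1 x' b = ip 1 x b" by (simp add: lin)
      qed (use x x' in auto)
    qed
  qed (use bilinear_ip B' C' disj in auto)
qed

end

theorem proposition6:
  fixes M :: "'m::t2_space set"
    and A :: "'m chart set"
    and g :: "'m chart \<Rightarrow> 'm \<Rightarrow> real^3^3"
    and K :: "'v::{finite,linorder} set set"
    and h :: "(real, 'v) vec \<Rightarrow> 'm"
    and B C :: "'v cochain set"
    and \<mu>0 \<nu>0 :: "'v cochain measure"
  assumes "closed_oriented_3manifold M A"
    and "riemannian_metric A g"
    and "smooth_triangulation M A K h"
    and "orthonormal_basis_of (whitney_ip A g K h 1) (V_p A g K h) B"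
    and "orthonormal_basis_of (whitney_ip A g K h 1) (V_g K) C"
    and "nondegenerate_gaussian (whitney_ip A g K h 1) B \<mu>0"
    and "nondegenerate_gaussian (whitney_ip A g K h 1) B \<nu>0"
  defines "Ext \<equiv> Ext_G (whitney_ip A g K h 1) B C (P_p A g K h)"
    and "cond \<equiv> cond_dist B C (P_p A g K h)"
  shows "(\<exists>\<mu>\<in>Ext \<mu>0. \<exists>\<nu>\<in>Ext \<nu>0. rel_entropy \<mu> \<nu> = rel_entropy \<mu>0 \<nu>0) \<and>
    (\<forall>\<mu>\<in>Ext \<mu>0. \<forall>\<nu>\<in>Ext \<nu>0. rel_entropy \<mu>0 \<nu>0 \<le> rel_entropy \<mu> \<nu>) \<and>
    (\<forall>\<mu>\<in>Ext \<mu>0. \<forall>\<nu>\<in>Ext \<nu>0.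
       is_arg_min (\<lambda>(\<mu>, \<nu>). rel_entropy \<mu> \<nu>) (\<lambda>(\<mu>, \<nu>). \<mu> \<in> Ext \<mu>0 \<and> \<nu> \<in> Ext \<nu>0) (\<mu>, \<nu>)
       \<longleftrightarrow> (AE x in \<mu>0. cond \<mu> x = cond \<nu> x))"
proof -
  interpret triangulated_manifold M A g K h by standard (use assms in auto)
  interpret orthogonal_pair "whitney_ip A g K h 1" B C "P_p A g K h"
    by (rule orthogonal_pair_V_p_V_g) (use assms in auto)
  have attained: "\<exists>\<mu>\<in>Ext \<mu>0. \<exists>\<nu>\<in>Ext \<nu>0. rel_entropy \<mu> \<nu> = rel_entropy \<mu>0 \<nu>0"
    unfolding Ext_def by (rule rel_entropy_minimum) (use assms in auto)
  have bound: "rel_entropy \<mu>0 \<nu>0 \<le> rel_entropy \<mu> \<nu>"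
    and eq: "rel_entropy \<mu> \<nu> = rel_entropy \<mu>0 \<nu>0 \<longleftrightarrow> (AE x in \<mu>0. cond \<mu> x = cond \<nu> x)"
    if "\<mu> \<in> Ext \<mu>0" "\<nu> \<in> Ext \<nu>0" for \<mu> \<nu>
    using rel_entropy_Ext_G[of \<mu> \<mu>0 \<nu> \<nu>0] that assms(6,7) unfolding Ext_def cond_def by blast+
  \<comment> \<open>As the lower bound is attained by some pair, a pair is a minimizer exactly when
    its value equals the bound.\<close>
  have "is_arg_min (\<lambda>(\<mu>, \<nu>). rel_entropy \<mu> \<nu>) (\<lambda>(\<mu>, \<nu>). \<mu> \<in> Ext \<mu>0 \<and> \<nu> \<in> Ext \<nu>0) (\<mu>, \<nu>)
      \<longleftrightarrow> rel_entropy \<mu> \<nu> = rel_entropy \<mu>0 \<nu>0" if mn: "\<mu> \<in> Ext \<mu>0" "\<nu> \<in> Ext \<nu>0" for \<mu> \<nu>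
  proof -
    obtain \<mu>' \<nu>' where w: "\<mu>' \<in> Ext \<mu>0" "\<nu>' \<in> Ext \<nu>0" "rel_entropy \<mu>' \<nu>' = rel_entropy \<mu>0 \<nu>0"
      using attained by blast
    have "is_arg_min (\<lambda>(\<mu>, \<nu>). rel_entropy \<mu> \<nu>) (\<lambda>(\<mu>, \<nu>). \<mu> \<in> Ext \<mu>0 \<and> \<nu> \<in> Ext \<nu>0) (\<mu>, \<nu>)
        \<longleftrightarrow> (\<forall>\<mu>'\<in>Ext \<mu>0. \<forall>\<nu>'\<in>Ext \<nu>0. rel_entropy \<mu> \<nu> \<le> rel_entropy \<mu>' \<nu>')"
      using mn by (auto simp: is_arg_min_def not_less)
    also have "\<dots> \<longleftrightarrow> rel_entropy \<mu> \<nu> = rel_entropy \<mu>0 \<nu>0"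
      using w bound mn by (metis order_antisym)
    finally show ?thesis .
  qed
  with attained bound eq show ?thesis by simp
qed

end
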